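(* Let $W$ be a random variable with values in $(0,1)$ such that the distribution of $|\log W|$ is non-lattice. Put $\mu:=\mathbb{E}|\log W|\in(0,\infty]$ and $\nu:=\mathbb{E}|\log(1-W)|\in(0,\infty]$, and let $L_n$ be the number of empty boxes within the occupancy range when $n$ balls are allocated by the Bernoulli sieve driven by $W$. Then the expectation $\mathbb{E}L_n$ exhibits the following asymptotic behaviour. (i) If $\mu=\infty$ and $\nu=\infty$, then $$\liminf_{n\to\infty}\frac{\mathbb{E}W^n}{\mathbb{E}(1-W)^n}\le \liminf_{n\to\infty}\mathbb{E}L_n\le\limsup_{n\to\infty}\mathbb{E}L_n\le\limsup_{n\to\infty}\frac{\mathbb{E}W^n}{\mathbb{E}(1-W)^n}.$$ In particular, if $\lim_{n\to\infty}\frac{\mathbb{E}W^n}{\mathbb{E}(1-W)^n}=\gamma_0\in[0,\infty]$, then $\lim_{n\to\infty}\mathbb{E}L_n=\gamma_0$. (ii) If $\nu<\infty$ and $\mu\le\infty$, then $\lim_{n\to\infty}\mathbb{E}L_n=\nu/\mu$ (interpreted as $0$ when $\mu=\infty$). (iii) If $\mu<\infty$ and $\nu=\infty$, then, as $n\to\infty$, $$\mathbb{E}L_n\sim\frac{1}{\mu}\int_1^n\frac{\mathbb{E}e^{-y(1-W)}}{y}\,dy,$$ where $a_n\sim b_n$ means $a_n/b_n\to1$.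
   Context: Bernoulli sieve: let $W_1,W_2,\dots$ be independent copies of $W$. The random frequencies of the boxes $k=1,2,\dots$ are $p_k:=W_1W_2\cdots W_{k-1}(1-W_k)$; they are positive and sum to $1$ almost surely. Given $(W_k)$, balls $1,2,\dots$ are thrown independently, each falling in box $k$ with probability $p_k$. (Equivalently, with $Q_0=1$ and $Q_k=W_1\cdots W_k$, and $U_1,U_2,\dots$ i.i.d. uniform on $[0,1]$ independent of $(W_k)$, ball $i$ falls in box $k$ iff $U_i\in(Q_k,Q_{k-1})$.) For the first $n$ balls, $K_n$ is the number of boxes containing at least one ball, $M_n$ is the maximal index of an occupied box, and $L_n:=M_n-K_n$ is the number of empty boxes with index at most $M_n$. The distribution of $|\log W|$ is non-lattice if it is not concentrated on $d\mathbb{Z}$ for any $d>0$. *)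

theory Defs
  imports "HOL-Probability.Probability"
begin

text \<open>
  Boxes, balls and the factors \<open>Ws k\<close> are all indexed from 1; \<open>Ws 0\<close> and \<open>X 0\<close> are never used.
  \<open>X i \<omega>\<close> is the box into which ball \<open>i\<close> falls.
\<close>

definition box_freq :: "(nat \<Rightarrow> 'a \<Rightarrow> real) \<Rightarrow> nat \<Rightarrow> 'a \<Rightarrow> real" where
  "box_freq Ws k \<omega> = (\<Prod>j\<in>{1..<k}. Ws j \<omega>) * (1 - Ws k \<omega>)"

definition factor_algebra :: "'a measure \<Rightarrow> (nat \<Rightarrow> 'a \<Rightarrow> real) \<Rightarrow> 'a measure" where
  "factor_algebra M Ws =
     vimage_algebra (space M) (\<lambda>\<omega>. \<lambda>k\<in>{1..}. Ws k \<omega>) (\<Pi>\<^sub>M k\<in>{1..}. borel)"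

text \<open>
  The last assumption says that, conditionally on \<open>(Ws k)\<close>, the balls are thrown independently,
  each falling into box \<open>k\<close> with probability \<open>box_freq Ws k\<close>.
\<close>

locale bernoulli_sieve = prob_space M
  for M :: "'a measure" and W :: "'a \<Rightarrow> real"
    and Ws :: "nat \<Rightarrow> 'a \<Rightarrow> real" and X :: "nat \<Rightarrow> 'a \<Rightarrow> nat" +
  assumes W_measurable: "random_variable borel W"
    and W_range: "AE \<omega> in M. W \<omega> \<in> {0<..<1}"
    and Ws_indep: "indep_vars (\<lambda>_. borel) Ws {1..}"
    and Ws_distr: "\<And>k. k \<ge> 1 \<Longrightarrow> distr M borel (Ws k) = distr M borel W"
    and X_measurable: "\<And>i. i \<ge> 1 \<Longrightarrow> random_variable (count_space {1..}) (X i)"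
    and X_cond_law: "\<And>n b. (\<And>i. i \<in> {1..n} \<Longrightarrow> b i \<ge> 1) \<Longrightarrow>
      AE \<omega> in M. real_cond_exp M (factor_algebra M Ws)
          (indicator {\<omega> \<in> space M. \<forall>i\<in>{1..n}. X i \<omega> = b i}) \<omega>
        = (\<Prod>i\<in>{1..n}. box_freq Ws (b i) \<omega>)"

definition num_occupied :: "(nat \<Rightarrow> 'a \<Rightarrow> nat) \<Rightarrow> nat \<Rightarrow> 'a \<Rightarrow> nat" where
  "num_occupied X n \<omega> = card ((\<lambda>i. X i \<omega>) ` {1..n})"

text \<open>Only meaningful for \<open>n \<ge> 1\<close>.\<close>

definition max_occupied :: "(nat \<Rightarrow> 'a \<Rightarrow> nat) \<Rightarrow> nat \<Rightarrow> 'a \<Rightarrow> nat" where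
  "max_occupied X n \<omega> = Max ((\<lambda>i. X i \<omega>) ` {1..n})"

text \<open>The subtraction does not truncate for \<open>n \<ge> 1\<close>: the occupied boxes lie in
  \<open>{1..max_occupied X n \<omega>}\<close>.\<close>

definition num_empty :: "(nat \<Rightarrow> 'a \<Rightarrow> nat) \<Rightarrow> nat \<Rightarrow> 'a \<Rightarrow> nat" where
  "num_empty X n \<omega> = max_occupied X n \<omega> - num_occupied X n \<omega>"

text \<open>Expectations of nonnegative variables are taken in \<open>[0,\<infinity>]\<close>, so no integrability
  convention enters.\<close>

definition expected_empty :: "'a measure \<Rightarrow> (nat \<Rightarrow> 'a \<Rightarrow> nat) \<Rightarrow> nat \<Rightarrow> ennreal" where
  "expected_empty M X n = (\<integral>\<^sup>+ \<omega>. of_nat (num_empty X n \<omega>) \<partial>M)"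

definition non_lattice :: "real measure \<Rightarrow> bool" where
  "non_lattice D \<longleftrightarrow> (\<forall>d>0. \<not> (AE x in D. x \<in> range (\<lambda>k::int. d * of_int k)))"

end

theory Submission
  imports Defs
begin

text \<open>
  Let \<open>N\<^sub>k\<close> be the number of the first \<open>n\<close> balls that miss the boxes \<open>1, \<dots>, k\<close>; this is a decreasing
  Markov chain on the naturals. With \<open>b m = E W ^ m\<close>, \<open>c m = E (1 - W) ^ m\<close> and \<open>U n m\<close> the expected
  number of visits of \<open>m\<close>, an empty box within the range is a stay at some \<open>m \<ge> 1\<close>, and the last
  occupied box is a jump from some \<open>m \<ge> 1\<close> to \<open>0\<close>. So \<open>E L\<^sub>n = \<Sum>m. U n m * b m\<close> while
  \<open>\<Sum>m. U n m * c m = 1\<close>. Moreover \<open>\<Sum>m. b m / m = \<nu>\<close> and \<open>\<Sum>m. c m / m = \<mu>\<close>.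

  The key fact is the renewal theorem \<open>m * U n m \<longlonglongrightarrow> 1 / \<mu>\<close>. Removing a random ball shows that
  \<open>n * (U n m - U (n - 1) m) = m * U n m - (m + 1) * U n (m + 1)\<close>, so that \<open>U n m\<close> is Lipschitz in
  \<open>log n\<close>. If \<open>U n 1\<close> is close to its upper limit at \<open>n\<close>, then by harmonicity also at \<open>w * n\<close> for
  every \<open>w\<close> in the support of \<open>W\<close>, hence, as \<open>\<bar>log W\<bar>\<close> is non-lattice, on \<open>t * n\<close> for all small \<open>t\<close>.
  There the logarithmic derivative above is small, so \<open>m * U\<close> takes the same value for all \<open>m\<close>, and
  \<open>\<Sum>m. U n m * c m = 1\<close> identifies that value as \<open>1 / \<mu>\<close>. The same holds for the lower limit.

  Part (i) holds because \<open>E L\<^sub>n\<close> is the average of \<open>b m / c m\<close> with weights \<open>U n m * c m\<close>, which escape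
  to infinity if \<open>\<mu> = \<infinity>\<close>. Part (ii) follows by dominated convergence, as the expected number of visits
  to a dyadic block is bounded. Part (iii) follows by Abel summation from bounds for the expected number
  of visits to \<open>{1..m}\<close>.
\<close>

subsection \<open>Bernstein polynomials\<close>

text \<open>The chain smears \<open>\<bar>log W\<bar>\<close> binomially, so no renewal theorem for
  its partial sums is quoted; the limit is found on the integers from two facts:
  \<open>U n m\<close> is harmonic in \<open>n\<close> beyond \<open>m\<close>, and both it and its
  logarithmic derivative are Lipschitz in \<open>log n\<close>. The derivative is small wherever
  \<open>U\<close> is nearly constant because a Lipschitz derivative cannot be large without moving
  the function over a short window. If \<mu> is infinite, the upper limit alone decides: finitely
  many terms of the identity for \<open>c\<close> force it to be at most 0, and \<open>U\<close> is
  nonnegative.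

  The obstacle in part (iii) is uniformity: the renewal theorem fixes \<open>m\<close>, whereas the
  sum over \<open>m \<le> n\<close> of \<open>b m / m\<close> diverges, so no fixed range dominates.
  Visits to \<open>{1..m}\<close> are therefore counted directly. Started at \<open>m\<close>, their
  expected number is exactly the sum of \<open>U i 1 / i\<close> over \<open>i \<le> m\<close>. The
  maximum principle turns this into an upper bound for every start; for the lower bound, finite
  \<mu> makes it unlikely that the walk jumps from above \<open>m\<close> to far below
  \<open>m\<close>.\<close>

lemma Bernstein_eq_0: "n < m \<Longrightarrow> Bernstein n m x = 0"
  by (simp add: Bernstein_def)

text \<open>Composition of binomial thinnings: keeping each of \<open>n\<close> balls with
  probability \<open>x\<close>, and each survivor with probability \<open>y\<close>, keeps a ball
  with probability \<open>x * y\<close>. The Markov property of the chain rests on this.\<close>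

lemma Bernstein_mult:
  "Bernstein n m (x * y) = (\<Sum>j\<le>n. Bernstein n j x * Bernstein j m y)"
proof (cases "m \<le> n")
  case False
  then show ?thesis by (auto simp: Bernstein_eq_0 intro!: sum.neutral)
next
  case True
  have "(\<Sum>j\<le>n. Bernstein n j x * Bernstein j m y) = (\<Sum>j\<in>{m..n}. Bernstein n j x * Bernstein j m y)"
    by (rule sum.mono_neutral_right) (auto simp: Bernstein_def)
  also have "\<dots> = (\<Sum>i\<le>n - m. Bernstein n (i + m) x * Bernstein (i + m) m y)"
    by (rule sum.reindex_bij_witness[where i = "\<lambda>i. i + m" and j = "\<lambda>i. i - m"])
       (use True in auto)
  also have "\<dots> = (\<Sum>i\<le>n - m. real (n choose m) * (x * y) ^ m *
      (real ((n - m) choose i) * (x * (1 - y)) ^ i * (1 - x) ^ (n - m - i)))"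
  proof (rule sum.cong[OF refl])
    fix i assume "i \<in> {..n - m}"
    then have "i + m \<le> n" using True by auto
    have "(n choose (i + m)) * ((i + m) choose m) = (n choose m) * ((n - m) choose i)"
      using choose_mult[of m "i + m" n] \<open>i + m \<le> n\<close> by simp
    then have *: "real (n choose (i + m)) * real ((i + m) choose m)
        = real (n choose m) * real ((n - m) choose i)"
      by (metis of_nat_mult)
    have "Bernstein n (i + m) x * Bernstein (i + m) m y
        = (real (n choose (i + m)) * real ((i + m) choose m)) *
          ((x * y) ^ m * ((x * (1 - y)) ^ i * (1 - x) ^ (n - m - i)))"
      by (simp add: Bernstein_def power_add power_mult_distrib mult_ac add.commute)
    then show "Bernstein n (i + m) x * Bernstein (i + m) m y = real (n choose m) * (x * y) ^ m *
      (real ((n - m) choose i) * (x * (1 - y)) ^ i * (1 - x) ^ (n - m - i))"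
      unfolding * by (simp add: mult_ac)
  qed
  also have "\<dots> = real (n choose m) * (x * y) ^ m * (x * (1 - y) + (1 - x)) ^ (n - m)"
    by (simp add: binomial_ring sum_distrib_left)
  also have "\<dots> = Bernstein n m (x * y)"
    by (simp add: Bernstein_def algebra_simps)
  finally show ?thesis by simp
qed

text \<open>Delete a uniformly chosen ball out of \<open>n + 1\<close>. Then \<open>m\<close> marked
  balls are left if \<open>m\<close> were marked and an unmarked one goes, or if
  \<open>m + 1\<close> were marked and a marked one goes. Being linear in the polynomials, the
  relation survives expectations and sums over the boxes.\<close>

lemma Bernstein_Suc_diff:
  "real (Suc n) * (Bernstein (Suc n) m x - Bernstein n m x)
    = real m * Bernstein (Suc n) m x - real (Suc m) * Bernstein (Suc n) (Suc m) x"
proof (cases "m \<le> n")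
  case True
  have 1: "real (Suc m) * real (Suc n choose Suc m) = real (Suc n) * real (n choose m)"
    by (metis Suc_times_binomial of_nat_mult)
  have "Suc n * (n choose m) = (Suc n - m) * (Suc n choose m)"
    using True binomial_absorb_comp[of "Suc n" m] by simp
  then have 2: "(real (Suc n) - real m) * real (Suc n choose m) = real (Suc n) * real (n choose m)"
    using True by (metis of_nat_mult of_nat_diff le_SucI)
  have "(real (Suc n) - real m) * Bernstein (Suc n) m x + real (Suc m) * Bernstein (Suc n) (Suc m) x
    = ((real (Suc n) - real m) * real (Suc n choose m)) * x ^ m * (1 - x) ^ (Suc n - m)
      + (real (Suc m) * real (Suc n choose Suc m)) * x ^ Suc m * (1 - x) ^ (n - m)"
    by (simp add: Bernstein_def)
  also have "\<dots> = real (Suc n) * real (n choose m) * (x ^ m * (1 - x) ^ (n - m)) * ((1 - x) + x)"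
    unfolding 1 2 using True by (simp add: Suc_diff_le algebra_simps)
  also have "\<dots> = real (Suc n) * Bernstein n m x" by (simp add: Bernstein_def)
  finally show ?thesis by (simp add: algebra_simps)
next
  case False
  then have "m > n" by simp
  then consider "m = Suc n" | "m > Suc n" by linarith
  then show ?thesis
    by cases (auto simp: Bernstein_eq_0)
qed

text \<open>Generating function of the binomial law. It is evaluated at \<open>Ws (Suc k)\<close> to
  find empty boxes and at a number near 1 to bound large jumps.\<close>

lemma sum_Bernstein_power:
  "(\<Sum>j\<le>n. Bernstein n j x * y ^ j) = (1 - x * (1 - y)) ^ n"
proof -
  have "(\<Sum>j\<le>n. Bernstein n j x * y ^ j) = (x * y + (1 - x)) ^ n"
    by (simp add: binomial_ring Bernstein_def power_mult_distrib mult_ac)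
  also have "x * y + (1 - x) = 1 - x * (1 - y)" by (simp add: algebra_simps)
  finally show ?thesis .
qed

lemma exp_neg_le:
  fixes x :: real
  assumes "0 \<le> x" "x \<le> 1"
  shows "exp (- x) \<le> 1 - x / 2"
proof -
  have "x * x \<le> x * 1" using assms by (intro mult_left_mono) auto
  then have "1 \<le> (1 - x / 2) * (1 + x)" by (simp add: algebra_simps)
  also have "\<dots> \<le> (1 - x / 2) * exp x"
    using assms exp_ge_add_one_self[of x] by (intro mult_left_mono) auto
  finally show ?thesis by (simp add: exp_minus field_simps)
qed

subsection \<open>Additive semigroups of positive reals\<close>

text \<open>The group of differences of \<open>S\<close> contains \<open>S\<close>, so it is not cyclic, hence dense.\<close>

lemma semigroup_nonlattice_small_difference:
  fixes S :: "real set" and \<eta> :: real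
  assumes add: "\<And>x y. x \<in> S \<Longrightarrow> y \<in> S \<Longrightarrow> x + y \<in> S"
    and nonlat: "\<And>d. d > 0 \<Longrightarrow> \<not> S \<subseteq> range (\<lambda>k::int. d * of_int k)"
    and "S \<subseteq> {0<..}" "S \<noteq> {}" "\<eta> > 0"
  shows "\<exists>a\<in>S. \<exists>b\<in>S. 0 < b - a \<and> b - a < \<eta>"
proof (rule ccontr)
  assume neg: "\<not> ?thesis"
  define H where "H = {b - a |a b. a \<in> S \<and> b \<in> S}"
  have H_diff: "x - y \<in> H" if "x \<in> H" "y \<in> H" for x y
  proof -
    obtain a b where "x = b - a" "a \<in> S" "b \<in> S" using \<open>x \<in> H\<close> unfolding H_def by blast
    moreover obtain c d where "y = d - c" "c \<in> S" "d \<in> S" using \<open>y \<in> H\<close> unfolding H_def by blast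
    ultimately have "x - y = (b + c) - (a + d)" "b + c \<in> S" "a + d \<in> S" using add by auto
    then show ?thesis unfolding H_def by blast
  qed
  have "S \<subseteq> H"
  proof
    fix x assume "x \<in> S"
    have "x = (x + x) - x" by simp
    then show "x \<in> H" unfolding H_def using \<open>x \<in> S\<close> add[OF \<open>x \<in> S\<close> \<open>x \<in> S\<close>] by blast
  qed
  have gap: "x \<ge> \<eta>" if "x \<in> H" "x > 0" for x
    using that neg unfolding H_def by force
  define P where "P = {x \<in> H. x > 0}"
  have "P \<noteq> {}" using \<open>S \<subseteq> H\<close> \<open>S \<noteq> {}\<close> \<open>S \<subseteq> {0<..}\<close> unfolding P_def by auto
  have bdd: "bdd_below P" unfolding P_def by (rule bdd_belowI[of _ 0]) auto
  define d where "d = Inf P"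
  have "d \<ge> \<eta>" unfolding d_def using \<open>P \<noteq> {}\<close> gap by (intro cInf_greatest) (auto simp: P_def)
  \<comment> \<open>The infimum is attained: otherwise \<open>P\<close> would contain two points of
    \<open>[d, d + \<eta>)\<close>, whose difference is a positive element of \<open>H\<close> below
    \<eta>.\<close>
  have "d \<in> H"
  proof -
    obtain h where h: "h \<in> P" "h < d + \<eta>"
      using cInf_lessD[OF \<open>P \<noteq> {}\<close>, of "d + \<eta>"] \<open>\<eta> > 0\<close> unfolding d_def by auto
    have "h \<le> d"
    proof (rule ccontr)
      assume "\<not> h \<le> d"
      then obtain h' where h': "h' \<in> P" "h' < h"
        using cInf_lessD[OF \<open>P \<noteq> {}\<close>, of h] unfolding d_def by auto
      have "d \<le> h'" unfolding d_def using bdd h' by (intro cInf_lower)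
      moreover have "h - h' \<ge> \<eta>" using h h' H_diff by (intro gap) (auto simp: P_def)
      ultimately show False using h by auto
    qed
    moreover have "d \<le> h" unfolding d_def using bdd h by (intro cInf_lower)
    ultimately show ?thesis using h by (auto simp: P_def)
  qed
  have nat_mult: "real k * d \<in> H" for k
  proof (induction k)
    case 0
    show ?case using H_diff[OF \<open>d \<in> H\<close> \<open>d \<in> H\<close>] by simp
  next
    case (Suc k)
    have "0 \<in> H" using H_diff[OF \<open>d \<in> H\<close> \<open>d \<in> H\<close>] by simp
    then have "real k * d - (0 - d) \<in> H" using H_diff Suc \<open>d \<in> H\<close> by blast
    then show ?case by (simp add: algebra_simps)
  qed
  have "S \<subseteq> range (\<lambda>k::int. d * of_int k)"
  proof
    fix x assume "x \<in> S"
    then have "x > 0" "x \<in> H" using assms \<open>S \<subseteq> H\<close> by auto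
    \<comment> \<open>Euclidean division by \<open>d\<close>: the remainder lies in \<open>H\<close>
      and in \<open>[0, d)\<close>, so it vanishes by minimality of \<open>d\<close>.\<close>
    define k where "k = nat \<lfloor>x / d\<rfloor>"
    have "d > 0" using \<open>d \<ge> \<eta>\<close> \<open>\<eta> > 0\<close> by simp
    have k: "real k \<le> x / d" "x / d < real k + 1"
      using \<open>x > 0\<close> \<open>d > 0\<close> unfolding k_def by auto
    then have "0 \<le> x - real k * d" "x - real k * d < d"
      using \<open>d > 0\<close> by (auto simp: field_simps)
    moreover have "x - real k * d \<in> H" using H_diff \<open>x \<in> H\<close> nat_mult by blast
    moreover have "d \<le> y" if "y \<in> P" for y unfolding d_def using bdd that by (intro cInf_lower)
    ultimately have "x - real k * d = 0" unfolding P_def by force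
    then have "x = d * of_int (int k)" by simp
    then show "x \<in> range (\<lambda>k::int. d * of_int k)" by blast
  qed
  then show False using nonlat[of d] \<open>d \<ge> \<eta>\<close> \<open>\<eta> > 0\<close> by auto
qed

text \<open>The sums \<open>(n - l) * a + l * b\<close> with \<open>l \<le> n\<close> start at
  \<open>n * a\<close> and advance in steps of \<open>b - a < \<eta>\<close>. Once \<open>n\<close>
  reaches \<open>n0 > a / (b - a)\<close>, they bridge the whole interval from \<open>n * a\<close>
  to \<open>(n + 1) * a\<close>.\<close>

lemma semigroup_nonlattice_dense:
  fixes S :: "real set" and \<eta> :: real
  assumes add: "\<And>x y. x \<in> S \<Longrightarrow> y \<in> S \<Longrightarrow> x + y \<in> S"
    and nonlat: "\<And>d. d > 0 \<Longrightarrow> \<not> S \<subseteq> range (\<lambda>k::int. d * of_int k)"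
    and pos: "S \<subseteq> {0<..}" and ne: "S \<noteq> {}" and "\<eta> > 0"
  shows "\<exists>c. \<forall>s\<ge>c. \<exists>x\<in>S. \<bar>s - x\<bar> < \<eta>"
proof -
  obtain a b where ab: "a \<in> S" "b \<in> S" "0 < b - a" "b - a < \<eta>"
    using semigroup_nonlattice_small_difference[OF assms] by blast
  have "a > 0" using ab pos by auto
  have mult: "real (Suc n) * x \<in> S" if "x \<in> S" for n x
  proof (induction n)
    case (Suc n)
    then show ?case using add[OF that Suc] by (simp add: algebra_simps)
  qed (use that in simp)
  have comb: "real k * a + real l * b \<in> S" if "k + l > 0" for k l
  proof (cases "k = 0 \<or> l = 0")
    case True
    then show ?thesis using that mult[OF ab(1), of "k - 1"] mult[OF ab(2), of "l - 1"] by auto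
  next
    case False
    then show ?thesis using add[OF mult[OF ab(1), of "k - 1"] mult[OF ab(2), of "l - 1"]] by auto
  qed
  obtain n0 :: nat where n0: "a / (b - a) < real n0" using reals_Archimedean2 by blast
  then have "n0 > 0" using \<open>a > 0\<close> ab(3) by (metis divide_pos_pos gr0I less_asym of_nat_0)
  show ?thesis
  proof (intro exI[of _ "real n0 * a"] allI impI)
    fix s assume s: "s \<ge> real n0 * a"
    define n where "n = nat \<lfloor>s / a\<rfloor>"
    have "real n0 \<le> s / a" using s \<open>a > 0\<close> by (simp add: field_simps)
    then have "0 \<le> s / a" using of_nat_0_le_iff order_trans by blast
    then have n: "real n \<le> s / a" "s / a < real n + 1" unfolding n_def by linarith+
    note \<open>real n0 \<le> s / a\<close>
    then have "n0 \<le> n" unfolding n_def by (simp add: le_nat_floor)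
    define l where "l = nat \<lfloor>(s - real n * a) / (b - a)\<rfloor>"
    have "0 \<le> s - real n * a" "s - real n * a < a" using n \<open>a > 0\<close> by (auto simp: field_simps)
    have l: "real l \<le> (s - real n * a) / (b - a)" "(s - real n * a) / (b - a) < real l + 1"
      using \<open>0 \<le> s - real n * a\<close> ab unfolding l_def by auto
    have "(s - real n * a) / (b - a) < a / (b - a)"
      using \<open>s - real n * a < a\<close> ab by (simp add: divide_strict_right_mono)
    then have "real l < real n0" using l n0 by linarith
    then have "l < n" using \<open>n0 \<le> n\<close> by simp
    have "real (n - l) * a + real l * b \<in> S" using comb[of "n - l" l] \<open>l < n\<close> by simp
    also have "real (n - l) * a + real l * b = real n * a + real l * (b - a)"
      using \<open>l < n\<close> by (simp add: algebra_simps of_nat_diff)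
    finally have "real n * a + real l * (b - a) \<in> S" .
    moreover have "real l * (b - a) \<le> s - real n * a" "s - real n * a < (real l + 1) * (b - a)"
      using l ab by (simp_all add: field_simps)
    ultimately show "\<exists>x\<in>S. \<bar>s - x\<bar> < \<eta>"
      using ab by (intro bexI[of _ "real n * a + real l * (b - a)"]) (auto simp: algebra_simps)
  qed
qed

subsection \<open>Sequences with bounded logarithmic increments\<close>

lemma log_Lipschitz_const_nonneg:
  fixes a :: "nat \<Rightarrow> real"
  assumes "\<And>n. real (Suc n) * \<bar>a (Suc n) - a n\<bar> \<le> C"
  shows "C \<ge> 0"
  using assms[of 0] by (meson abs_ge_zero mult_nonneg_nonneg of_nat_0_le_iff order_trans)

text \<open>The hypothesis bounds increments with respect to \<open>log n\<close>. Here
  \<open>(i - j) / j\<close> serves as an upper bound for \<open>log (i / j)\<close>, which avoids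
  logarithms.\<close>

lemma log_Lipschitz_nat:
  fixes a :: "nat \<Rightarrow> real"
  assumes step: "\<And>n. real (Suc n) * \<bar>a (Suc n) - a n\<bar> \<le> C" and "j \<le> i" "j > 0"
  shows "\<bar>a i - a j\<bar> \<le> C * (real i - real j) / real j"
  using \<open>j \<le> i\<close>
proof (induction i rule: dec_induct)
  case base
  show ?case by simp
next
  case (step i)
  have "C \<ge> 0" by (rule log_Lipschitz_const_nonneg[OF assms(1)])
  have "\<bar>a (Suc i) - a i\<bar> \<le> C / real (Suc i)"
    using assms(1)[of i] by (simp add: field_simps)
  also have "\<dots> \<le> C / real j" using \<open>C \<ge> 0\<close> \<open>j > 0\<close> step by (intro divide_left_mono) auto
  finally have "\<bar>a (Suc i) - a j\<bar> \<le> C / real j + C * (real i - real j) / real j"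
    using step by linarith
  also have "\<dots> = C * (real (Suc i) - real j) / real j"
    by (simp add: add_divide_distrib[symmetric] algebra_simps)
  finally show ?case .
qed

lemma log_Lipschitz_min:
  fixes a :: "nat \<Rightarrow> real"
  assumes step: "\<And>n. real (Suc n) * \<bar>a (Suc n) - a n\<bar> \<le> C" and "l > 0" "l \<le> real i" "l \<le> real j"
  shows "\<bar>a i - a j\<bar> \<le> C * \<bar>real i - real j\<bar> / l"
proof -
  have "C \<ge> 0" by (rule log_Lipschitz_const_nonneg[OF assms(1)])
  have *: "\<bar>a i - a j\<bar> \<le> C * \<bar>real i - real j\<bar> / l" if "j \<le> i" "l \<le> real j" for i j
  proof -
    have "\<bar>a i - a j\<bar> \<le> C * (real i - real j) / real j"
      using that \<open>l > 0\<close> by (intro log_Lipschitz_nat[OF step]) auto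
    also have "\<dots> \<le> C * (real i - real j) / l"
      using that \<open>l > 0\<close> \<open>C \<ge> 0\<close> by (intro divide_left_mono) auto
    finally show ?thesis using that by simp
  qed
  show ?thesis
    using *[of j i] *[of i j] assms by (cases "j \<le> i") (auto simp: abs_minus_commute)
qed

text \<open>Over a window of relative length \<theta> ending at \<open>n\<close>, the increment of
  \<open>a\<close> is the sum of \<open>d i / i\<close>. There \<open>d\<close> differs from
  \<open>d n\<close> by at most \<open>2 * C * \<theta>\<close>, and the weights
  \<open>1 / i\<close> add up to at least \<open>\<theta> / 2\<close>; dividing by their sum
  isolates \<open>d n\<close>.\<close>

lemma log_derivative_bound:
  fixes a d :: "nat \<Rightarrow> real"
  assumes der: "\<And>n. real (Suc n) * (a (Suc n) - a n) = d (Suc n)"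
    and lip: "\<And>n. real (Suc n) * \<bar>d (Suc n) - d n\<bar> \<le> C"
    and \<theta>: "0 < \<theta>" "\<theta> \<le> 1 / 2" and n: "\<theta> * real n \<ge> 1"
  shows "\<bar>d n\<bar> \<le> 2 * C * \<theta> + 2 / \<theta> * \<bar>a n - a (n - nat \<lfloor>\<theta> * real n\<rfloor>)\<bar>"
proof -
  have "C \<ge> 0" by (rule log_Lipschitz_const_nonneg[OF lip])
  define k where "k = nat \<lfloor>\<theta> * real n\<rfloor>"
  have "n > 0" using n by (cases n) auto
  have k: "real k \<le> \<theta> * real n" "\<theta> * real n < real k + 1" using n unfolding k_def by linarith+
  have "real k \<ge> 1" using le_nat_floor[of 1 "\<theta> * real n"] n unfolding k_def by simp
  have "\<theta> * real n \<le> real n / 2" using \<theta> mult_right_mono[of \<theta> "1/2" "real n"] by simp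
  then have "2 * real k \<le> real n" using k by linarith
  then have "2 * k \<le> n" by linarith
  have "k < n" using \<open>2 * k \<le> n\<close> \<open>real k \<ge> 1\<close> by linarith
  have telescope: "a m - a l = (\<Sum>i\<in>{l<..m}. d i / real i)" if "l \<le> m" for l m
    using that
  proof (induction m rule: dec_induct)
    case (step m)
    have "{l<..Suc m} = insert (Suc m) {l<..m}" using step by auto
    moreover have "a (Suc m) - a m = d (Suc m) / real (Suc m)" using der[of m] by (simp add: field_simps)
    ultimately show ?case using step by simp
  qed simp
  define I where "I = {n - k<..n}"
  define H where "H = (\<Sum>i\<in>I. 1 / real i)"
  \<comment> \<open>The window has \<open>k\<close> terms, each at least \<open>1 / n\<close>, and
    \<open>k \<ge> 1\<close> gives \<open>2 * k \<ge> k + 1 > \<theta> * n\<close>.\<close>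
  have H_ge: "H \<ge> \<theta> / 2"
  proof -
    have "\<theta> / 2 \<le> real k / real n"
      using k \<open>real k \<ge> 1\<close> \<open>n > 0\<close> by (simp add: field_simps)
    also have "\<dots> = (\<Sum>i\<in>I. 1 / real n)" using \<open>k < n\<close> by (simp add: I_def)
    also have "\<dots> \<le> H" unfolding H_def by (intro sum_mono divide_left_mono) (auto simp: I_def)
    finally show ?thesis .
  qed
  have d_close: "\<bar>d i - d n\<bar> \<le> 2 * C * \<theta>" if "i \<in> I" for i
  proof -
    have "\<bar>d i - d n\<bar> \<le> C * \<bar>real i - real n\<bar> / (real n / 2)"
      using that \<open>n > 0\<close> \<open>2 * k \<le> n\<close> by (intro log_Lipschitz_min[OF lip]) (auto simp: I_def)
    also have "\<dots> \<le> C * (\<theta> * real n) / (real n / 2)"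
    proof (intro divide_right_mono mult_left_mono)
      have "real n - real i \<le> real k" using that by (auto simp: I_def)
      then show "\<bar>real i - real n\<bar> \<le> \<theta> * real n" using that k by (auto simp: I_def)
    qed (use \<open>C \<ge> 0\<close> in auto)
    also have "\<dots> = 2 * C * \<theta>" using \<open>n > 0\<close> by simp
    finally show ?thesis .
  qed
  have "a n - a (n - k) - d n * H = (\<Sum>i\<in>I. (d i - d n) * (1 / real i))"
    by (simp add: telescope I_def H_def sum_distrib_left sum_subtractf left_diff_distrib diff_divide_distrib)
  also have "\<bar>\<dots>\<bar> \<le> (\<Sum>i\<in>I. (2 * C * \<theta>) * (1 / real i))"
    using d_close by (intro order_trans[OF sum_abs] sum_mono) (auto simp: abs_mult intro!: divide_right_mono)
  also have "\<dots> = 2 * C * \<theta> * H" unfolding H_def by (simp add: sum_distrib_left)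
  finally have "\<bar>d n * H\<bar> \<le> 2 * C * \<theta> * H + \<bar>a n - a (n - k)\<bar>" by linarith
  moreover have "H > 0" using H_ge \<theta> by linarith
  ultimately have "\<bar>d n\<bar> \<le> 2 * C * \<theta> + \<bar>a n - a (n - k)\<bar> / H"
    by (simp add: abs_mult field_simps)
  also have "\<bar>a n - a (n - k)\<bar> / H \<le> \<bar>a n - a (n - k)\<bar> / (\<theta> / 2)"
    using H_ge \<theta> \<open>H > 0\<close> by (intro divide_left_mono) auto
  finally show ?thesis unfolding k_def by (simp add: mult.commute)
qed

lemma Bernstein_measurable [measurable]: "Bernstein n m \<in> borel_measurable borel"
  unfolding Bernstein_def by measurable

lemma Bernstein_le_1: "0 \<le> x \<Longrightarrow> x \<le> 1 \<Longrightarrow> Bernstein n m x \<le> 1"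
proof (cases "m \<le> n")
  case True
  assume x: "0 \<le> x" "x \<le> 1"
  have "Bernstein n m x \<le> (\<Sum>k\<le>n. Bernstein n k x)"
    using True x by (intro member_le_sum) (auto intro: Bernstein_nonneg)
  then show ?thesis by simp
qed (simp add: Bernstein_eq_0)

lemma Bernstein_abs_le: "0 \<le> x \<Longrightarrow> x \<le> 1 \<Longrightarrow> \<bar>Bernstein n m x\<bar> \<le> 1"
  using Bernstein_le_1 Bernstein_nonneg by simp

subsection \<open>The number of balls beyond the first boxes\<close>

text \<open>The sieve without its balls. Given the factors, the number of balls beyond the first
  \<open>k\<close> boxes is binomial with parameter \<open>Q k\<close>, so its law is a mean of
  Bernstein polynomials and can be studied before any allocation enters.\<close>

locale multiplicative_walk = prob_space M
  for M :: "'a measure" and W :: "'a \<Rightarrow> real" and Ws :: "nat \<Rightarrow> 'a \<Rightarrow> real" +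
  assumes W_measurable [measurable]: "random_variable borel W"
    and W_range: "AE \<omega> in M. W \<omega> \<in> {0<..<1}"
    and Ws_indep: "indep_vars (\<lambda>_. borel) Ws {1..}"
    and Ws_distr: "\<And>k. k \<ge> 1 \<Longrightarrow> distr M borel (Ws k) = distr M borel W"
begin

definition b :: "nat \<Rightarrow> real" where "b m = expectation (\<lambda>\<omega>. W \<omega> ^ m)"
definition c :: "nat \<Rightarrow> real" where "c m = expectation (\<lambda>\<omega>. (1 - W \<omega>) ^ m)"
definition p :: "nat \<Rightarrow> nat \<Rightarrow> real" where "p n j = expectation (\<lambda>\<omega>. Bernstein n j (W \<omega>))"
definition Q :: "nat \<Rightarrow> 'a \<Rightarrow> real" where "Q k \<omega> = (\<Prod>j\<in>{1..k}. Ws j \<omega>)"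
definition q :: "nat \<Rightarrow> nat \<Rightarrow> nat \<Rightarrow> real" where "q k n m = expectation (\<lambda>\<omega>. Bernstein n m (Q k \<omega>))"

text \<open>\<open>p n j\<close> is the probability that \<open>j\<close> of \<open>n\<close> balls miss the first box, \<open>q k n m\<close> that \<open>m\<close> of
  them miss the first \<open>k\<close> boxes, and \<open>U n m\<close> is the expected number of \<open>k\<close> for which this happens.
  \<open>U\<close> is only used for \<open>m \<ge> 1\<close>: the series diverges for \<open>m = 0\<close>.\<close>

definition U :: "nat \<Rightarrow> nat \<Rightarrow> real" where "U n m = (\<Sum>k. q k n m)"

lemma AE_W: "(\<And>x. 0 < x \<Longrightarrow> x < 1 \<Longrightarrow> P x) \<Longrightarrow> AE \<omega> in M. P (W \<omega>)"
  using W_range by (rule eventually_mono) auto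

lemma integrable_bounded_unit:
  fixes f :: "real \<Rightarrow> real"
  assumes [measurable]: "f \<in> borel_measurable borel" "random_variable borel V"
    and "AE \<omega> in M. V \<omega> \<in> {0<..<1}" and "\<And>x. 0 < x \<Longrightarrow> x < 1 \<Longrightarrow> \<bar>f x\<bar> \<le> B"
  shows "integrable M (\<lambda>\<omega>. f (V \<omega>))"
  by (rule integrable_const_bound[where B = B]) (use assms(3,4) in auto)

lemma Ws_measurable [measurable]: "k \<ge> 1 \<Longrightarrow> random_variable borel (Ws k)"
  using Ws_indep unfolding indep_vars_def by auto

lemma Ws_range:
  assumes "k \<ge> 1" shows "AE \<omega> in M. Ws k \<omega> \<in> {0<..<1}"
proof -
  have "AE x in distr M borel W. x \<in> {0<..<1}" using W_range by (subst AE_distr_iff) auto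
  then have "AE x in distr M borel (Ws k). x \<in> {0<..<1}" unfolding Ws_distr[OF assms] .
  then show ?thesis using assms by (subst (asm) AE_distr_iff) auto
qed

lemma Ws_expectation:
  fixes f :: "real \<Rightarrow> real"
  assumes "k \<ge> 1" and [measurable]: "f \<in> borel_measurable borel"
  shows "expectation (\<lambda>\<omega>. f (Ws k \<omega>)) = expectation (\<lambda>\<omega>. f (W \<omega>))"
proof -
  have "expectation (\<lambda>\<omega>. f (Ws k \<omega>)) = integral\<^sup>L (distr M borel (Ws k)) f"
    using assms by (subst integral_distr) auto
  also have "\<dots> = expectation (\<lambda>\<omega>. f (W \<omega>))"
    unfolding Ws_distr[OF assms(1)] by (subst integral_distr) auto
  finally show ?thesis .
qed

lemma Q_measurable [measurable]: "random_variable borel (Q k)"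
  unfolding Q_def[abs_def] by (intro borel_measurable_prod) auto

lemma Q_Suc: "Q (Suc k) \<omega> = Q k \<omega> * Ws (Suc k) \<omega>"
  by (simp add: Q_def mult.commute)

lemma Q_range: "AE \<omega> in M. Q (Suc k) \<omega> \<in> {0<..<1}"
proof (induction k)
  case 0
  show ?case using Ws_range[of 1] by (simp add: Q_def)
next
  case (Suc k)
  have "AE \<omega> in M. Ws (Suc (Suc k)) \<omega> \<in> {0<..<1}" by (rule Ws_range) simp
  with Suc show ?case
  proof eventually_elim
    case (elim \<omega>)
    have "Q (Suc k) \<omega> * Ws (Suc (Suc k)) \<omega> < 1 * 1"
      using elim by (intro mult_strict_mono) auto
    then show ?case using elim by (subst (1) Q_Suc) auto
  qed
qed

lemma Q_range': "AE \<omega> in M. 0 < Q k \<omega> \<and> Q k \<omega> \<le> 1"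
proof (cases k)
  case (Suc l)
  then show ?thesis using Q_range[of l] by (auto elim: eventually_mono)
qed (simp add: Q_def)

lemma AE_Q: "(\<And>x. 0 < x \<Longrightarrow> x \<le> 1 \<Longrightarrow> P x) \<Longrightarrow> AE \<omega> in M. P (Q k \<omega>)"
  using Q_range'[of k] by (rule eventually_mono) auto

lemma integrable_Q:
  fixes f :: "real \<Rightarrow> real"
  assumes [measurable]: "f \<in> borel_measurable borel" and "\<And>x. 0 < x \<Longrightarrow> x \<le> 1 \<Longrightarrow> \<bar>f x\<bar> \<le> B"
  shows "integrable M (\<lambda>\<omega>. f (Q k \<omega>))"
  by (rule integrable_const_bound[where B = B]) (use Q_range'[of k] assms(2) in auto)

lemma integrable_W:
  fixes f :: "real \<Rightarrow> real"
  assumes "f \<in> borel_measurable borel" and "\<And>x. 0 < x \<Longrightarrow> x < 1 \<Longrightarrow> \<bar>f x\<bar> \<le> B"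
  shows "integrable M (\<lambda>\<omega>. f (W \<omega>))"
  using assms W_measurable W_range by (intro integrable_bounded_unit[where B = B]) auto

lemma Q_Ws_indep:
  fixes f g :: "real \<Rightarrow> real"
  assumes [measurable]: "f \<in> borel_measurable borel" "g \<in> borel_measurable borel"
    and f: "\<And>x. 0 < x \<Longrightarrow> x \<le> 1 \<Longrightarrow> \<bar>f x\<bar> \<le> B" and g: "\<And>x. 0 < x \<Longrightarrow> x < 1 \<Longrightarrow> \<bar>g x\<bar> \<le> B'"
  shows "integrable M (\<lambda>\<omega>. f (Q k \<omega>) * g (Ws (Suc k) \<omega>))"
    and "expectation (\<lambda>\<omega>. f (Q k \<omega>) * g (Ws (Suc k) \<omega>))
      = expectation (\<lambda>\<omega>. f (Q k \<omega>)) * expectation (\<lambda>\<omega>. g (W \<omega>))"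
proof -
  have "indep_vars (\<lambda>_. borel) Ws (insert (Suc k) {1..k})"
    by (rule indep_vars_subset[OF Ws_indep]) auto
  then have "indep_var borel (Ws (Suc k)) borel (\<lambda>\<omega>. \<Prod>i\<in>{1..k}. Ws i \<omega>)"
    by (intro indep_vars_prod) auto
  then have "indep_var borel (g \<circ> Ws (Suc k)) borel (f \<circ> (\<lambda>\<omega>. \<Prod>i\<in>{1..k}. Ws i \<omega>))"
    by (intro indep_var_compose) auto
  then have ind: "indep_var borel (\<lambda>\<omega>. g (Ws (Suc k) \<omega>)) borel (\<lambda>\<omega>. f (Q k \<omega>))"
    by (simp add: comp_def Q_def[abs_def])
  have int: "integrable M (\<lambda>\<omega>. g (Ws (Suc k) \<omega>))" "integrable M (\<lambda>\<omega>. f (Q k \<omega>))"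
    using integrable_bounded_unit[where V = "Ws (Suc k)" and f = g] Ws_range[of "Suc k"] g
      integrable_Q[where f = f] f by auto
  show "integrable M (\<lambda>\<omega>. f (Q k \<omega>) * g (Ws (Suc k) \<omega>))"
    using indep_var_integrable[OF ind int] by (simp add: mult.commute)
  show "expectation (\<lambda>\<omega>. f (Q k \<omega>) * g (Ws (Suc k) \<omega>))
      = expectation (\<lambda>\<omega>. f (Q k \<omega>)) * expectation (\<lambda>\<omega>. g (W \<omega>))"
    using indep_var_lebesgue_integral[OF ind int] Ws_expectation[of "Suc k" g] by (simp add: mult.commute)
qed

lemma integrable_Bernstein_W [simp]: "integrable M (\<lambda>\<omega>. Bernstein n m (W \<omega>))"
  by (rule integrable_W[where B = 1]) (auto intro: Bernstein_abs_le)

lemma integrable_Bernstein_Q [simp]: "integrable M (\<lambda>\<omega>. Bernstein n m (Q k \<omega>))"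
  by (rule integrable_Q[where B = 1]) (auto intro: Bernstein_abs_le)

lemma integrable_power_W [simp]: "integrable M (\<lambda>\<omega>. W \<omega> ^ m)" "integrable M (\<lambda>\<omega>. (1 - W \<omega>) ^ m)"
    "integrable M W"
proof -
  show pw: "integrable M (\<lambda>\<omega>. W \<omega> ^ m)" for m
    by (rule integrable_W[where B = 1]) (auto intro: power_le_one)
  show "integrable M (\<lambda>\<omega>. (1 - W \<omega>) ^ m)"
    by (rule integrable_W[where B = 1 and f = "\<lambda>x. (1 - x) ^ m"]) (auto intro: power_le_one)
  show "integrable M W" using pw[of 1] by simp
qed

lemma integrable_power_Q [simp]: "integrable M (\<lambda>\<omega>. (1 - Q k \<omega>) ^ m)" "integrable M (Q k)"
proof -
  show "integrable M (\<lambda>\<omega>. (1 - Q k \<omega>) ^ m)"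
    by (rule integrable_Q[where B = 1 and f = "\<lambda>x. (1 - x) ^ m"]) (auto intro: power_le_one)
  show "integrable M (Q k)"
    by (rule integrable_Q[where B = 1 and f = "\<lambda>x. x"]) auto
qed

text \<open>First-step decomposition. The newest factor \<open>Ws (Suc k)\<close> plays the part of
  the first step and \<open>Q k\<close> that of the remaining \<open>k\<close> steps; as the factors
  are independent and identically distributed, their order in the product is immaterial.\<close>

lemma q_Suc: "q (Suc k) n m = (\<Sum>j\<le>n. p n j * q k j m)"
proof -
  have int: "integrable M (\<lambda>\<omega>. Bernstein j m (Q k \<omega>) * Bernstein n j (Ws (Suc k) \<omega>))"
    and ex: "expectation (\<lambda>\<omega>. Bernstein j m (Q k \<omega>) * Bernstein n j (Ws (Suc k) \<omega>)) = p n j * q k j m" for j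
    using Q_Ws_indep[where f = "Bernstein j m" and g = "Bernstein n j" and B = 1 and B' = 1 and k = k]
    by (auto simp: p_def q_def Bernstein_abs_le mult.commute)
  have "q (Suc k) n m = expectation (\<lambda>\<omega>. \<Sum>j\<le>n. Bernstein j m (Q k \<omega>) * Bernstein n j (Ws (Suc k) \<omega>))"
    unfolding q_def Q_Suc by (subst mult.commute, subst Bernstein_mult) (simp add: mult.commute)
  also have "\<dots> = (\<Sum>j\<le>n. p n j * q k j m)"
    using int ex by (subst Bochner_Integration.integral_sum) auto
  finally show ?thesis .
qed

lemma p_nonneg: "p n j \<ge> 0" and q_nonneg: "q k n m \<ge> 0"
proof -
  show "p n j \<ge> 0" unfolding p_def
    by (rule integral_nonneg_AE) (auto intro!: AE_W Bernstein_nonneg)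
  show "q k n m \<ge> 0" unfolding q_def
    by (rule integral_nonneg_AE) (auto intro!: AE_Q Bernstein_nonneg)
qed

lemma q_eq_0: "n < m \<Longrightarrow> q k n m = 0"
  by (simp add: q_def Bernstein_eq_0)

lemma q_0: "q 0 n m = (if n = m then 1 else 0)"
proof -
  have "Bernstein n m 1 = (if n = m then 1 else 0)"
    by (cases n m rule: linorder_cases) (auto simp: Bernstein_def binomial_eq_0)
  then show ?thesis by (simp add: q_def Q_def prob_space)
qed

lemma sum_p: "(\<Sum>j\<le>n. p n j) = 1"
  unfolding p_def by (subst Bochner_Integration.integral_sum[symmetric]) (auto simp: prob_space)

lemma sum_p_mult: "(\<Sum>j\<le>n. real j * p n j) = real n * b 1"
proof -
  have "(\<Sum>j\<le>n. real j * p n j) = expectation (\<lambda>\<omega>. \<Sum>j\<le>n. real j * Bernstein n j (W \<omega>))"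
    unfolding p_def by (subst Bochner_Integration.integral_sum) auto
  then show ?thesis by (simp add: b_def)
qed

lemma p_diag: "p n n = b n" and p_zero: "p n 0 = c n"
  by (simp_all add: p_def b_def c_def Bernstein_def)

lemma b_0 [simp]: "b 0 = 1"
  by (simp add: b_def prob_space)

lemma expectation_pos:
  fixes f :: "'a \<Rightarrow> real"
  assumes "integrable M f" "AE \<omega> in M. f \<omega> > 0"
  shows "expectation f > 0"
proof -
  have "AE \<omega> in M. 0 \<le> f \<omega>" using assms(2) by (rule eventually_mono) auto
  then have "expectation f \<ge> 0" by (rule integral_nonneg_AE)
  moreover have "expectation f \<noteq> 0"
  proof
    assume "expectation f = 0"
    then have "AE \<omega> in M. f \<omega> = 0"
      using integral_nonneg_eq_0_iff_AE[OF assms(1) \<open>AE \<omega> in M. 0 \<le> f \<omega>\<close>] by simp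
    then have "AE \<omega> in M. False" using assms(2) by eventually_elim auto
    then show False by simp
  qed
  ultimately show ?thesis by simp
qed

lemma b_pos: "b n > 0" and c_pos: "c n > 0"
proof -
  show "b n > 0" unfolding b_def
    by (rule expectation_pos, simp, rule AE_W) auto
  show "c n > 0" unfolding c_def
    by (rule expectation_pos, simp, rule AE_W) auto
qed

lemma b_less_1: "n > 0 \<Longrightarrow> b n < 1"
proof -
  assume "n > 0"
  have "expectation (\<lambda>\<omega>. 1 - W \<omega> ^ n) > 0"
    using \<open>n > 0\<close> by (intro expectation_pos, simp, intro AE_W) (auto simp: power_less_one_iff)
  then show ?thesis by (simp add: b_def prob_space)
qed

lemma b_antimono: "m \<le> n \<Longrightarrow> b n \<le> b m" and c_antimono: "m \<le> n \<Longrightarrow> c n \<le> c m"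
proof -
  assume "m \<le> n"
  then show "b n \<le> b m" unfolding b_def
    by (intro integral_mono_AE, simp, simp, intro AE_W power_decreasing) auto
next
  assume "m \<le> n"
  then show "c n \<le> c m" unfolding c_def
    by (intro integral_mono_AE, simp, simp, intro AE_W power_decreasing) auto
qed

lemma expectation_Q: "expectation (Q k) = b 1 ^ k"
proof (induction k)
  case 0
  show ?case by (simp add: Q_def prob_space)
next
  case (Suc k)
  have "expectation (Q (Suc k)) = expectation (Q k) * expectation W"
    using Q_Ws_indep(2)[where f = "\<lambda>x. x" and g = "\<lambda>x. x" and B = 1 and B' = 1 and k = k]
    by (simp add: Q_Suc[abs_def])
  then show ?case using Suc by (simp add: b_def)
qed

text \<open>For \<open>m \<ge> 1\<close> the probability is at most the mean number of balls left,
  which is \<open>n * b 1 ^ k\<close>. This geometric decay makes the series defining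
  \<open>U\<close> converge.\<close>

lemma q_le: "m \<ge> 1 \<Longrightarrow> q k n m \<le> real n * b 1 ^ k"
proof (cases "m \<le> n")
  case True
  assume "m \<ge> 1"
  have "q k n m \<le> real m * q k n m" using \<open>m \<ge> 1\<close> q_nonneg[of k n m] by (simp add: mult_le_cancel_right1)
  also have "\<dots> \<le> (\<Sum>j\<le>n. real j * q k n j)"
    using True q_nonneg by (intro member_le_sum) auto
  also have "\<dots> = expectation (\<lambda>\<omega>. \<Sum>j\<le>n. real j * Bernstein n j (Q k \<omega>))"
    unfolding q_def by (subst Bochner_Integration.integral_sum) auto
  also have "\<dots> = real n * b 1 ^ k" by (simp add: expectation_Q)
  finally show ?thesis .
next
  case False
  then show ?thesis using b_pos[of 1] by (simp add: q_eq_0 less_imp_le)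
qed

lemma q_summable: "m \<ge> 1 \<Longrightarrow> summable (\<lambda>k. q k n m)"
proof (rule summable_comparison_test'[of "\<lambda>k. real n * b 1 ^ k" 0])
  show "summable (\<lambda>k. real n * b 1 ^ k)"
    using b_less_1[of 1] b_pos[of 1] by (intro summable_mult summable_geometric) auto
qed (use q_le q_nonneg in auto)

lemma U_nonneg: "m \<ge> 1 \<Longrightarrow> U n m \<ge> 0"
  unfolding U_def by (rule suminf_nonneg[OF q_summable q_nonneg])

lemma U_eq_0: "n < m \<Longrightarrow> U n m = 0"
  by (simp add: U_def q_eq_0)

text \<open>The term \<open>j = 0\<close> drops out because the chain never leaves 0. The term
  \<open>j = n\<close> remains on the right, since the chain may rest at \<open>n\<close>.\<close>

lemma U_rec: "m \<ge> 1 \<Longrightarrow> U n m = (if n = m then 1 else 0) + (\<Sum>j\<in>{1..n}. p n j * U j m)"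
proof -
  assume m: "m \<ge> 1"
  have "U n m = q 0 n m + (\<Sum>k. q (Suc k) n m)"
    unfolding U_def using suminf_split_head[OF q_summable[OF m]] by simp
  also have "(\<Sum>k. q (Suc k) n m) = (\<Sum>j\<le>n. \<Sum>k. p n j * q k j m)"
    unfolding q_Suc using q_summable[OF m] by (intro suminf_sum) (auto intro: summable_mult)
  also have "\<dots> = (\<Sum>j\<le>n. p n j * U j m)"
    unfolding U_def using q_summable[OF m] by (intro sum.cong suminf_mult refl)
  also have "\<dots> = (\<Sum>j\<in>{1..n}. p n j * U j m)"
    using m by (intro sum.mono_neutral_right) (auto simp: U_eq_0 Suc_le_eq)
  finally show ?thesis by (simp add: q_0)
qed

lemma U_Suc_diff:
  "m \<ge> 1 \<Longrightarrow> real (Suc n) * (U (Suc n) m - U n m) = real m * U (Suc n) m - real (Suc m) * U (Suc n) (Suc m)"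
proof -
  assume m: "m \<ge> 1"
  have *: "real (Suc n) * (q k (Suc n) m - q k n m) = real m * q k (Suc n) m - real (Suc m) * q k (Suc n) (Suc m)" for k
  proof -
    have "real (Suc n) * (q k (Suc n) m - q k n m)
        = expectation (\<lambda>\<omega>. real (Suc n) * (Bernstein (Suc n) m (Q k \<omega>) - Bernstein n m (Q k \<omega>)))"
      by (simp add: q_def del: of_nat_Suc)
    also have "\<dots> = real m * q k (Suc n) m - real (Suc m) * q k (Suc n) (Suc m)"
      unfolding Bernstein_Suc_diff by (simp add: q_def del: of_nat_Suc)
    finally show ?thesis .
  qed
  have s: "summable (\<lambda>k. q k (Suc n) m)" "summable (\<lambda>k. q k n m)" "summable (\<lambda>k. q k (Suc n) (Suc m))"
    using q_summable m by auto
  have "real (Suc n) * (U (Suc n) m - U n m) = (\<Sum>k. real (Suc n) * (q k (Suc n) m - q k n m))"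
    unfolding U_def suminf_diff[OF s(1,2)] by (rule suminf_mult[symmetric, OF summable_diff[OF s(1,2)]])
  also have "\<dots> = real m * U (Suc n) m - real (Suc m) * U (Suc n) (Suc m)"
    unfolding * U_def using s by (subst suminf_diff[symmetric]) (auto simp: suminf_mult summable_mult simp del: of_nat_Suc)
  finally show ?thesis .
qed


subsection \<open>The potential of the chain\<close>

lemma sum_p_from_1: "n \<ge> 1 \<Longrightarrow> (\<Sum>j\<in>{1..n}. p n j) = 1 - c n"
proof -
  assume "n \<ge> 1"
  have "{..n} = insert 0 {1..n}" by auto
  then show ?thesis using sum_p[of n] by (simp add: p_zero)
qed

text \<open>The chain never moves up, so strong induction applies. The weight \<open>b n < 1\<close>
  of resting at \<open>n\<close> is moved to the left; the mass \<open>c n\<close> that jumps to 0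
  carries the value 0 and does no harm because \<open>K \<ge> 0\<close>.\<close>

lemma max_principle:
  fixes y :: "nat \<Rightarrow> real"
  assumes base: "\<And>n. 1 \<le> n \<Longrightarrow> n \<le> A \<Longrightarrow> y n \<le> K"
    and sub: "\<And>n. 1 \<le> n \<Longrightarrow> A < n \<Longrightarrow> y n \<le> (\<Sum>j\<in>{1..n}. p n j * y j)"
    and "K \<ge> 0" "n \<ge> 1"
  shows "y n \<le> K"
  using \<open>n \<ge> 1\<close>
proof (induction n rule: less_induct)
  case (less n)
  show ?case
  proof (cases "n \<le> A")
    case True
    then show ?thesis using base less by auto
  next
    case False
    have split: "{1..n} = insert n {1..<n}" using less by auto
    have "y n \<le> p n n * y n + (\<Sum>j\<in>{1..<n}. p n j * y j)"
      using sub[of n] less False unfolding split by simp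
    also have "(\<Sum>j\<in>{1..<n}. p n j * y j) \<le> (\<Sum>j\<in>{1..<n}. p n j * K)"
      using less by (intro sum_mono mult_left_mono p_nonneg) auto
    also have "\<dots> = (1 - c n - b n) * K"
      using sum_p_from_1[OF less(2)] unfolding split by (simp add: sum_distrib_right[symmetric] p_diag)
    also have "\<dots> \<le> (1 - b n) * K"
      using \<open>K \<ge> 0\<close> c_pos[of n] by (intro mult_right_mono) auto
    finally have "(1 - b n) * y n \<le> (1 - b n) * K" by (simp add: p_diag algebra_simps)
    then show ?thesis using b_less_1[of n] less by simp
  qed
qed

text \<open>\<open>U\<close> acts as the Green function of the chain killed at 0: the sum is the
  expected total of \<beta> collected over all visits to positive states, and \<beta>
  \<open>n\<close> is the contribution of the starting point.\<close>

lemma potential_rec: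
  "n \<ge> 1 \<Longrightarrow> (\<Sum>m\<in>{1..n}. U n m * \<beta> m) = \<beta> n + (\<Sum>j\<in>{1..n}. p n j * (\<Sum>m\<in>{1..j}. U j m * \<beta> m))"
proof -
  assume "n \<ge> 1"
  have "(\<Sum>m\<in>{1..n}. U n m * \<beta> m)
      = (\<Sum>m\<in>{1..n}. (if n = m then 1 else 0) * \<beta> m) + (\<Sum>m\<in>{1..n}. (\<Sum>j\<in>{1..n}. p n j * U j m) * \<beta> m)"
    unfolding sum.distrib[symmetric]
  proof (rule sum.cong[OF refl])
    fix m assume "m \<in> {1..n}"
    then have "U n m = (if n = m then 1 else 0) + (\<Sum>j\<in>{1..n}. p n j * U j m)"
      by (intro U_rec) auto
    then show "U n m * \<beta> m = (if n = m then 1 else 0) * \<beta> m + (\<Sum>j\<in>{1..n}. p n j * U j m) * \<beta> m"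
      by (metis distrib_right)
  qed
  also have "(\<Sum>m\<in>{1..n}. (if n = m then 1 else 0) * \<beta> m) = \<beta> n"
    using \<open>n \<ge> 1\<close> by (simp add: if_distrib[of "\<lambda>x. x * _"] sum.delta cong: if_cong)
  also have "(\<Sum>m\<in>{1..n}. (\<Sum>j\<in>{1..n}. p n j * U j m) * \<beta> m) = (\<Sum>j\<in>{1..n}. \<Sum>m\<in>{1..n}. p n j * (U j m * \<beta> m))"
    unfolding sum_distrib_right by (subst sum.swap) (simp add: mult.assoc)
  also have "\<dots> = (\<Sum>j\<in>{1..n}. p n j * (\<Sum>m\<in>{1..j}. U j m * \<beta> m))"
  proof (rule sum.cong[OF refl])
    fix j assume "j \<in> {1..n}"
    then have "(\<Sum>m\<in>{1..n}. U j m * \<beta> m) = (\<Sum>m\<in>{1..j}. U j m * \<beta> m)"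
      by (intro sum.mono_neutral_right) (auto simp: U_eq_0)
    then show "(\<Sum>m\<in>{1..n}. p n j * (U j m * \<beta> m)) = p n j * (\<Sum>m\<in>{1..j}. U j m * \<beta> m)"
      by (simp add: sum_distrib_left[symmetric])
  qed
  finally show ?thesis .
qed

text \<open>The difference of two solutions is harmonic on all positive states, so the maximum
  principle with an empty base, applied with both signs, gives 0. Potentials are thereby found by
  guessing a closed form.\<close>

lemma potential_unique:
  assumes "\<And>n. n \<ge> 1 \<Longrightarrow> x n = \<beta> n + (\<Sum>j\<in>{1..n}. p n j * x j)" and "n \<ge> 1"
  shows "(\<Sum>m\<in>{1..n}. U n m * \<beta> m) = x n"
proof -
  define P where "P n = (\<Sum>m\<in>{1..n}. U n m * \<beta> m)" for n
  have P: "P n = \<beta> n + (\<Sum>j\<in>{1..n}. p n j * P j)" if "n \<ge> 1" for n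
    using potential_rec[OF that] by (simp add: P_def)
  have D: "P n - x n = (\<Sum>j\<in>{1..n}. p n j * (P j - x j))" if "n \<ge> 1" for n
    using P[OF that] assms(1)[OF that] by (simp add: right_diff_distrib sum_subtractf)
  have "P n - x n \<le> 0"
    by (rule max_principle[where A = 0 and y = "\<lambda>n. P n - x n"]) (use D assms(2) in auto)
  moreover have "x n - P n \<le> 0"
  proof (rule max_principle[where A = 0 and y = "\<lambda>n. x n - P n"])
    fix n :: nat assume "1 \<le> n"
    have "x n - P n = - (\<Sum>j\<in>{1..n}. p n j * (P j - x j))" using D[OF \<open>1 \<le> n\<close>] by linarith
    also have "\<dots> = (\<Sum>j\<in>{1..n}. p n j * (x j - P j))"
      unfolding sum_negf[symmetric] by (simp add: algebra_simps)
    finally show "x n - P n \<le> (\<Sum>j\<in>{1..n}. p n j * (x j - P j))" by simp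
  qed (use assms(2) in auto)
  ultimately show ?thesis by (simp add: P_def)
qed

lemma sum_U_c: "n \<ge> 1 \<Longrightarrow> (\<Sum>m\<in>{1..n}. U n m * c m) = 1"
  by (rule potential_unique[where x = "\<lambda>_. 1"]) (auto simp: sum_p_from_1[simplified])

text \<open>The mean number of balls left after \<open>k\<close> steps is
  \<open>n * b 1 ^ k\<close>; the right side is the geometric series over \<open>k\<close>.\<close>

lemma sum_U_mult: "n \<ge> 1 \<Longrightarrow> (\<Sum>m\<in>{1..n}. U n m * real m) = real n / (1 - b 1)"
proof (rule potential_unique)
  fix n :: nat assume "n \<ge> 1"
  have "(\<Sum>j\<in>{1..n}. p n j * (real j / (1 - b 1))) = (\<Sum>j\<le>n. real j * p n j) / (1 - b 1)"
    unfolding sum_divide_distrib by (intro sum.mono_neutral_cong_left) auto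
  also have "\<dots> = real n * b 1 / (1 - b 1)" by (simp only: sum_p_mult)
  finally show "real n / (1 - b 1) = real n + (\<Sum>j\<in>{1..n}. p n j * (real j / (1 - b 1)))"
    using b_less_1[of 1] by (simp add: field_simps)
qed auto

lemma U_le: "m \<ge> 1 \<Longrightarrow> U n m \<le> 1 / c m"
proof (cases "m \<le> n")
  case True
  assume "m \<ge> 1"
  have "U n m * c m \<le> (\<Sum>m\<in>{1..n}. U n m * c m)"
    using True \<open>m \<ge> 1\<close> U_nonneg c_pos by (intro member_le_sum) (auto simp: less_imp_le)
  also have "\<dots> = 1" using True \<open>m \<ge> 1\<close> by (intro sum_U_c) auto
  finally show ?thesis using c_pos[of m] by (simp add: field_simps)
next
  case False
  then show ?thesis using c_pos[of m] by (simp add: U_eq_0 less_imp_le)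
qed

text \<open>For a start up to \<open>2 * A\<close>, each visit to the block contributes at least
  \<open>A\<close> to the sum of all states visited, whose mean is at most
  \<open>2 * A / (1 - b 1)\<close> by \<open>sum_U_mult\<close>. A start above the block cannot do
  better, by the maximum principle.\<close>

lemma U_block_bound:
  assumes "A \<ge> 1"
  shows "(\<Sum>m\<in>{A..<2 * A}. U n m) \<le> 2 / (1 - b 1)"
proof (cases "n \<ge> 1")
  case False
  then show ?thesis using assms b_less_1[of 1] by (simp add: U_eq_0)
next
  case True
  show ?thesis
  proof (rule max_principle[where A = "2 * A" and y = "\<lambda>n. \<Sum>m\<in>{A..<2 * A}. U n m"])
    fix n assume n: "1 \<le> n" "n \<le> 2 * A"
    have "real A * (\<Sum>m\<in>{A..<2 * A}. U n m) \<le> (\<Sum>m\<in>{A..<2 * A}. U n m * real m)"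
      unfolding sum_distrib_left using assms
      by (intro sum_mono) (auto simp: mult.commute U_nonneg intro!: mult_right_mono)
    also have "\<dots> = (\<Sum>m\<in>{A..<2 * A} \<inter> {1..n}. U n m * real m)"
      using assms by (intro sum.mono_neutral_right) (auto intro: U_eq_0 simp: not_le[symmetric])
    also have "\<dots> \<le> (\<Sum>m\<in>{1..n}. U n m * real m)"
      by (intro sum_mono2) (auto simp: U_nonneg)
    also have "\<dots> = real n / (1 - b 1)" using n by (intro sum_U_mult)
    also have "\<dots> \<le> real (2 * A) / (1 - b 1)"
      using n b_less_1[of 1] by (intro divide_right_mono) auto
    finally have "real A * (\<Sum>m\<in>{A..<2 * A}. U n m) \<le> real A * (2 / (1 - b 1))" by (simp add: field_simps)
    then show "(\<Sum>m\<in>{A..<2 * A}. U n m) \<le> 2 / (1 - b 1)"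
      by (rule mult_left_le_imp_le) (use assms in simp)
  next
    fix n assume n: "1 \<le> n" "2 * A < n"
    have "(\<Sum>m\<in>{A..<2 * A}. U n m) = (\<Sum>m\<in>{A..<2 * A}. \<Sum>j\<in>{1..n}. p n j * U j m)"
      using n assms by (intro sum.cong refl) (subst U_rec, auto)
    also have "\<dots> = (\<Sum>j\<in>{1..n}. p n j * (\<Sum>m\<in>{A..<2 * A}. U j m))"
      unfolding sum_distrib_left by (rule sum.swap)
    finally show "(\<Sum>m\<in>{A..<2 * A}. U n m) \<le> (\<Sum>j\<in>{1..n}. p n j * (\<Sum>m\<in>{A..<2 * A}. U j m))" by simp
  qed (use True b_less_1[of 1] in auto)
qed

lemma dyadic_blocks:
  fixes f :: "nat \<Rightarrow> real"
  assumes "A \<ge> 1"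
  shows "(\<Sum>m\<in>{A..<2 ^ N * A}. f m) = (\<Sum>i<N. \<Sum>m\<in>{2 ^ i * A..<2 * (2 ^ i * A)}. f m)"
proof (induction N)
  case (Suc N)
  have "{A..<2 ^ Suc N * A} = {A..<2 ^ N * A} \<union> {2 ^ N * A..<2 * (2 ^ N * A)}"
    using assms by (auto simp: ivl_disj_un)
  then have "(\<Sum>m\<in>{A..<2 ^ Suc N * A}. f m)
      = (\<Sum>m\<in>{A..<2 ^ N * A}. f m) + (\<Sum>m\<in>{2 ^ N * A..<2 * (2 ^ N * A)}. f m)"
    by (simp add: sum.union_disjoint)
  then show ?case using Suc by simp
qed simp

text \<open>On each dyadic block the decreasing weight is at most its first value, and the expected
  number of visits is bounded by the constant of \<open>U_block_bound\<close>. Because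
  \<open>n < 2 ^ n * A\<close>, \<open>n\<close> blocks reach beyond \<open>n\<close>.\<close>

lemma U_tail_dyadic:
  fixes \<beta> :: "nat \<Rightarrow> real"
  assumes mono: "\<And>m l. m \<le> l \<Longrightarrow> \<beta> l \<le> \<beta> m" and nonneg: "\<And>m. \<beta> m \<ge> 0"
    and "A \<ge> 1" and sm: "summable (\<lambda>i. \<beta> (2 ^ i * A))"
  shows "(\<Sum>m\<in>{A..n}. U n m * \<beta> m) \<le> 2 / (1 - b 1) * (\<Sum>i. \<beta> (2 ^ i * A))"
proof -
  have "n < 2 ^ n" by simp
  also have "(2 :: nat) ^ n \<le> 2 ^ n * A" using \<open>A \<ge> 1\<close> by simp
  finally have n: "n < 2 ^ n * A" .
  have "(\<Sum>m\<in>{A..n}. U n m * \<beta> m) \<le> (\<Sum>m\<in>{A..<2 ^ n * A}. U n m * \<beta> m)"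
    using n nonneg U_nonneg \<open>A \<ge> 1\<close> by (intro sum_mono2) auto
  also have "\<dots> = (\<Sum>i<n. \<Sum>m\<in>{2 ^ i * A..<2 * (2 ^ i * A)}. U n m * \<beta> m)"
    using dyadic_blocks[OF \<open>A \<ge> 1\<close>] .
  also have "\<dots> \<le> (\<Sum>i<n. 2 / (1 - b 1) * \<beta> (2 ^ i * A))"
  proof (rule sum_mono)
    fix i
    have "2 ^ i * A \<ge> 1" using \<open>A \<ge> 1\<close> by simp
    have "(\<Sum>m\<in>{2 ^ i * A..<2 * (2 ^ i * A)}. U n m * \<beta> m)
        \<le> (\<Sum>m\<in>{2 ^ i * A..<2 * (2 ^ i * A)}. U n m * \<beta> (2 ^ i * A))"
      using \<open>2 ^ i * A \<ge> 1\<close> by (intro sum_mono mult_left_mono mono U_nonneg) auto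
    also have "\<dots> \<le> 2 / (1 - b 1) * \<beta> (2 ^ i * A)"
      unfolding sum_distrib_right[symmetric]
      using U_block_bound[OF \<open>2 ^ i * A \<ge> 1\<close>] nonneg by (intro mult_right_mono) auto
    finally show "(\<Sum>m\<in>{2 ^ i * A..<2 * (2 ^ i * A)}. U n m * \<beta> m) \<le> 2 / (1 - b 1) * \<beta> (2 ^ i * A)" .
  qed
  also have "\<dots> \<le> 2 / (1 - b 1) * (\<Sum>i. \<beta> (2 ^ i * A))"
    unfolding sum_distrib_left[symmetric]
    using b_less_1[of 1] nonneg sm by (intro mult_left_mono sum_le_suminf) auto
  finally show ?thesis .
qed

text \<open>Cauchy condensation: the factor \<open>2 ^ i\<close> cancels against the
  denominator.\<close>

lemma summable_dyadic:
  fixes \<beta> :: "nat \<Rightarrow> real"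
  assumes mono: "\<And>m l. m \<le> l \<Longrightarrow> \<beta> l \<le> \<beta> m" and nonneg: "\<And>m. \<beta> m \<ge> 0"
    and sm: "summable (\<lambda>m. \<beta> m / real m)"
  shows "summable (\<lambda>i. \<beta> (2 ^ i))"
proof -
  have "summable (\<lambda>n. 2 ^ n * (\<beta> (2 ^ n) / real (2 ^ n)))"
    using sm by (subst condensation_test[symmetric])
      (auto intro!: frac_le divide_nonneg_nonneg mono nonneg simp: less_imp_le)
  then show ?thesis by simp
qed

text \<open>The point is uniformity in \<open>n\<close>: this replaces a dominating function, for
  \<open>c\<close> when \<mu> is finite and for \<open>b\<close> when \<nu> is finite.\<close>

lemma U_tail:
  fixes \<beta> :: "nat \<Rightarrow> real"
  assumes mono: "\<And>m l. m \<le> l \<Longrightarrow> \<beta> l \<le> \<beta> m" and nonneg: "\<And>m. \<beta> m \<ge> 0"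
    and sm: "summable (\<lambda>m. \<beta> m / real m)" and "\<epsilon> > 0"
  shows "\<exists>A0\<ge>1. \<forall>A\<ge>A0. \<forall>n. (\<Sum>m\<in>{A..n}. U n m * \<beta> m) < \<epsilon>"
proof -
  define K where "K = 2 / (1 - b 1)"
  have "K > 0" using b_less_1[of 1] by (simp add: K_def)
  have sm2: "summable (\<lambda>i. \<beta> (2 ^ i))" using summable_dyadic assms by blast
  obtain J where J: "\<And>j. j \<ge> J \<Longrightarrow> norm (\<Sum>i. \<beta> (2 ^ (i + j))) < \<epsilon> / K"
    using suminf_exist_split[OF divide_pos_pos[OF \<open>\<epsilon> > 0\<close> \<open>K > 0\<close>] sm2] by blast
  have "(\<Sum>m\<in>{A..n}. U n m * \<beta> m) < \<epsilon>" if "A \<ge> 2 ^ J" for A n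
  proof -
    have "(\<Sum>m\<in>{A..n}. U n m * \<beta> m) \<le> (\<Sum>m\<in>{2 ^ J..n}. U n m * \<beta> m)"
    proof (rule sum_mono2)
      fix m assume "m \<in> {2 ^ J..n} - {A..n}"
      then have "m \<ge> 2 ^ J" by auto
      moreover have "(2::nat) ^ J \<ge> 1" by simp
      ultimately show "0 \<le> U n m * \<beta> m" using U_nonneg[of m n] nonneg by (meson mult_nonneg_nonneg order_trans)
    qed (use that in auto)
    also have "\<dots> \<le> K * (\<Sum>i. \<beta> (2 ^ i * 2 ^ J))"
      unfolding K_def using summable_ignore_initial_segment[OF sm2, of J]
      by (intro U_tail_dyadic mono nonneg) (auto simp: power_add)
    also have "\<dots> \<le> K * norm (\<Sum>i. \<beta> (2 ^ i * 2 ^ J))"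
      using \<open>K > 0\<close> by (intro mult_left_mono) auto
    also have "\<dots> < \<epsilon>"
      using J[of J] \<open>K > 0\<close> by (simp add: power_add field_simps)
    finally show ?thesis .
  qed
  then show ?thesis by (intro exI[of _ "2 ^ J"]) auto
qed

lemma U_Lipschitz:
  assumes "m \<ge> 1"
  shows "real (Suc n) * \<bar>U (Suc n) m - U n m\<bar> \<le> real m / c m + real (Suc m) / c (Suc m)"
proof -
  have 1: "0 \<le> real m * U (Suc n) m" "real m * U (Suc n) m \<le> real m * (1 / c m)"
    using U_nonneg[of m "Suc n"] U_le[of m "Suc n"] assms by (auto intro!: mult_nonneg_nonneg mult_left_mono simp del: times_divide_eq_right)
  have 2: "0 \<le> real (Suc m) * U (Suc n) (Suc m)" "real (Suc m) * U (Suc n) (Suc m) \<le> real (Suc m) * (1 / c (Suc m))"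
    using U_nonneg[of "Suc m" "Suc n"] U_le[of "Suc m" "Suc n"]
    by (auto intro!: mult_left_mono mult_nonneg_nonneg simp del: of_nat_Suc times_divide_eq_right)
  have "real (Suc n) * \<bar>U (Suc n) m - U n m\<bar> = \<bar>real m * U (Suc n) m - real (Suc m) * U (Suc n) (Suc m)\<bar>"
    unfolding U_Suc_diff[OF assms, symmetric] abs_mult by simp
  also have "\<dots> \<le> real m * (1 / c m) + real (Suc m) * (1 / c (Suc m))" using 1 2 by linarith
  finally show ?thesis by simp
qed

end

section \<open>Concentration of binomial weights by Chebyshev's inequality\<close>

lemma Bernstein_variance:
  "(\<Sum>j\<le>n. (real j - real n * x)\<^sup>2 * Bernstein n j x) = real n * x * (1 - x)"
proof -
  have "(\<Sum>j\<le>n. (real j - real n * x)\<^sup>2 * Bernstein n j x)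
    = (\<Sum>j\<le>n. real j * (real j - 1) * Bernstein n j x + (1 - 2 * real n * x) * (real j * Bernstein n j x)
        + (real n * x)\<^sup>2 * Bernstein n j x)"
    by (intro sum.cong refl) (simp add: algebra_simps power2_eq_square)
  also have "\<dots> = real n * (real n - 1) * x\<^sup>2 + (1 - 2 * real n * x) * (real n * x) + (real n * x)\<^sup>2"
    by (simp only: sum.distrib sum_distrib_left[symmetric] sum_Bernstein sum_k_Bernstein sum_kk_Bernstein)
  finally show ?thesis by (simp add: algebra_simps power2_eq_square)
qed

lemma Bernstein_Chebyshev:
  assumes "0 \<le> x" "x \<le> 1" "\<eta> > 0" "n \<ge> 1"
  shows "(\<Sum>j\<in>{j. j \<le> n \<and> \<bar>real j - real n * x\<bar> \<le> \<eta> * real n}. Bernstein n j x) \<ge> 1 - 1 / (4 * \<eta>\<^sup>2 * real n)"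
proof -
  let ?A = "{j. j \<le> n \<and> \<bar>real j - real n * x\<bar> \<le> \<eta> * real n}"
  have "(\<eta> * real n)\<^sup>2 * (\<Sum>j\<in>{..n} - ?A. Bernstein n j x)
      \<le> (\<Sum>j\<in>{..n} - ?A. (real j - real n * x)\<^sup>2 * Bernstein n j x)"
    unfolding sum_distrib_left
  proof (intro sum_mono mult_right_mono Bernstein_nonneg)
    fix j assume "j \<in> {..n} - ?A"
    then show "(\<eta> * real n)\<^sup>2 \<le> (real j - real n * x)\<^sup>2"
      using \<open>\<eta> > 0\<close> by (subst power2_abs[symmetric]) (intro power_mono, auto)
  qed (use assms in auto)
  also have "\<dots> \<le> (\<Sum>j\<le>n. (real j - real n * x)\<^sup>2 * Bernstein n j x)"
    using assms by (intro sum_mono2 mult_nonneg_nonneg Bernstein_nonneg) auto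
  also have "\<dots> = real n * (x * (1 - x))" by (simp add: Bernstein_variance)
  also have "\<dots> \<le> real n * (1 / 4)"
  proof (intro mult_left_mono)
    have "x * (1 - x) = 1 / 4 - (x - 1 / 2)\<^sup>2" by (simp add: power2_eq_square algebra_simps)
    then show "x * (1 - x) \<le> 1 / 4" by simp
  qed auto
  finally have "(\<Sum>j\<in>{..n} - ?A. Bernstein n j x) \<le> 1 / (4 * \<eta>\<^sup>2 * real n)"
    using assms by (simp add: field_simps power2_eq_square)
  moreover have "(\<Sum>j\<le>n. Bernstein n j x) = (\<Sum>j\<in>?A. Bernstein n j x) + (\<Sum>j\<in>{..n} - ?A. Bernstein n j x)"
    by (subst add.commute, rule sum.subset_diff) auto
  ultimately show ?thesis by simp
qed

section \<open>Limits along asymptotically proportional indices\<close>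

lemma bounded_seq_limsup:
  fixes a :: "nat \<Rightarrow> real"
  assumes "\<And>n. \<bar>a n\<bar> \<le> B"
  obtains \<kappa> \<sigma> where "strict_mono \<sigma>" "(a \<circ> \<sigma>) \<longlonglongrightarrow> \<kappa>" "\<And>\<epsilon>. \<epsilon> > 0 \<Longrightarrow> eventually (\<lambda>n. a n < \<kappa> + \<epsilon>) sequentially"
proof -
  define u where "u n = ereal (a n)" for n
  obtain \<sigma> :: "nat \<Rightarrow> nat" where \<sigma>: "strict_mono \<sigma>" "(u \<circ> \<sigma>) \<longlonglongrightarrow> limsup u"
    using limsup_subseq_lim by auto
  have "limsup u \<le> ereal B"
    using assms by (intro Limsup_bounded) (auto simp: u_def abs_le_iff)
  moreover have "ereal (- B) \<le> limsup u"
  proof -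
    have "ereal (- B) \<le> liminf u"
      using assms by (intro Liminf_bounded) (auto simp: u_def abs_le_iff intro!: eventuallyI, meson minus_le_iff)
    also have "\<dots> \<le> limsup u" by (simp add: Liminf_le_Limsup)
    finally show ?thesis .
  qed
  ultimately obtain \<kappa> where \<kappa>: "limsup u = ereal \<kappa>" by (cases "limsup u") auto
  show ?thesis
  proof (rule that[of \<sigma> \<kappa>])
    show "(a \<circ> \<sigma>) \<longlonglongrightarrow> \<kappa>" using \<sigma>(2) unfolding \<kappa> by (simp add: u_def comp_def)
    fix \<epsilon> :: real assume "\<epsilon> > 0"
    then have "limsup u < ereal (\<kappa> + \<epsilon>)" by (simp add: \<kappa>)
    then show "eventually (\<lambda>n. a n < \<kappa> + \<epsilon>) sequentially"
      by (drule_tac Limsup_lessD) (simp add: u_def)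
  qed fact
qed

abbreviation has_ratio :: "(nat \<Rightarrow> nat) \<Rightarrow> (nat \<Rightarrow> nat) \<Rightarrow> real \<Rightarrow> bool" where
  "has_ratio \<tau> \<sigma> t \<equiv> (\<lambda>k. real (\<tau> k) / real (\<sigma> k)) \<longlonglongrightarrow> t"

text \<open>Iterated limit of \<open>a (t * \<sigma> k)\<close>, first for \<open>k \<rightarrow> \<infinity>\<close> and then for \<open>t \<rightarrow> 0\<close>; the index
  \<open>\<tau> k\<close> stands for an integer rounding of \<open>t * \<sigma> k\<close>.\<close>

definition scale_limit :: "(nat \<Rightarrow> nat) \<Rightarrow> (nat \<Rightarrow> real) \<Rightarrow> real \<Rightarrow> bool" where
  "scale_limit \<sigma> a \<kappa> \<longleftrightarrow> (\<forall>\<epsilon>>0. \<exists>t0>0. \<forall>t. 0 < t \<and> t \<le> t0 \<longrightarrow>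
     (\<forall>\<tau>. has_ratio \<tau> \<sigma> t \<longrightarrow> (\<forall>\<^sub>F k in sequentially. \<bar>a (\<tau> k) - \<kappa>\<bar> < \<epsilon>)))"

lemma scale_limitE:
  assumes "scale_limit \<sigma> a \<kappa>" "\<epsilon> > 0"
  obtains t0 where "t0 > 0" "\<And>t \<tau>. 0 < t \<Longrightarrow> t \<le> t0 \<Longrightarrow> has_ratio \<tau> \<sigma> t \<Longrightarrow>
      \<forall>\<^sub>F k in sequentially. \<bar>a (\<tau> k) - \<kappa>\<bar> < \<epsilon>"
proof -
  obtain t0 where "t0 > 0" "\<forall>t. 0 < t \<and> t \<le> t0 \<longrightarrow> (\<forall>\<tau>. has_ratio \<tau> \<sigma> t \<longrightarrow>
      (\<forall>\<^sub>F k in sequentially. \<bar>a (\<tau> k) - \<kappa>\<bar> < \<epsilon>))"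
    using assms(1)[unfolded scale_limit_def, rule_format, OF assms(2)] by (elim exE conjE)
  then show ?thesis using that[of t0] by simp
qed

lemma filterlim_scaled:
  assumes "filterlim \<sigma> at_top sequentially" "has_ratio \<tau> \<sigma> t" "t > 0"
  shows "filterlim \<tau> at_top sequentially"
proof -
  have \<sigma>: "filterlim (\<lambda>k. real (\<sigma> k)) at_top sequentially"
    using filterlim_compose[OF filterlim_real_sequentially assms(1)] .
  have "filterlim (\<lambda>k. real (\<tau> k) / real (\<sigma> k) * real (\<sigma> k)) at_top sequentially"
    using filterlim_tendsto_pos_mult_at_top[OF assms(2,3) \<sigma>] .
  moreover have "\<forall>\<^sub>F k in sequentially. real (\<tau> k) / real (\<sigma> k) * real (\<sigma> k) = real (\<tau> k)"
    using eventually_compose_filterlim[OF eventually_gt_at_top[of 0] \<sigma>] by eventually_elim simp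
  ultimately have "filterlim (\<lambda>k. real (\<tau> k)) at_top sequentially"
    by (subst (asm) filterlim_cong[OF refl refl]) auto
  then show ?thesis by (simp add: filterlim_sequentially_iff_filterlim_real)
qed

lemma floor_scaled:
  assumes "filterlim \<sigma> at_top sequentially" "t \<ge> 0"
  shows "(\<lambda>k. real (nat \<lfloor>t * real (\<sigma> k)\<rfloor>) / real (\<sigma> k)) \<longlonglongrightarrow> t"
proof (rule tendsto_sandwich)
  have \<sigma>: "filterlim (\<lambda>k. real (\<sigma> k)) at_top sequentially"
    using filterlim_compose[OF filterlim_real_sequentially assms(1)] .
  have pos: "\<forall>\<^sub>F k in sequentially. real (\<sigma> k) > 0"
    using eventually_compose_filterlim[OF eventually_gt_at_top[of 0] \<sigma>] .
  have fl: "real (nat \<lfloor>t * real (\<sigma> k)\<rfloor>) \<le> t * real (\<sigma> k)" "t * real (\<sigma> k) - 1 \<le> real (nat \<lfloor>t * real (\<sigma> k)\<rfloor>)" for k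
  proof -
    have "t * real (\<sigma> k) \<ge> 0" using \<open>t \<ge> 0\<close> by simp
    then show "real (nat \<lfloor>t * real (\<sigma> k)\<rfloor>) \<le> t * real (\<sigma> k)" "t * real (\<sigma> k) - 1 \<le> real (nat \<lfloor>t * real (\<sigma> k)\<rfloor>)"
      by linarith+
  qed
  show "\<forall>\<^sub>F k in sequentially. t - 1 / real (\<sigma> k) \<le> real (nat \<lfloor>t * real (\<sigma> k)\<rfloor>) / real (\<sigma> k)"
    using pos
  proof eventually_elim
    case (elim k)
    have "t - 1 / real (\<sigma> k) = (t * real (\<sigma> k) - 1) / real (\<sigma> k)" using elim by (simp add: field_simps)
    also have "\<dots> \<le> real (nat \<lfloor>t * real (\<sigma> k)\<rfloor>) / real (\<sigma> k)"
      using fl(2)[of k] elim by (intro divide_right_mono) auto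
    finally show ?case .
  qed
  show "\<forall>\<^sub>F k in sequentially. real (nat \<lfloor>t * real (\<sigma> k)\<rfloor>) / real (\<sigma> k) \<le> t"
    using pos by eventually_elim (use fl(1) in \<open>simp add: field_simps\<close>)
  have "(\<lambda>k. t - 1 / real (\<sigma> k)) \<longlonglongrightarrow> t - 0"
    by (intro tendsto_intros tendsto_divide_0[OF tendsto_const] filterlim_at_top_imp_at_infinity \<sigma>)
  then show "(\<lambda>k. t - 1 / real (\<sigma> k)) \<longlonglongrightarrow> t" by simp
qed auto

text \<open>Eventually both indices exceed half of \<open>min t t' * \<sigma> k\<close>; this half
  is the origin of the factor 2.\<close>

lemma log_Lipschitz_scaled:
  fixes a :: "nat \<Rightarrow> real"
  assumes step: "\<And>n. real (Suc n) * \<bar>a (Suc n) - a n\<bar> \<le> C"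
    and \<sigma>: "filterlim \<sigma> at_top sequentially"
    and \<tau>: "has_ratio \<tau> \<sigma> t" and \<tau>': "has_ratio \<tau>' \<sigma> t'"
    and t: "t > 0" "t' > 0" and "\<epsilon> > 0"
  shows "\<forall>\<^sub>F k in sequentially. \<bar>a (\<tau> k) - a (\<tau>' k)\<bar> < 2 * C * \<bar>t - t'\<bar> / min t t' + \<epsilon>"
proof -
  define l where "l = min t t'"
  have "l > 0" using t by (simp add: l_def)
  have pos: "\<forall>\<^sub>F k in sequentially. real (\<sigma> k) > 0"
    using eventually_compose_filterlim[OF eventually_gt_at_top[of 0] filterlim_compose[OF filterlim_real_sequentially \<sigma>]] .
  have "((\<lambda>k. 2 * C * \<bar>real (\<tau> k) / real (\<sigma> k) - real (\<tau>' k) / real (\<sigma> k)\<bar> / l) \<longlonglongrightarrow> 2 * C * \<bar>t - t'\<bar> / l)"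
    using \<open>l > 0\<close> by (intro tendsto_intros \<tau> \<tau>') auto
  then have 1: "\<forall>\<^sub>F k in sequentially. 2 * C * \<bar>real (\<tau> k) / real (\<sigma> k) - real (\<tau>' k) / real (\<sigma> k)\<bar> / l
      < 2 * C * \<bar>t - t'\<bar> / l + \<epsilon>"
    by (rule order_tendstoD) (use \<open>\<epsilon> > 0\<close> in simp)
  have 2: "\<forall>\<^sub>F k in sequentially. l / 2 < real (\<tau> k) / real (\<sigma> k)"
    using \<tau> by (rule order_tendstoD) (use t in \<open>auto simp: l_def\<close>)
  have 3: "\<forall>\<^sub>F k in sequentially. l / 2 < real (\<tau>' k) / real (\<sigma> k)"
    using \<tau>' by (rule order_tendstoD) (use t in \<open>auto simp: l_def\<close>)
  show ?thesis using 1 2 3 pos unfolding l_def[symmetric]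
  proof eventually_elim
    case (elim k)
    have "\<bar>a (\<tau> k) - a (\<tau>' k)\<bar> \<le> C * \<bar>real (\<tau> k) - real (\<tau>' k)\<bar> / (l / 2 * real (\<sigma> k))"
      using elim \<open>l > 0\<close> by (intro log_Lipschitz_min[OF step]) (auto simp: field_simps)
    also have "\<dots> = 2 * C * \<bar>real (\<tau> k) / real (\<sigma> k) - real (\<tau>' k) / real (\<sigma> k)\<bar> / l"
      using elim \<open>l > 0\<close> by (simp add: diff_divide_distrib[symmetric] abs_divide field_simps)
    finally show ?case using elim by simp
  qed
qed

lemma scale_limit_cmult:
  assumes "scale_limit \<sigma> a \<kappa>" shows "scale_limit \<sigma> (\<lambda>n. x * a n) (x * \<kappa>)"
  unfolding scale_limit_def
proof (intro allI impI)
  fix \<epsilon> :: real assume "\<epsilon> > 0"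
  then have "\<epsilon> / (\<bar>x\<bar> + 1) > 0" by simp
  from scale_limitE[OF assms this] obtain t0 where t0: "t0 > 0" "\<And>t \<tau>. 0 < t \<Longrightarrow> t \<le> t0 \<Longrightarrow> has_ratio \<tau> \<sigma> t \<Longrightarrow>
      \<forall>\<^sub>F k in sequentially. \<bar>a (\<tau> k) - \<kappa>\<bar> < \<epsilon> / (\<bar>x\<bar> + 1)"
    by blast
  have *: "\<bar>x * y - x * \<kappa>\<bar> < \<epsilon>" if "\<bar>y - \<kappa>\<bar> < \<epsilon> / (\<bar>x\<bar> + 1)" for y
  proof -
    have "\<bar>x * y - x * \<kappa>\<bar> = \<bar>x\<bar> * \<bar>y - \<kappa>\<bar>" by (simp add: right_diff_distrib[symmetric] abs_mult)
    also have "\<dots> \<le> \<bar>x\<bar> * (\<epsilon> / (\<bar>x\<bar> + 1))" using that by (intro mult_left_mono) auto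
    also have "\<dots> < \<epsilon>" using \<open>\<epsilon> > 0\<close> by (simp add: field_simps)
    finally show ?thesis .
  qed
  show "\<exists>t0>0. \<forall>t. 0 < t \<and> t \<le> t0 \<longrightarrow> (\<forall>\<tau>. has_ratio \<tau> \<sigma> t \<longrightarrow>
      (\<forall>\<^sub>F k in sequentially. \<bar>x * a (\<tau> k) - x * \<kappa>\<bar> < \<epsilon>))"
  proof (intro exI[of _ t0] conjI allI impI)
    fix t \<tau> assume "0 < t \<and> t \<le> t0" "has_ratio \<tau> \<sigma> t"
    then have "\<forall>\<^sub>F k in sequentially. \<bar>a (\<tau> k) - \<kappa>\<bar> < \<epsilon> / (\<bar>x\<bar> + 1)" using t0 by blast
    then show "\<forall>\<^sub>F k in sequentially. \<bar>x * a (\<tau> k) - x * \<kappa>\<bar> < \<epsilon>"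
      by eventually_elim (rule *)
  qed (use t0 in auto)
qed

lemma scale_limit_diff:
  assumes "scale_limit \<sigma> a \<kappa>" "scale_limit \<sigma> a' \<kappa>'" shows "scale_limit \<sigma> (\<lambda>n. a n - a' n) (\<kappa> - \<kappa>')"
  unfolding scale_limit_def
proof (intro allI impI)
  fix \<epsilon> :: real assume "\<epsilon> > 0"
  then have "\<epsilon> / 2 > 0" by simp
  from scale_limitE[OF assms(1) this] obtain t0 where t0: "t0 > 0" "\<And>t \<tau>. 0 < t \<Longrightarrow> t \<le> t0 \<Longrightarrow> has_ratio \<tau> \<sigma> t \<Longrightarrow>
      \<forall>\<^sub>F k in sequentially. \<bar>a (\<tau> k) - \<kappa>\<bar> < \<epsilon> / 2"
    by blast
  from scale_limitE[OF assms(2) \<open>\<epsilon> / 2 > 0\<close>] obtain t0' where t0': "t0' > 0" "\<And>t \<tau>. 0 < t \<Longrightarrow> t \<le> t0' \<Longrightarrow> has_ratio \<tau> \<sigma> t \<Longrightarrow>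
      \<forall>\<^sub>F k in sequentially. \<bar>a' (\<tau> k) - \<kappa>'\<bar> < \<epsilon> / 2"
    by blast
  show "\<exists>t0>0. \<forall>t. 0 < t \<and> t \<le> t0 \<longrightarrow> (\<forall>\<tau>. has_ratio \<tau> \<sigma> t \<longrightarrow>
      (\<forall>\<^sub>F k in sequentially. \<bar>a (\<tau> k) - a' (\<tau> k) - (\<kappa> - \<kappa>')\<bar> < \<epsilon>))"
  proof (intro exI[of _ "min t0 t0'"] conjI allI impI)
    fix t \<tau> assume "0 < t \<and> t \<le> min t0 t0'" "has_ratio \<tau> \<sigma> t"
    then have "\<forall>\<^sub>F k in sequentially. \<bar>a (\<tau> k) - \<kappa>\<bar> < \<epsilon> / 2" "\<forall>\<^sub>F k in sequentially. \<bar>a' (\<tau> k) - \<kappa>'\<bar> < \<epsilon> / 2"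
      using t0 t0' by auto
    then show "\<forall>\<^sub>F k in sequentially. \<bar>a (\<tau> k) - a' (\<tau> k) - (\<kappa> - \<kappa>')\<bar> < \<epsilon>"
      by eventually_elim linarith
  qed (use t0 t0' in auto)
qed

text \<open>Both \<open>\<tau> k\<close> and the left end of its window, at ratio
  \<open>t - \<theta> * t\<close>, are covered by the hypothesis on \<open>a\<close>. Hence
  \<open>a\<close> hardly changes over the window, and \<open>log_derivative_bound\<close>
  applies.\<close>

lemma scale_limit_log_derivative:
  fixes a d :: "nat \<Rightarrow> real"
  assumes lim: "scale_limit \<sigma> a \<kappa>" and \<sigma>: "filterlim \<sigma> at_top sequentially"
    and der: "\<And>n. real (Suc n) * (a (Suc n) - a n) = d (Suc n)"
    and lip: "\<And>n. real (Suc n) * \<bar>d (Suc n) - d n\<bar> \<le> C"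
  shows "scale_limit \<sigma> d 0"
  unfolding scale_limit_def
proof (intro allI impI)
  fix \<epsilon> :: real assume "\<epsilon> > 0"
  have "C \<ge> 0" by (rule log_Lipschitz_const_nonneg[OF lip])
  \<comment> \<open>This choice keeps \<open>2 * C * \<theta>\<close> below
    \<open>\<epsilon> / 2\<close>. Afterwards \<open>a\<close> is controlled to accuracy
    \<open>\<epsilon> * \<theta> / 8\<close> at both ends of the window, which the factor
    \<open>2 / \<theta>\<close> turns into the other \<open>\<epsilon> / 2\<close>.\<close>
  define \<theta> where "\<theta> = min (1 / 2) (\<epsilon> / (4 * C + 4))"
  have \<theta>: "0 < \<theta>" "\<theta> \<le> 1 / 2"
    using \<open>\<epsilon> > 0\<close> \<open>C \<ge> 0\<close> unfolding \<theta>_def by (simp, intro min.cobounded1)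
  have C\<theta>: "2 * C * \<theta> < \<epsilon> / 2"
  proof -
    have "2 * C * \<theta> \<le> 2 * C * (\<epsilon> / (4 * C + 4))" using \<open>C \<ge> 0\<close> by (intro mult_left_mono) (auto simp: \<theta>_def)
    also have "\<dots> < \<epsilon> / 2" using \<open>\<epsilon> > 0\<close> \<open>C \<ge> 0\<close> by (simp add: field_simps)
    finally show ?thesis .
  qed
  have "\<epsilon> * \<theta> / 8 > 0" using \<open>\<epsilon> > 0\<close> \<theta> by simp
  from scale_limitE[OF lim this] obtain t0 where t0: "t0 > 0" "\<And>t \<tau>. 0 < t \<Longrightarrow> t \<le> t0 \<Longrightarrow> has_ratio \<tau> \<sigma> t \<Longrightarrow>
      \<forall>\<^sub>F k in sequentially. \<bar>a (\<tau> k) - \<kappa>\<bar> < \<epsilon> * \<theta> / 8"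
    by blast
  show "\<exists>t0>0. \<forall>t. 0 < t \<and> t \<le> t0 \<longrightarrow> (\<forall>\<tau>. has_ratio \<tau> \<sigma> t \<longrightarrow>
      (\<forall>\<^sub>F k in sequentially. \<bar>d (\<tau> k) - 0\<bar> < \<epsilon>))"
  proof (intro exI[of _ t0] conjI allI impI)
    fix t \<tau> assume t: "0 < t \<and> t \<le> t0" and \<tau>: "has_ratio \<tau> \<sigma> t"
    have \<tau>_top: "filterlim \<tau> at_top sequentially" using filterlim_scaled[OF \<sigma> \<tau>] t by simp
    have \<tau>_pos: "\<forall>\<^sub>F k in sequentially. \<tau> k > 0"
      using eventually_compose_filterlim[OF eventually_gt_at_top[of 0] \<tau>_top] .
    define \<tau>' where "\<tau>' k = \<tau> k - nat \<lfloor>\<theta> * real (\<tau> k)\<rfloor>" for k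
    have floor_le: "nat \<lfloor>\<theta> * real n\<rfloor> \<le> n" for n
    proof -
      have "\<theta> * real n \<le> 1 * real n" using \<theta> by (intro mult_right_mono) auto
      then show ?thesis by linarith
    qed
    have "(\<lambda>k. real (\<tau> k) / real (\<sigma> k) - real (nat \<lfloor>\<theta> * real (\<tau> k)\<rfloor>) / real (\<tau> k) * (real (\<tau> k) / real (\<sigma> k)))
        \<longlonglongrightarrow> t - \<theta> * t"
      using \<theta> by (intro tendsto_intros \<tau> floor_scaled[OF \<tau>_top]) auto
    then have "has_ratio \<tau>' \<sigma> (t - \<theta> * t)"
      by (rule Lim_transform_eventually)
         (use \<tau>_pos in eventually_elim, simp add: \<tau>'_def of_nat_diff floor_le diff_divide_distrib)
    moreover have "0 < t - \<theta> * t" "t - \<theta> * t \<le> t0" using t \<theta> by (auto simp: mult_less_cancel_right2 algebra_simps)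
        (smt (verit) mult_nonneg_nonneg)
    ultimately have 1: "\<forall>\<^sub>F k in sequentially. \<bar>a (\<tau>' k) - \<kappa>\<bar> < \<epsilon> * \<theta> / 8" using t0 by blast
    have 2: "\<forall>\<^sub>F k in sequentially. \<bar>a (\<tau> k) - \<kappa>\<bar> < \<epsilon> * \<theta> / 8" using t0 t \<tau> by blast
    have 3: "\<forall>\<^sub>F k in sequentially. real (\<tau> k) \<ge> 1 / \<theta>"
      using eventually_compose_filterlim[OF eventually_ge_at_top[of "1 / \<theta>"] filterlim_compose[OF filterlim_real_sequentially \<tau>_top]] .
    show "\<forall>\<^sub>F k in sequentially. \<bar>d (\<tau> k) - 0\<bar> < \<epsilon>"
      using 1 2 3
    proof eventually_elim
      case (elim k)
      have "\<bar>d (\<tau> k)\<bar> \<le> 2 * C * \<theta> + 2 / \<theta> * \<bar>a (\<tau> k) - a (\<tau>' k)\<bar>"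
        unfolding \<tau>'_def using elim \<theta> by (intro log_derivative_bound[OF der lip]) (auto simp: field_simps)
      also have "2 / \<theta> * \<bar>a (\<tau> k) - a (\<tau>' k)\<bar> \<le> 2 / \<theta> * (\<epsilon> * \<theta> / 4)"
      proof (rule mult_left_mono)
        show "\<bar>a (\<tau> k) - a (\<tau>' k)\<bar> \<le> \<epsilon> * \<theta> / 4" using elim by linarith
      qed (use \<theta> in simp)
      also have "\<dots> = \<epsilon> / 2" using \<theta> by simp
      finally show ?case using C\<theta> by simp
    qed
  qed (use t0 in auto)
qed

context multiplicative_walk
begin

subsection \<open>The renewal theorem\<close>

definition W_support :: "real set" where
  "W_support = {w. 0 < w \<and> w < 1 \<and> (\<forall>\<eta>>0. prob {\<omega> \<in> space M. \<bar>W \<omega> - w\<bar> < \<eta>} > 0)}"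

text \<open>A value in the open unit interval but outside the support lies in an interval with
  rational ends that carries no mass, and there are only countably many of these.\<close>

lemma AE_W_support: "AE \<omega> in M. W \<omega> \<in> W_support"
proof -
  have null: "AE \<omega> in M. \<not> (of_rat (fst z) < W \<omega> \<and> W \<omega> < of_rat (snd z))"
    if "prob {\<omega> \<in> space M. of_rat (fst z) < W \<omega> \<and> W \<omega> < of_rat (snd z)} = 0" for z
    using that by (subst AE_iff_measurable[OF _ refl]) (auto simp: emeasure_eq_measure)
  have "AE \<omega> in M. \<forall>z. prob {\<omega> \<in> space M. of_rat (fst z) < W \<omega> \<and> W \<omega> < of_rat (snd z)} = 0 \<longrightarrow>
      \<not> (of_rat (fst z) < W \<omega> \<and> W \<omega> < of_rat (snd z))"
    unfolding AE_all_countable using null by auto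
  then show ?thesis using W_range
  proof eventually_elim
    case (elim \<omega>)
    show ?case
    proof (rule ccontr)
      assume "W \<omega> \<notin> W_support"
      then obtain \<eta> where \<eta>: "\<eta> > 0" "\<not> prob {\<omega>' \<in> space M. \<bar>W \<omega>' - W \<omega>\<bar> < \<eta>} > 0"
        using elim unfolding W_support_def by auto
      obtain r where r: "W \<omega> - \<eta> < of_rat r" "of_rat r < W \<omega>" using of_rat_dense[of "W \<omega> - \<eta>" "W \<omega>"] \<eta> by auto
      obtain s where s: "W \<omega> < of_rat s" "of_rat s < W \<omega> + \<eta>" using of_rat_dense[of "W \<omega>" "W \<omega> + \<eta>"] \<eta> by auto
      have "prob {\<omega>' \<in> space M. of_rat r < W \<omega>' \<and> W \<omega>' < of_rat s} \<le> prob {\<omega>' \<in> space M. \<bar>W \<omega>' - W \<omega>\<bar> < \<eta>}"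
        using r s by (intro finite_measure_mono) auto
      then have "prob {\<omega>' \<in> space M. of_rat r < W \<omega>' \<and> W \<omega>' < of_rat s} = 0"
        using \<eta> measure_nonneg[of M "{\<omega>' \<in> space M. of_rat r < W \<omega>' \<and> W \<omega>' < of_rat s}"] by linarith
      then show False using elim(1)[rule_format, of "(r, s)"] r s by auto
    qed
  qed
qed

text \<open>On the event that \<open>W\<close> is within \<open>\<eta> / 2\<close> of
  \<open>w\<close>, which has positive probability, Chebyshev's inequality with the other
  \<open>\<eta> / 2\<close> leaves mass at least 1/2 in the window as soon as
  \<open>n \<ge> 2 / \<eta>\<^sup>2\<close>.\<close>

lemma p_near:
  assumes "w \<in> W_support" "\<eta> > 0"
  shows "\<exists>p0>0. \<forall>\<^sub>F n in sequentially. p0 \<le> (\<Sum>j\<in>{j. j \<le> n \<and> \<bar>real j - real n * w\<bar> \<le> \<eta> * real n}. p n j)"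
proof -
  define E where "E = {\<omega> \<in> space M. \<bar>W \<omega> - w\<bar> < \<eta> / 2}"
  have [measurable]: "E \<in> events" unfolding E_def by measurable
  have "prob E > 0"
    using assms(1)[unfolded W_support_def] half_gt_zero[OF assms(2)] unfolding E_def by blast
  have "\<forall>\<^sub>F n in sequentially. real n \<ge> 2 / \<eta>\<^sup>2"
    using eventually_compose_filterlim[OF eventually_ge_at_top filterlim_real_sequentially] .
  then have "\<forall>\<^sub>F n in sequentially. prob E / 2 \<le> (\<Sum>j\<in>{j. j \<le> n \<and> \<bar>real j - real n * w\<bar> \<le> \<eta> * real n}. p n j)"
    using eventually_ge_at_top[of 1]
  proof eventually_elim
    case (elim n)
    let ?A = "{j. j \<le> n \<and> \<bar>real j - real n * w\<bar> \<le> \<eta> * real n}"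
    have fin: "finite ?A" by simp
    have "prob E / 2 = expectation (\<lambda>\<omega>. indicator E \<omega> * (1 / 2))" by simp
    also have "\<dots> \<le> expectation (\<lambda>\<omega>. \<Sum>j\<in>?A. Bernstein n j (W \<omega>))"
    proof (rule integral_mono_AE)
      show "AE \<omega> in M. indicator E \<omega> * (1 / 2) \<le> (\<Sum>j\<in>?A. Bernstein n j (W \<omega>))"
        using W_range
      proof eventually_elim
        case (elim \<omega>)
        then have W: "0 \<le> W \<omega>" "W \<omega> \<le> 1" by auto
        show ?case
        proof (cases "\<omega> \<in> E")
          case True
          then have close: "\<bar>W \<omega> - w\<bar> < \<eta> / 2" by (simp add: E_def)
          have "1 / (4 * (\<eta> / 2)\<^sup>2 * real n) \<le> 1 / 2"
            using \<open>\<eta> > 0\<close> \<open>2 / \<eta>\<^sup>2 \<le> real n\<close> \<open>1 \<le> n\<close> by (simp add: field_simps)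
          then have "1 / 2 \<le> 1 - 1 / (4 * (\<eta> / 2)\<^sup>2 * real n)" by simp
          also have "\<dots> \<le> (\<Sum>j\<in>{j. j \<le> n \<and> \<bar>real j - real n * W \<omega>\<bar> \<le> \<eta> / 2 * real n}. Bernstein n j (W \<omega>))"
            using W \<open>\<eta> > 0\<close> \<open>1 \<le> n\<close> by (intro Bernstein_Chebyshev) auto
          also have "\<dots> \<le> (\<Sum>j\<in>?A. Bernstein n j (W \<omega>))"
          proof (intro sum_mono2 fin)
            have "real n * \<bar>W \<omega> - w\<bar> \<le> real n * (\<eta> / 2)" using close by (intro mult_left_mono) auto
            then have "\<bar>real n * W \<omega> - real n * w\<bar> \<le> real n * (\<eta> / 2)"
              by (simp add: right_diff_distrib[symmetric] abs_mult)
            moreover have "real n * (\<eta> / 2) = \<eta> * real n / 2" "\<eta> / 2 * real n = \<eta> * real n / 2" by simp_all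
            ultimately have "\<bar>real j - real n * w\<bar> \<le> \<eta> * real n"
              if "\<bar>real j - real n * W \<omega>\<bar> \<le> \<eta> / 2 * real n" for j using that by linarith
            then show "{j. j \<le> n \<and> \<bar>real j - real n * W \<omega>\<bar> \<le> \<eta> / 2 * real n} \<subseteq> ?A" by blast
          qed (use W in \<open>auto intro: Bernstein_nonneg\<close>)
          finally show ?thesis using True by simp
        next
          case False
          then show ?thesis using W by (auto intro!: sum_nonneg Bernstein_nonneg)
        qed
      qed
    qed (auto intro!: integrable_sum integrable_divide integrable_real_indicator simp: emeasure_eq_measure)
    also have "\<dots> = (\<Sum>j\<in>?A. p n j)" unfolding p_def by (subst Bochner_Integration.integral_sum) auto
    finally show ?case .
  qed
  then show ?thesis using \<open>prob E > 0\<close> by (intro exI[of _ "prob E / 2"]) auto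
qed

lemma p_tendsto_0: "(\<lambda>n. p n j) \<longlonglongrightarrow> 0"
proof -
  have "(\<lambda>n. p n j) \<longlonglongrightarrow> expectation (\<lambda>_. 0)"
    unfolding p_def
  proof (rule integral_dominated_convergence[where w = "\<lambda>_. 1"])
    show "AE \<omega> in M. (\<lambda>n. Bernstein n j (W \<omega>)) \<longlonglongrightarrow> 0"
    proof (rule AE_W)
      fix x :: real assume x: "0 < x" "x < 1"
      have "(\<lambda>n. real n ^ j * (1 - x) ^ n) \<longlonglongrightarrow> 0"
      proof (cases "j = 0")
        case True
        then show ?thesis using x by (simp add: LIMSEQ_realpow_zero)
      next
        case False
        \<comment> \<open>Taking the \<open>j\<close>-th root reduces the claim to
          \<open>n * y ^ n\<close> tending to 0.\<close>
        define y where "y = root j (1 - x)"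
        have y: "0 < y" "y < 1" "y ^ j = 1 - x" using x False by (auto simp: y_def)
        have "(\<lambda>n. (real n * y ^ n) ^ j) \<longlonglongrightarrow> 0 ^ j"
          using y by (intro tendsto_power powser_times_n_limit_0) auto
        moreover have "(real n * y ^ n) ^ j = real n ^ j * (1 - x) ^ n" for n
          unfolding y(3)[symmetric] power_mult_distrib power_mult[symmetric] by (simp add: mult.commute)
        ultimately show ?thesis using False by (simp add: power_0_left)
      qed
      then have "(\<lambda>n. real n ^ j * (1 - x) ^ n * ((x / (1 - x)) ^ j)) \<longlonglongrightarrow> 0"
        by (rule tendsto_mult_left_zero)
      then show "(\<lambda>n. Bernstein n j x) \<longlonglongrightarrow> 0"
      proof (rule Lim_null_comparison[rotated])
        show "\<forall>\<^sub>F n in sequentially. norm (Bernstein n j x) \<le> real n ^ j * (1 - x) ^ n * ((x / (1 - x)) ^ j)"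
          using eventually_ge_at_top[of j]
        proof eventually_elim
          case (elim n)
          have "real (n choose j) \<le> real n ^ j"
            using binomial_le_pow[OF elim] by (metis of_nat_le_iff of_nat_power)
          then have "Bernstein n j x \<le> real n ^ j * x ^ j * (1 - x) ^ (n - j)"
            unfolding Bernstein_def using x by (intro mult_right_mono) auto
          also have "\<dots> = real n ^ j * (1 - x) ^ n * ((x / (1 - x)) ^ j)"
            using x elim by (simp add: power_diff power_divide)
          finally show ?case using x by (simp add: Bernstein_nonneg)
        qed
      qed
    qed
    show "AE \<omega> in M. norm (Bernstein n j (W \<omega>)) \<le> 1" for n
      by (rule AE_W) (auto intro: Bernstein_abs_le)
  qed auto
  then show ?thesis by simp
qed

text \<open>Where \<open>a\<close> is close to its upper limit, so is it after multiplying the argument by a point of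
  the support, since \<open>a n\<close> is an average of values that hardly exceed the upper limit.\<close>

lemma harmonic_limit_scaling:
  fixes a :: "nat \<Rightarrow> real"
  assumes bound: "\<And>n. \<bar>a n\<bar> \<le> B"
    and step: "\<And>n. real (Suc n) * \<bar>a (Suc n) - a n\<bar> \<le> C"
    and harm: "\<And>n. n > N0 \<Longrightarrow> a n = (\<Sum>j\<le>n. p n j * a j)"
    and upper: "\<And>\<epsilon>. \<epsilon> > 0 \<Longrightarrow> eventually (\<lambda>n. a n < \<kappa> + \<epsilon>) sequentially"
    and \<sigma>: "filterlim \<sigma> at_top sequentially" and lim: "(\<lambda>k. a (\<sigma> k)) \<longlonglongrightarrow> \<kappa>"
    and w: "w \<in> W_support" and \<tau>: "has_ratio \<tau> \<sigma> w"
  shows "(\<lambda>k. a (\<tau> k)) \<longlonglongrightarrow> \<kappa>"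
proof (rule order_tendstoI)
  have w01: "0 < w" "w < 1" using w by (auto simp: W_support_def)
  fix x assume "\<kappa> < x"
  then have "\<forall>\<^sub>F n in sequentially. a n < x" using upper[of "x - \<kappa>"] by simp
  then show "\<forall>\<^sub>F k in sequentially. a (\<tau> k) < x"
    using filterlim_scaled[OF \<sigma> \<tau> w01(1)] by (rule eventually_compose_filterlim)
next
  have w01: "0 < w" "w < 1" using w by (auto simp: W_support_def)
  have "C \<ge> 0" by (rule log_Lipschitz_const_nonneg[OF step])
  fix x assume "x < \<kappa>"
  define \<epsilon> where "\<epsilon> = \<kappa> - x"
  have "\<epsilon> > 0" using \<open>x < \<kappa>\<close> by (simp add: \<epsilon>_def)
  \<comment> \<open>So narrow that \<open>a\<close> varies by at most
    \<open>4 * C * \<eta> / w \<le> \<epsilon> / 2\<close> between \<open>\<tau> k\<close> and the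
    window around \<open>w * n\<close>.\<close>
  define \<eta> where "\<eta> = min (w / 2) (\<epsilon> * w / (8 * (C + 1)))"
  have \<eta>: "\<eta> > 0" "\<eta> \<le> w / 2"
    using w01 \<open>\<epsilon> > 0\<close> \<open>C \<ge> 0\<close> unfolding \<eta>_def by (simp, intro min.cobounded1)
  have C\<eta>: "4 * C * \<eta> / w \<le> \<epsilon> / 2"
  proof -
    have "4 * C * \<eta> \<le> 4 * C * (\<epsilon> * w / (8 * (C + 1)))" using \<open>C \<ge> 0\<close> by (intro mult_left_mono) (auto simp: \<eta>_def)
    also have "\<dots> \<le> \<epsilon> / 2 * w" using \<open>C \<ge> 0\<close> \<open>\<epsilon> > 0\<close> w01 by (simp add: field_simps)
    finally show ?thesis using w01 by (simp add: field_simps)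
  qed
  define A where "A n = {j. j \<le> n \<and> \<bar>real j - real n * w\<bar> \<le> \<eta> * real n}" for n
  obtain p0 where p0: "p0 > 0" "\<forall>\<^sub>F n in sequentially. p0 \<le> (\<Sum>j\<in>A n. p n j)"
    using p_near[OF w \<eta>(1)] unfolding A_def by blast
  \<comment> \<open>If \<open>a (\<tau> k) \<le> \<kappa> - \<epsilon>\<close>, the window lowers
    the average by \<open>p0 * \<epsilon> / 2 = 4 * \<delta>\<close>. That pushes
    \<open>a n - \<kappa> - \<delta>\<close> below \<open>- 3 * \<delta>\<close>, although it
    exceeds \<open>- 2 * \<delta>\<close>.\<close>
  define \<delta> where "\<delta> = p0 * \<epsilon> / 8"
  have "\<delta> > 0" using p0 \<open>\<epsilon> > 0\<close> by (simp add: \<delta>_def)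
  obtain J where J: "\<And>j. j \<ge> J \<Longrightarrow> a j < \<kappa> + \<delta>"
    using upper[OF \<open>\<delta> > 0\<close>] unfolding eventually_sequentially by blast
  \<comment> \<open>A crude bound for the indices below \<open>J\<close>, whose total weight tends
    to 0.\<close>
  define D where "D = B + \<bar>\<kappa>\<bar> + \<delta>"
  have D: "a j - \<kappa> - \<delta> \<le> D" for j
    using bound[of j] \<open>\<delta> > 0\<close> by (simp add: D_def)
  have "B \<ge> 0" using bound[of 0] by linarith
  then have "D \<ge> 0" using \<open>\<delta> > 0\<close> by (simp add: D_def)
  have "(\<lambda>n. (\<Sum>j<J. p n j) * D) \<longlonglongrightarrow> 0"
    by (intro tendsto_mult_left_zero tendsto_null_sum p_tendsto_0)
  then have 1: "\<forall>\<^sub>F n in sequentially. (\<Sum>j<J. p n j) * D < \<delta>" by (rule order_tendstoD) fact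
  have 2: "\<forall>\<^sub>F n in sequentially. real n * w \<ge> 2 * real J"
  proof -
    have "\<forall>\<^sub>F n in sequentially. real n \<ge> 2 * real J / w"
      using eventually_compose_filterlim[OF eventually_ge_at_top filterlim_real_sequentially] .
    then show ?thesis by eventually_elim (use w01 in \<open>simp add: field_simps\<close>)
  qed
  have "\<forall>\<^sub>F n in sequentially. n > N0 \<and> n > 0 \<and> p0 \<le> (\<Sum>j\<in>A n. p n j) \<and> (\<Sum>j<J. p n j) * D < \<delta> \<and> real n * w \<ge> 2 * real J"
    using p0(2) 1 2 eventually_gt_at_top[of N0] eventually_gt_at_top[of 0] by eventually_elim auto
  then have 3: "\<forall>\<^sub>F k in sequentially. \<sigma> k > N0 \<and> \<sigma> k > 0 \<and> p0 \<le> (\<Sum>j\<in>A (\<sigma> k). p (\<sigma> k) j) \<and>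
      (\<Sum>j<J. p (\<sigma> k) j) * D < \<delta> \<and> real (\<sigma> k) * w \<ge> 2 * real J"
    using \<sigma> by (rule eventually_compose_filterlim)
  have 4: "\<forall>\<^sub>F k in sequentially. a (\<sigma> k) > \<kappa> - \<delta>" using lim by (rule order_tendstoD) (use \<open>\<delta> > 0\<close> in simp)
  have 5: "\<forall>\<^sub>F k in sequentially. \<bar>real (\<tau> k) / real (\<sigma> k) - w\<bar> < \<eta>"
    using tendstoD[OF \<tau> \<eta>(1)] by (simp add: dist_real_def)
  show "\<forall>\<^sub>F k in sequentially. x < a (\<tau> k)"
    using 3 4 5
  proof eventually_elim
    case (elim k)
    define n where "n = \<sigma> k"
    have n: "n > N0" "n > 0" "p0 \<le> (\<Sum>j\<in>A n. p n j)" "(\<Sum>j<J. p n j) * D < \<delta>" "real n * w \<ge> 2 * real J"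
        "a n > \<kappa> - \<delta>" "\<bar>real (\<tau> k) / real n - w\<bar> < \<eta>"
      using elim by (auto simp: n_def)
    have "\<bar>real (\<tau> k) - real n * w\<bar> = real n * \<bar>real (\<tau> k) / real n - w\<bar>"
      using n(2) by (simp add: abs_mult[symmetric, of "real n", simplified] right_diff_distrib)
    also have "\<dots> \<le> real n * \<eta>" using n(7) by (intro mult_left_mono) auto
    finally have \<tau>_close: "\<bar>real (\<tau> k) - real n * w\<bar> \<le> \<eta> * real n" by (simp add: mult.commute)
    have half: "\<eta> * real n \<le> w * real n / 2" using \<eta>(2) mult_right_mono[of \<eta> "w / 2" "real n"] by simp
    define y where "y = a (\<tau> k) + \<epsilon> / 2 - \<kappa> - \<delta>"
    have A_close: "a j - \<kappa> - \<delta> \<le> y" and A_J: "j \<ge> J" if "j \<in> A n" for j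
    proof -
      have j: "\<bar>real j - real n * w\<bar> \<le> \<eta> * real n" using that by (simp add: A_def)
      have "\<bar>a j - a (\<tau> k)\<bar> \<le> C * \<bar>real j - real (\<tau> k)\<bar> / (w * real n / 2)"
      proof (rule log_Lipschitz_min[OF step])
        show "w * real n / 2 \<le> real j" "w * real n / 2 \<le> real (\<tau> k)" "0 < w * real n / 2"
          using j \<tau>_close half w01 n(2) mult.commute[of w "real n"] unfolding abs_le_iff
          by (linarith, linarith, simp)
      qed
      also have "\<dots> \<le> C * (2 * (\<eta> * real n)) / (w * real n / 2)"
        using j \<tau>_close w01 \<open>C \<ge> 0\<close> by (intro divide_right_mono mult_left_mono) auto
      also have "\<dots> = 4 * C * \<eta> / w" using n(2) by simp
      finally show "a j - \<kappa> - \<delta> \<le> y" using C\<eta> unfolding y_def by linarith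
      have "real n * w / 2 \<le> real j" using j half by (simp add: algebra_simps abs_le_iff)
      then show "j \<ge> J" using n(5) by linarith
    qed
    \<comment> \<open>Three ranges of \<open>j\<close>: below \<open>J\<close> the crude bound
      \<open>D\<close> is used, in the window the bound \<open>y\<close>, and elsewhere the summand
      is at most 0 by the choice of \<open>J\<close>.\<close>
    have pt: "p n j * (a j - \<kappa> - \<delta>) \<le> (if j < J then p n j * D else 0) + (if j \<in> A n then p n j * y else 0)" for j
    proof -
      consider "j < J" "j \<notin> A n" | "j \<ge> J" "j \<in> A n" | "j \<ge> J" "j \<notin> A n" using A_J[of j] by force
      then show ?thesis
      proof cases
        case 1
        then show ?thesis using D p_nonneg by (simp add: mult_left_mono)
      next
        case 2
        then show ?thesis using A_close p_nonneg by (simp add: mult_left_mono)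
      next
        case 3
        then show ?thesis using J[of j] p_nonneg[of n j] by (simp add: mult_nonneg_nonpos)
      qed
    qed
    have "a n - \<kappa> - \<delta> = (\<Sum>j\<le>n. p n j * (a j - \<kappa> - \<delta>))"
      unfolding right_diff_distrib sum_subtractf sum_distrib_right[symmetric] sum_p harm[OF n(1)] by simp
    also have "\<dots> \<le> (\<Sum>j\<le>n. (if j < J then p n j * D else 0) + (if j \<in> A n then p n j * y else 0))"
      by (intro sum_mono pt)
    also have "\<dots> = (\<Sum>j\<in>{..n} \<inter> {j. j < J}. p n j * D) + (\<Sum>j\<in>{..n} \<inter> A n. p n j * y)"
      unfolding sum.distrib by (simp add: sum.inter_restrict[symmetric] sum.If_cases Collect_mem_eq)
    also have "{..n} \<inter> A n = A n" by (auto simp: A_def)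
    also have "(\<Sum>j\<in>{..n} \<inter> {j. j < J}. p n j * D) \<le> (\<Sum>j<J. p n j * D)"
      using \<open>D \<ge> 0\<close> p_nonneg by (intro sum_mono2) auto
    also have "\<dots> < \<delta>" using n(4) by (simp add: sum_distrib_right)
    finally have main: "a n - \<kappa> - \<delta> < \<delta> + (\<Sum>j\<in>A n. p n j) * y" by (simp add: sum_distrib_right)
    show "x < a (\<tau> k)"
    proof (rule ccontr)
      assume "\<not> x < a (\<tau> k)"
      then have "a (\<tau> k) \<le> \<kappa> - \<epsilon>" by (simp add: \<epsilon>_def)
      then have "y \<le> - (\<epsilon> / 2)" using \<open>\<delta> > 0\<close> unfolding y_def by linarith
      then have "(\<Sum>j\<in>A n. p n j) * y \<le> (\<Sum>j\<in>A n. p n j) * (- (\<epsilon> / 2))"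
        by (intro mult_left_mono sum_nonneg p_nonneg)
      also have "\<dots> \<le> p0 * (- (\<epsilon> / 2))" using n(3) \<open>\<epsilon> > 0\<close> by (intro mult_right_mono_neg) auto
      finally have "(\<Sum>j\<in>A n. p n j) * y \<le> - 4 * \<delta>" by (simp add: \<delta>_def mult.commute)
      then show False using main n(6) \<open>\<delta> > 0\<close> by linarith
    qed
  qed
qed


text \<open>Let \<open>T\<close> be the ratios along which \<open>a\<close> tends to its upper limit
  \<kappa>. It contains 1 and is closed under multiplication by points of the support; on the
  logarithmic scale these generate a non-lattice semigroup, so every small ratio is close to one in
  \<open>T\<close>, and the Lipschitz bound covers the gap.\<close>

lemma harmonic_scale_limit:
  fixes a :: "nat \<Rightarrow> real"
  assumes nonlat: "non_lattice (distr M borel (\<lambda>\<omega>. \<bar>ln (W \<omega>)\<bar>))"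
    and bound: "\<And>n. \<bar>a n\<bar> \<le> B"
    and step: "\<And>n. real (Suc n) * \<bar>a (Suc n) - a n\<bar> \<le> C"
    and harm: "\<And>n. n > N0 \<Longrightarrow> a n = (\<Sum>j\<le>n. p n j * a j)"
    and upper: "\<And>\<epsilon>. \<epsilon> > 0 \<Longrightarrow> eventually (\<lambda>n. a n < \<kappa> + \<epsilon>) sequentially"
    and \<sigma>: "filterlim \<sigma> at_top sequentially" and lim: "(\<lambda>k. a (\<sigma> k)) \<longlonglongrightarrow> \<kappa>"
  shows "scale_limit \<sigma> a \<kappa>"
proof -
  have "C \<ge> 0" by (rule log_Lipschitz_const_nonneg[OF step])
  define T where "T = {t. t > 0 \<and> (\<forall>\<tau>. has_ratio \<tau> \<sigma> t \<longrightarrow> ((\<lambda>k. a (\<tau> k)) \<longlonglongrightarrow> \<kappa>))}"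
  have TI: "t \<in> T" if "t > 0" "\<And>\<tau>. has_ratio \<tau> \<sigma> t \<Longrightarrow> (\<lambda>k. a (\<tau> k)) \<longlonglongrightarrow> \<kappa>" for t
    using that by (simp add: T_def)
  have TD: "t > 0" "(\<lambda>k. a (nat \<lfloor>t * real (\<sigma> k)\<rfloor>)) \<longlonglongrightarrow> \<kappa>" if "t \<in> T" for t
    using that floor_scaled[OF \<sigma>, of t] by (simp_all add: T_def)
  have \<sigma>_pos: "\<forall>\<^sub>F k in sequentially. \<sigma> k > 0"
    using eventually_compose_filterlim[OF eventually_gt_at_top[of 0] \<sigma>] .
  have "1 \<in> T"
  proof (rule TI)
    fix \<tau> assume \<tau>: "has_ratio \<tau> \<sigma> 1"
    have \<sigma>1: "has_ratio \<sigma> \<sigma> 1"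
      by (rule Lim_transform_eventually[OF tendsto_const])
         (use \<sigma>_pos in eventually_elim, simp)
    have "(\<lambda>k. a (\<tau> k) - a (\<sigma> k)) \<longlonglongrightarrow> 0"
    proof (rule tendstoI)
      fix \<epsilon> :: real assume "\<epsilon> > 0"
      from log_Lipschitz_scaled[OF step \<sigma> \<tau> \<sigma>1 _ _ this]
      show "\<forall>\<^sub>F k in sequentially. dist (a (\<tau> k) - a (\<sigma> k)) 0 < \<epsilon>" by simp
    qed
    from tendsto_add[OF this lim] show "(\<lambda>k. a (\<tau> k)) \<longlonglongrightarrow> \<kappa>" by simp
  qed auto
  have T_mult: "t * w \<in> T" if "t \<in> T" "w \<in> W_support" for t w
  proof (rule TI)
    have w: "0 < w" using that by (simp add: W_support_def)
    then show "t * w > 0" using TD(1) that by simp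
    fix \<tau> assume \<tau>: "has_ratio \<tau> \<sigma> (t * w)"
    define \<tau>0 where "\<tau>0 k = nat \<lfloor>t * real (\<sigma> k)\<rfloor>" for k
    have \<tau>0: "has_ratio \<tau>0 \<sigma> t"
      unfolding \<tau>0_def using TD(1)[OF that(1)] by (intro floor_scaled \<sigma>) auto
    have \<tau>0_top: "filterlim \<tau>0 at_top sequentially" using filterlim_scaled[OF \<sigma> \<tau>0 TD(1)[OF that(1)]] .
    have "(\<lambda>k. (real (\<tau> k) / real (\<sigma> k)) / (real (\<tau>0 k) / real (\<sigma> k))) \<longlonglongrightarrow> t * w / t"
      using TD(1)[OF that(1)] by (intro tendsto_divide \<tau> \<tau>0) auto
    then have "(\<lambda>k. (real (\<tau> k) / real (\<sigma> k)) / (real (\<tau>0 k) / real (\<sigma> k))) \<longlonglongrightarrow> w"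
      using TD(1)[OF that(1)] by simp
    then have "has_ratio \<tau> \<tau>0 w"
      by (rule Lim_transform_eventually) (use \<sigma>_pos in eventually_elim, simp)
    with harmonic_limit_scaling[OF bound step harm upper \<tau>0_top _ that(2)] TD(2)[OF that(1)]
    show "(\<lambda>k. a (\<tau> k)) \<longlonglongrightarrow> \<kappa>" unfolding \<tau>0_def by blast
  qed
  \<comment> \<open>All multipliers preserving \<open>T\<close> are taken, not only those generated
    by the support: closure under addition is then immediate, and \<open>- ln w\<close> belongs to
    \<open>S\<close> by \<open>T_mult\<close>.\<close>
  define S where "S = {s. s > 0 \<and> (\<forall>t\<in>T. t * exp (- s) \<in> T)}"
  have S_add: "x + y \<in> S" if "x \<in> S" "y \<in> S" for x y
  proof -
    have eq: "t * exp (- x) * exp (- y) = t * exp (- (x + y))" for t :: real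
      unfolding minus_add_distrib exp_add by (simp only: mult.assoc)
    have "t * exp (- x) * exp (- y) \<in> T" if "t \<in> T" for t
      using \<open>x \<in> S\<close> \<open>y \<in> S\<close> that unfolding S_def by blast
    then have "\<forall>t\<in>T. t * exp (- (x + y)) \<in> T" unfolding eq by blast
    then show ?thesis using that by (simp add: S_def)
  qed
  have S_supp: "- ln w \<in> S" if "w \<in> W_support" for w
    using T_mult that by (auto simp: S_def W_support_def ln_less_zero)
  have AE_S: "AE \<omega> in M. \<bar>ln (W \<omega>)\<bar> \<in> S"
    using AE_W_support W_range
  proof eventually_elim
    case (elim \<omega>)
    then have "\<bar>ln (W \<omega>)\<bar> = - ln (W \<omega>)" by (simp add: abs_if ln_less_zero)
    then show ?case using S_supp elim by simp
  qed
  have S_nonlat: "\<not> S \<subseteq> range (\<lambda>k::int. d * of_int k)" if "d > 0" for d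
  proof
    assume sub: "S \<subseteq> range (\<lambda>k::int. d * of_int k)"
    have "AE \<omega> in M. \<bar>ln (W \<omega>)\<bar> \<in> range (\<lambda>k::int. d * of_int k)"
      using AE_S by (rule eventually_mono) (use sub in blast)
    moreover have "range (\<lambda>k::int. d * of_int k) \<in> sets borel"
    proof (rule sets.countable)
      show "countable (range (\<lambda>k::int. d * of_int k))" by simp
    qed simp
    ultimately have "AE x in distr M borel (\<lambda>\<omega>. \<bar>ln (W \<omega>)\<bar>). x \<in> range (\<lambda>k::int. d * of_int k)"
      by (subst AE_distr_iff) auto
    then show False using nonlat[unfolded non_lattice_def, rule_format, OF that] by (rule notE[rotated])
  qed
  have S_ne: "S \<noteq> {}"
  proof
    assume "S = {}"
    then have "AE \<omega> in M. False" using AE_S by simp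
    then show False by simp
  qed
  show ?thesis
    unfolding scale_limit_def
  proof (intro allI impI)
    fix \<epsilon> :: real assume "\<epsilon> > 0"
    \<comment> \<open>Ensures \<open>2 * C * (exp \<xi> - 1) < \<epsilon> / 3\<close>, the cost of
      replacing \<open>t\<close> by a ratio that differs by a factor of at most
      \<open>exp \<xi>\<close>.\<close>
    define \<xi> where "\<xi> = ln (1 + \<epsilon> / (6 * C + 6))"
    have \<xi>: "\<xi> > 0" "exp \<xi> = 1 + \<epsilon> / (6 * C + 6)"
      using \<open>C \<ge> 0\<close> \<open>\<epsilon> > 0\<close> unfolding \<xi>_def by (auto intro!: ln_gt_zero simp: add_pos_pos)
    obtain s0 where s0: "\<And>s. s \<ge> s0 \<Longrightarrow> \<exists>x\<in>S. \<bar>s - x\<bar> < \<xi>"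
      using semigroup_nonlattice_dense[OF S_add S_nonlat _ S_ne \<xi>(1)] by (auto simp: S_def)
    show "\<exists>t0>0. \<forall>t. 0 < t \<and> t \<le> t0 \<longrightarrow> (\<forall>\<tau>. has_ratio \<tau> \<sigma> t \<longrightarrow>
      (\<forall>\<^sub>F k in sequentially. \<bar>a (\<tau> k) - \<kappa>\<bar> < \<epsilon>))"
    \<comment> \<open>\<open>S\<close> meets every short interval only beyond \<open>s0\<close>, so
      only ratios up to \<open>exp (- s0)\<close> can be approximated. For this reason
      \<open>scale_limit\<close> speaks about small \<open>t\<close>.\<close>
    proof (intro exI[of _ "exp (- s0)"] conjI allI impI)
      fix t \<tau> assume t: "0 < t \<and> t \<le> exp (- s0)" and \<tau>: "has_ratio \<tau> \<sigma> t"
      have "ln t \<le> - s0" using t by (metis ln_exp ln_le_cancel_iff exp_gt_zero)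
      then obtain x where x: "x \<in> S" "\<bar>- ln t - x\<bar> < \<xi>" using s0[of "- ln t"] by auto
      define t' where "t' = exp (- x)"
      have "t' \<in> T" using x(1) \<open>1 \<in> T\<close> unfolding S_def t'_def by force
      define \<tau>' where "\<tau>' k = nat \<lfloor>t' * real (\<sigma> k)\<rfloor>" for k
      have "t' > 0" by (simp add: t'_def)
      have \<tau>': "has_ratio \<tau>' \<sigma> t'"
        unfolding \<tau>'_def using \<open>t' > 0\<close> by (intro floor_scaled \<sigma>) auto
      have ratio: "\<bar>t - t'\<bar> / min t t' \<le> exp \<xi> - 1"
      proof (cases "t \<le> t'")
        case True
        have "t' / t = exp (- x - ln t)" using t by (simp add: t'_def exp_diff)
        also have "\<dots> \<le> exp \<xi>" using x by auto
        finally show ?thesis using True t by (simp add: diff_divide_distrib)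
      next
        case False
        have "t / t' = exp (ln t + x)" using t by (simp add: t'_def exp_add exp_minus field_simps)
        also have "\<dots> \<le> exp \<xi>" using x by auto
        finally show ?thesis using False \<open>t' > 0\<close> by (simp add: diff_divide_distrib)
      qed
      have "2 * C * \<bar>t - t'\<bar> / min t t' \<le> 2 * C * (exp \<xi> - 1)"
        using mult_left_mono[OF ratio, of "2 * C"] \<open>C \<ge> 0\<close> by simp
      also have "\<dots> < \<epsilon> / 3" using \<open>C \<ge> 0\<close> \<open>\<epsilon> > 0\<close> by (simp add: \<xi>(2) field_simps)
      finally have small: "2 * C * \<bar>t - t'\<bar> / min t t' < \<epsilon> / 3" .
      have 1: "\<forall>\<^sub>F k in sequentially. \<bar>a (\<tau> k) - a (\<tau>' k)\<bar> < 2 * C * \<bar>t - t'\<bar> / min t t' + \<epsilon> / 3"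
        using t \<open>t' > 0\<close> \<open>\<epsilon> > 0\<close> by (intro log_Lipschitz_scaled[OF step \<sigma> \<tau> \<tau>']) auto
      have "\<epsilon> / 3 > 0" using \<open>\<epsilon> > 0\<close> by simp
      from tendstoD[OF TD(2)[OF \<open>t' \<in> T\<close>] this]
      have 2: "\<forall>\<^sub>F k in sequentially. \<bar>a (\<tau>' k) - \<kappa>\<bar> < \<epsilon> / 3"
        by (simp add: dist_real_def \<tau>'_def)
      show "\<forall>\<^sub>F k in sequentially. \<bar>a (\<tau> k) - \<kappa>\<bar> < \<epsilon>"
        using 1 2 by eventually_elim (use small in linarith)
    qed auto
  qed
qed

text \<open>By \<open>U_Suc_diff\<close> the logarithmic derivative of \<open>U\<close> in
  \<open>n\<close> is again a combination of two values of \<open>U\<close>, each Lipschitz in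
  \<open>log n\<close>.\<close>

lemma U_log_derivative_Lipschitz:
  assumes "m \<ge> 1"
  shows "\<exists>C. \<forall>n. real (Suc n) * \<bar>(real m * U (Suc n) m - real (Suc m) * U (Suc n) (Suc m))
      - (real m * U n m - real (Suc m) * U n (Suc m))\<bar> \<le> C"
proof -
  define L where "L m = real m / c m + real (Suc m) / c (Suc m)" for m
  have L: "real (Suc n) * \<bar>U (Suc n) m - U n m\<bar> \<le> L m" if "m \<ge> 1" for n m
    using U_Lipschitz[OF that] by (simp only: L_def)
  have "real (Suc n) * \<bar>(real m * U (Suc n) m - real (Suc m) * U (Suc n) (Suc m))
      - (real m * U n m - real (Suc m) * U n (Suc m))\<bar> \<le> real m * L m + real (Suc m) * L (Suc m)" for n
  proof -
    define x where "x = U (Suc n) m - U n m"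
    define y where "y = U (Suc n) (Suc m) - U n (Suc m)"
    have "\<bar>(real m * U (Suc n) m - real (Suc m) * U (Suc n) (Suc m)) - (real m * U n m - real (Suc m) * U n (Suc m))\<bar>
        = \<bar>real m * x - real (Suc m) * y\<bar>" unfolding x_def y_def by (simp only: right_diff_distrib)
    also have "\<dots> \<le> real m * \<bar>x\<bar> + real (Suc m) * \<bar>y\<bar>"
      by (rule order_trans[OF abs_triangle_ineq4]) (simp add: abs_mult)
    finally have "real (Suc n) * \<bar>(real m * U (Suc n) m - real (Suc m) * U (Suc n) (Suc m)) - (real m * U n m - real (Suc m) * U n (Suc m))\<bar>
        \<le> real (Suc n) * (real m * \<bar>x\<bar> + real (Suc m) * \<bar>y\<bar>)" by (intro mult_left_mono) auto
    also have "\<dots> = real m * (real (Suc n) * \<bar>x\<bar>) + real (Suc m) * (real (Suc n) * \<bar>y\<bar>)"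
      by (simp only: distrib_left mult.left_commute)
    also have "\<dots> \<le> real m * L m + real (Suc m) * L (Suc m)"
      unfolding x_def y_def using assms by (intro add_mono mult_left_mono L) auto
    finally show ?thesis .
  qed
  then show ?thesis by blast
qed

text \<open>Once \<open>m * U n m\<close> has a scale limit, so has \<open>U n m\<close>; its
  logarithmic derivative \<open>m * U n m - (m + 1) * U n (m + 1)\<close> then has scale limit 0,
  which passes the limit on to \<open>m + 1\<close>.\<close>

lemma scale_limit_U:
  assumes lim: "scale_limit \<sigma> (\<lambda>n. U n 1) \<kappa>" and \<sigma>: "filterlim \<sigma> at_top sequentially" and "m \<ge> 1"
  shows "scale_limit \<sigma> (\<lambda>n. real m * U n m) \<kappa>"
  using \<open>m \<ge> 1\<close>
proof (induction m rule: dec_induct)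
  case base
  then show ?case using lim by simp
next
  case (step m)
  define d where "d n = real m * U n m - real (Suc m) * U n (Suc m)" for n
  have U_lim: "scale_limit \<sigma> (\<lambda>n. U n m) (1 / real m * \<kappa>)"
    using scale_limit_cmult[OF step.IH, of "1 / real m"] step.hyps by simp
  obtain C where "\<And>n. real (Suc n) * \<bar>d (Suc n) - d n\<bar> \<le> C"
    using U_log_derivative_Lipschitz[of m] step.hyps unfolding d_def by blast
  then have "scale_limit \<sigma> d 0"
    using U_Suc_diff[of m] step.hyps
    by (intro scale_limit_log_derivative[OF U_lim \<sigma>]) (auto simp: d_def simp del: of_nat_Suc)
  from scale_limit_diff[OF step.IH this] show ?case by (simp add: d_def)
qed

text \<open>The threshold for \<open>t\<close> depends on \<open>m\<close>, so only finitely many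
  \<open>m\<close> can share one \<open>t\<close>; fixing it and going far along \<sigma> gives the
  required \<open>n\<close>.\<close>

lemma scale_limit_U_simultaneous:
  assumes lim: "scale_limit \<sigma> (\<lambda>n. U n 1) \<kappa>" and \<sigma>: "filterlim \<sigma> at_top sequentially" and "\<epsilon> > 0"
  shows "\<exists>n\<ge>A. \<forall>m\<in>{1..N}. \<bar>real m * U n m - \<kappa>\<bar> < \<epsilon>"
proof -
  have "\<forall>m\<in>{1..N}. \<exists>t0>0. \<forall>t \<tau>. 0 < t \<longrightarrow> t \<le> t0 \<longrightarrow> has_ratio \<tau> \<sigma> t \<longrightarrow>
      (\<forall>\<^sub>F k in sequentially. \<bar>real m * U (\<tau> k) m - \<kappa>\<bar> < \<epsilon>)"
  proof
    fix m assume "m \<in> {1..N}"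
    then have "scale_limit \<sigma> (\<lambda>n. real m * U n m) \<kappa>" using scale_limit_U[OF lim \<sigma>] by simp
    from scale_limitE[OF this \<open>\<epsilon> > 0\<close>] obtain t0 where "t0 > 0"
        "\<And>t \<tau>. 0 < t \<Longrightarrow> t \<le> t0 \<Longrightarrow> has_ratio \<tau> \<sigma> t \<Longrightarrow>
          \<forall>\<^sub>F k in sequentially. \<bar>real m * U (\<tau> k) m - \<kappa>\<bar> < \<epsilon>" by blast
    then show "\<exists>t0>0. \<forall>t \<tau>. 0 < t \<longrightarrow> t \<le> t0 \<longrightarrow> has_ratio \<tau> \<sigma> t \<longrightarrow>
      (\<forall>\<^sub>F k in sequentially. \<bar>real m * U (\<tau> k) m - \<kappa>\<bar> < \<epsilon>)"
      by (intro exI[of _ t0]) simp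
  qed
  then obtain t0 where t0: "\<And>m. m \<in> {1..N} \<Longrightarrow> t0 m > 0"
      "\<And>m t \<tau>. m \<in> {1..N} \<Longrightarrow> 0 < t \<Longrightarrow> t \<le> t0 m \<Longrightarrow> has_ratio \<tau> \<sigma> t \<Longrightarrow>
      \<forall>\<^sub>F k in sequentially. \<bar>real m * U (\<tau> k) m - \<kappa>\<bar> < \<epsilon>"
    by (drule_tac bchoice) blast
  define t where "t = Min (insert 1 (t0 ` {1..N}))"
  have "t > 0" unfolding t_def using t0 by (subst Min_gr_iff) auto
  have t_le: "t \<le> t0 m" if "m \<in> {1..N}" for m unfolding t_def using that by (intro Min_le) auto
  define \<tau> where "\<tau> k = nat \<lfloor>t * real (\<sigma> k)\<rfloor>" for k
  have \<tau>: "has_ratio \<tau> \<sigma> t"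
    unfolding \<tau>_def using \<open>t > 0\<close> by (intro floor_scaled \<sigma>) auto
  have "\<forall>\<^sub>F k in sequentially. \<forall>m\<in>{1..N}. \<bar>real m * U (\<tau> k) m - \<kappa>\<bar> < \<epsilon>"
    using t0(2)[OF _ \<open>t > 0\<close> t_le \<tau>] by (intro eventually_ball_finite) auto
  moreover have "\<forall>\<^sub>F k in sequentially. \<tau> k \<ge> A"
    using eventually_compose_filterlim[OF eventually_ge_at_top filterlim_scaled[OF \<sigma> \<tau> \<open>t > 0\<close>]] .
  ultimately have "\<forall>\<^sub>F k in sequentially. \<tau> k \<ge> A \<and> (\<forall>m\<in>{1..N}. \<bar>real m * U (\<tau> k) m - \<kappa>\<bar> < \<epsilon>)"
    by eventually_elim auto
  then obtain k where "\<tau> k \<ge> A" "\<forall>m\<in>{1..N}. \<bar>real m * U (\<tau> k) m - \<kappa>\<bar> < \<epsilon>"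
    using eventually_happens by fastforce
  then show ?thesis by blast
qed

text \<open>The first \<open>N\<close> terms of the identity in \<open>sum_U_c\<close> cannot exceed
  1. As the series of \<open>c m / m\<close> need not converge here, the bound also serves the case
  of infinite \<mu>.\<close>

lemma scale_limit_U_upper:
  assumes lim: "scale_limit \<sigma> (\<lambda>n. U n 1) \<kappa>" and \<sigma>: "filterlim \<sigma> at_top sequentially"
  shows "\<kappa> * (\<Sum>m\<in>{1..N}. c m / real m) \<le> 1"
proof -
  define h where "h = (\<Sum>m\<in>{1..N}. c m / real m)"
  have "h \<ge> 0" unfolding h_def using c_pos by (intro sum_nonneg) (auto simp: less_imp_le)
  have *: "(\<kappa> - \<epsilon>) * h \<le> 1" if eps: "\<epsilon> > 0" for \<epsilon>
  proof -
    obtain n where n: "n \<ge> max 1 N" "\<And>m. m \<in> {1..N} \<Longrightarrow> \<bar>real m * U n m - \<kappa>\<bar> < \<epsilon>"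
      using scale_limit_U_simultaneous[OF lim \<sigma> eps] by metis
    have "(\<kappa> - \<epsilon>) * h = (\<Sum>m\<in>{1..N}. (\<kappa> - \<epsilon>) / real m * c m)"
      unfolding h_def sum_distrib_left by simp
    also have "\<dots> \<le> (\<Sum>m\<in>{1..N}. U n m * c m)"
    proof (intro sum_mono mult_right_mono)
      fix m assume m: "m \<in> {1..N}"
      then have "\<kappa> - \<epsilon> \<le> real m * U n m" using n(2)[OF m] by linarith
      then show "(\<kappa> - \<epsilon>) / real m \<le> U n m" using m by (simp add: field_simps)
    qed (use c_pos in \<open>auto simp: less_imp_le\<close>)
    also have "\<dots> \<le> (\<Sum>m\<in>{1..n}. U n m * c m)"
      using n(1) U_nonneg c_pos by (intro sum_mono2) (auto simp: less_imp_le)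
    also have "\<dots> = 1" using n(1) by (intro sum_U_c) auto
    finally show ?thesis .
  qed
  have "\<kappa> * h \<le> 1 + e" if "e > 0" for e
  proof -
    have "(\<kappa> - e / (h + 1)) * h \<le> 1" using that \<open>h \<ge> 0\<close> by (intro *) auto
    moreover have "e / (h + 1) * h \<le> e" using that \<open>h \<ge> 0\<close> by (simp add: field_simps)
    ultimately show ?thesis by (simp add: algebra_simps)
  qed
  then show ?thesis unfolding h_def by (rule field_le_epsilon)
qed

text \<open>With summability \<open>U_tail\<close> shows that no part of the unit mass in
  \<open>sum_U_c\<close> is lost at large \<open>m\<close>, so the inequality of
  \<open>scale_limit_U_upper\<close> becomes an equality.\<close>

lemma scale_limit_U_eq:
  assumes lim: "scale_limit \<sigma> (\<lambda>n. U n 1) \<kappa>" and \<sigma>: "filterlim \<sigma> at_top sequentially"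
    and sm: "summable (\<lambda>m. c m / real m)"
  shows "\<kappa> * (\<Sum>m. c m / real m) = 1"
proof -
  define h where "h N = (\<Sum>m\<in>{1..N}. c m / real m)" for N
  have "(\<lambda>N. \<Sum>m\<le>N. c m / real m) \<longlonglongrightarrow> (\<Sum>m. c m / real m)" using summable_LIMSEQ'[OF sm] .
  moreover have "(\<Sum>m\<le>N. c m / real m) = h N" for N
    unfolding h_def by (intro sum.mono_neutral_right) auto
  ultimately have h: "h \<longlonglongrightarrow> (\<Sum>m. c m / real m)" by simp
  have "\<kappa> * (\<Sum>m. c m / real m) \<le> 1"
    by (rule tendsto_upperbound[OF tendsto_mult[OF tendsto_const h]])
       (use scale_limit_U_upper[OF lim \<sigma>] in \<open>auto simp: h_def\<close>)
  moreover have "1 \<le> \<kappa> * (\<Sum>m. c m / real m) + \<epsilon> * (\<Sum>m. c m / real m) + \<epsilon>" if eps: "\<epsilon> > 0" for \<epsilon>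
  proof -
    obtain A0 where A0: "A0 \<ge> 1" "\<And>A n. A \<ge> A0 \<Longrightarrow> (\<Sum>m\<in>{A..n}. U n m * c m) < \<epsilon>"
      using U_tail[OF c_antimono _ sm eps] less_imp_le[OF c_pos] by metis
    have "1 \<le> \<kappa> * h N + \<epsilon> * h N + \<epsilon>" if "N \<ge> A0" for N
    proof -
      obtain n where n: "n \<ge> max 1 N" "\<And>m. m \<in> {1..N} \<Longrightarrow> \<bar>real m * U n m - \<kappa>\<bar> < \<epsilon>"
        using scale_limit_U_simultaneous[OF lim \<sigma> \<open>\<epsilon> > 0\<close>] by metis
      have "{1..n} = {1..N} \<union> {Suc N..n}" using n(1) by auto
      then have "1 = (\<Sum>m\<in>{1..N}. U n m * c m) + (\<Sum>m\<in>{Suc N..n}. U n m * c m)"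
        using sum_U_c[of n] n(1) by (simp add: sum.union_disjoint)
      also have "(\<Sum>m\<in>{1..N}. U n m * c m) \<le> (\<Sum>m\<in>{1..N}. (\<kappa> + \<epsilon>) / real m * c m)"
      proof (intro sum_mono mult_right_mono)
        fix m assume m: "m \<in> {1..N}"
        then have "real m * U n m \<le> \<kappa> + \<epsilon>" using n(2)[OF m] by linarith
        then show "U n m \<le> (\<kappa> + \<epsilon>) / real m" using m by (simp add: field_simps)
      qed (use c_pos in \<open>auto simp: less_imp_le\<close>)
      also have "\<dots> = (\<kappa> + \<epsilon>) * h N" unfolding h_def sum_distrib_left by simp
      also have "(\<Sum>m\<in>{Suc N..n}. U n m * c m) \<le> \<epsilon>" using A0(2)[of "Suc N" n] \<open>N \<ge> A0\<close> by simp
      finally show ?thesis by (simp add: algebra_simps)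
    qed
    then have "\<forall>\<^sub>F N in sequentially. 1 \<le> \<kappa> * h N + \<epsilon> * h N + \<epsilon>"
      using eventually_sequentially by blast
    moreover have "(\<lambda>N. \<kappa> * h N + \<epsilon> * h N + \<epsilon>) \<longlonglongrightarrow> \<kappa> * (\<Sum>m. c m / real m) + \<epsilon> * (\<Sum>m. c m / real m) + \<epsilon>"
      by (intro tendsto_intros h)
    ultimately show ?thesis by (intro tendsto_lowerbound) auto
  qed
  then have "1 \<le> \<kappa> * (\<Sum>m. c m / real m) + e" if "e > 0" for e
  proof -
    define H where "H = (\<Sum>m. c m / real m)"
    have "H \<ge> 0" unfolding H_def using sm c_pos by (intro suminf_nonneg) (auto simp: less_imp_le)
    have "e / (H + 1) > 0" using that \<open>H \<ge> 0\<close> by simp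
    from \<open>\<And>\<epsilon>. \<epsilon> > 0 \<Longrightarrow> 1 \<le> \<kappa> * (\<Sum>m. c m / real m) + \<epsilon> * (\<Sum>m. c m / real m) + \<epsilon>\<close>[OF this]
    have "1 \<le> \<kappa> * H + e / (H + 1) * (H + 1)"
      unfolding H_def[symmetric] distrib_left mult_1_right add.assoc .
    then show ?thesis using \<open>H \<ge> 0\<close> by (simp add: H_def)
  qed
  then have "1 \<le> \<kappa> * (\<Sum>m. c m / real m)" by (rule field_le_epsilon)
  ultimately show ?thesis by simp
qed

text \<open>The sign handles upper and lower limit by one argument: with \<open>s = - 1\<close>, the
  upper limit of \<open>s * U n 1\<close> is minus the lower limit of \<open>U n 1\<close>.\<close>

lemma signed_limsup_scale_limit:
  assumes nonlat: "non_lattice (distr M borel (\<lambda>\<omega>. \<bar>ln (W \<omega>)\<bar>))" and s: "s = 1 \<or> s = - 1"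
  obtains \<kappa> \<sigma> where "filterlim \<sigma> at_top sequentially" "scale_limit \<sigma> (\<lambda>n. U n 1) \<kappa>"
    "\<And>\<epsilon>. \<epsilon> > 0 \<Longrightarrow> eventually (\<lambda>n. s * U n 1 < s * \<kappa> + \<epsilon>) sequentially"
proof -
  have "\<bar>s * U n 1\<bar> \<le> 1 / c 1" for n
    using U_le[of 1 n] U_nonneg[of 1 n] s by auto
  then obtain \<kappa>' \<sigma> where \<sigma>: "strict_mono \<sigma>" "((\<lambda>n. s * U n 1) \<circ> \<sigma>) \<longlonglongrightarrow> \<kappa>'"
      and upper: "\<And>\<epsilon>. \<epsilon> > 0 \<Longrightarrow> eventually (\<lambda>n. s * U n 1 < \<kappa>' + \<epsilon>) sequentially"
    using bounded_seq_limsup[of "\<lambda>n. s * U n 1"] by metis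
  have \<sigma>_top: "filterlim \<sigma> at_top sequentially" using \<sigma>(1) by (rule filterlim_subseq)
  have "scale_limit \<sigma> (\<lambda>n. s * U n 1) \<kappa>'"
  proof (rule harmonic_scale_limit[OF nonlat _ _ _ upper \<sigma>_top])
    show "\<bar>s * U n 1\<bar> \<le> 1 / c 1" for n by fact
    show "real (Suc n) * \<bar>s * U (Suc n) 1 - s * U n 1\<bar> \<le> real 1 / c 1 + real (Suc 1) / c (Suc 1)" for n
      using U_Lipschitz[of 1 n] s by (auto simp: abs_minus_commute)
    show "s * U n 1 = (\<Sum>j\<le>n. p n j * (s * U j 1))" if "n > 1" for n
    proof -
      have "U n 1 = (\<Sum>j\<in>{1..n}. p n j * U j 1)" using U_rec[of 1 n] that by simp
      also have "\<dots> = (\<Sum>j\<le>n. p n j * U j 1)"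
        by (intro sum.mono_neutral_left) (auto simp: U_eq_0)
      finally show ?thesis by (simp add: sum_distrib_left mult.left_commute)
    qed
    show "(\<lambda>k. s * U (\<sigma> k) 1) \<longlonglongrightarrow> \<kappa>'" using \<sigma>(2) by (simp add: comp_def)
  qed
  moreover have "s * (s * x) = x" for x :: real using s by auto
  ultimately have "scale_limit \<sigma> (\<lambda>n. U n 1) (s * \<kappa>')"
    using scale_limit_cmult[of \<sigma> "\<lambda>n. s * U n 1" \<kappa>' s] by (simp only:)
  moreover have "s * (s * \<kappa>') = \<kappa>'" by fact
  ultimately show ?thesis using that[of \<sigma> "s * \<kappa>'"] \<sigma>_top upper by (simp only:)
qed

text \<open>With summability both extremal limits satisfy the same equation and hence agree. Without
  it, a positive upper limit would bound the partial sums of \<open>c m / m\<close> by its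
  reciprocal.\<close>

lemma U_1_limit:
  assumes nonlat: "non_lattice (distr M borel (\<lambda>\<omega>. \<bar>ln (W \<omega>)\<bar>))"
  obtains \<rho> where "(\<lambda>n. U n 1) \<longlonglongrightarrow> \<rho>"
    "summable (\<lambda>m. c m / real m) \<Longrightarrow> \<rho> * (\<Sum>m. c m / real m) = 1"
    "\<not> summable (\<lambda>m. c m / real m) \<Longrightarrow> \<rho> = 0"
proof -
  obtain \<kappa> \<sigma> where 1: "filterlim \<sigma> at_top sequentially" "scale_limit \<sigma> (\<lambda>n. U n 1) \<kappa>"
    "\<And>\<epsilon>. \<epsilon> > 0 \<Longrightarrow> eventually (\<lambda>n. 1 * U n 1 < 1 * \<kappa> + \<epsilon>) sequentially"
    using signed_limsup_scale_limit[OF nonlat, of 1] by blast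
  show ?thesis
  proof (cases "summable (\<lambda>m. c m / real m)")
    case True
    obtain \<kappa>' \<sigma>' where 2: "filterlim \<sigma>' at_top sequentially" "scale_limit \<sigma>' (\<lambda>n. U n 1) \<kappa>'"
      "\<And>\<epsilon>. \<epsilon> > 0 \<Longrightarrow> eventually (\<lambda>n. - 1 * U n 1 < - 1 * \<kappa>' + \<epsilon>) sequentially"
      using signed_limsup_scale_limit[OF nonlat, of "- 1"] by blast
    have eq: "\<kappa> * (\<Sum>m. c m / real m) = 1" "\<kappa>' * (\<Sum>m. c m / real m) = 1"
      using scale_limit_U_eq[OF 1(2,1) True] scale_limit_U_eq[OF 2(2,1) True] .
    then have "\<kappa>' = \<kappa>" by (metis mult_cancel_right zero_neq_one mult_zero_right)
    have "(\<lambda>n. U n 1) \<longlonglongrightarrow> \<kappa>"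
    proof (rule tendstoI)
      fix \<epsilon> :: real assume "\<epsilon> > 0"
      show "\<forall>\<^sub>F n in sequentially. dist (U n 1) \<kappa> < \<epsilon>"
        using 1(3)[OF \<open>\<epsilon> > 0\<close>] 2(3)[OF \<open>\<epsilon> > 0\<close>] unfolding \<open>\<kappa>' = \<kappa>\<close>
        by eventually_elim (simp add: dist_real_def)
    qed
    then show ?thesis using that[of \<kappa>] eq True by simp
  next
    case False
    have "\<kappa> \<le> 0"
    proof (rule ccontr)
      assume "\<not> \<kappa> \<le> 0"
      have "summable (\<lambda>m. c m / real m)"
      proof (rule bounded_imp_summable)
        show "c m / real m \<ge> 0" for m using c_pos[of m] by simp
        show "(\<Sum>m\<le>N. c m / real m) \<le> 1 / \<kappa>" for N
        proof -
          have "(\<Sum>m\<le>N. c m / real m) = (\<Sum>m\<in>{1..N}. c m / real m)"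
            by (intro sum.mono_neutral_right) auto
          then show ?thesis using scale_limit_U_upper[OF 1(2,1), of N] \<open>\<not> \<kappa> \<le> 0\<close> by (simp add: field_simps)
        qed
      qed
      then show False using False by simp
    qed
    have "(\<lambda>n. U n 1) \<longlonglongrightarrow> 0"
    proof (rule tendstoI)
      fix \<epsilon> :: real assume "\<epsilon> > 0"
      show "\<forall>\<^sub>F n in sequentially. dist (U n 1) 0 < \<epsilon>"
        using 1(3)[OF \<open>\<epsilon> > 0\<close>]
        by eventually_elim (use \<open>\<kappa> \<le> 0\<close> U_nonneg[of 1] in \<open>simp add: dist_real_def\<close>)
    qed
    then show ?thesis using that[of 0] False by simp
  qed
qed

text \<open>The induction of \<open>scale_limit_U\<close> again, now for true limits: convergence of
  \<open>U n m\<close> makes its change over any window of relative length \<theta> tend to 0, so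
  its logarithmic derivative vanishes in the limit.\<close>

lemma U_limit:
  assumes lim: "(\<lambda>n. U n 1) \<longlonglongrightarrow> \<rho>" and "m \<ge> 1"
  shows "(\<lambda>n. real m * U n m) \<longlonglongrightarrow> \<rho>"
  using \<open>m \<ge> 1\<close>
proof (induction m rule: dec_induct)
  case base
  then show ?case using lim by simp
next
  case (step m)
  define d where "d n = real m * U n m - real (Suc m) * U n (Suc m)" for n
  define a where "a n = U n m" for n
  have "(\<lambda>n. 1 / real m * (real m * U n m)) \<longlonglongrightarrow> 1 / real m * \<rho>" by (intro tendsto_intros step.IH)
  then have a_lim: "a \<longlonglongrightarrow> \<rho> / real m" using step.hyps by (simp add: a_def[abs_def])
  have der: "real (Suc n) * (a (Suc n) - a n) = d (Suc n)" for n
    using U_Suc_diff[of m n] step.hyps by (simp add: a_def d_def)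
  obtain C where lip: "\<And>n. real (Suc n) * \<bar>d (Suc n) - d n\<bar> \<le> C"
    using U_log_derivative_Lipschitz[of m] step.hyps unfolding d_def by blast
  have "C \<ge> 0" by (rule log_Lipschitz_const_nonneg[OF lip])
  have "d \<longlonglongrightarrow> 0"
  proof (rule tendstoI)
    fix \<epsilon> :: real assume "\<epsilon> > 0"
    define \<theta> where "\<theta> = min (1 / 2) (\<epsilon> / (4 * C + 4))"
    have \<theta>: "0 < \<theta>" "\<theta> \<le> 1 / 2"
      using \<open>\<epsilon> > 0\<close> \<open>C \<ge> 0\<close> unfolding \<theta>_def by (simp, intro min.cobounded1)
    have C\<theta>: "2 * C * \<theta> < \<epsilon> / 2"
    proof -
      have "2 * C * \<theta> \<le> 2 * C * (\<epsilon> / (4 * C + 4))" using \<open>C \<ge> 0\<close> by (intro mult_left_mono) (auto simp: \<theta>_def)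
      also have "\<dots> < \<epsilon> / 2" using \<open>\<epsilon> > 0\<close> \<open>C \<ge> 0\<close> by (simp add: field_simps)
      finally show ?thesis .
    qed
    have half: "n - nat \<lfloor>\<theta> * real n\<rfloor> \<ge> n div 2" for n
    proof -
      have "\<theta> * real n \<le> 1 / 2 * real n" using \<theta> by (intro mult_right_mono) auto
      then have "real (nat \<lfloor>\<theta> * real n\<rfloor>) \<le> real n / 2" using \<theta> by linarith
      then have "2 * nat \<lfloor>\<theta> * real n\<rfloor> \<le> n" by linarith
      then show ?thesis by linarith
    qed
    have "filterlim (\<lambda>n::nat. n div 2) at_top sequentially"
      unfolding filterlim_at_top eventually_sequentially
    proof (intro allI exI impI)
      fix Z n :: nat assume "2 * Z \<le> n"
      then show "Z \<le> n div 2" by linarith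
    qed
    then have "filterlim (\<lambda>n. n - nat \<lfloor>\<theta> * real n\<rfloor>) at_top sequentially"
      by (rule filterlim_at_top_mono) (use half in auto)
    then have "(\<lambda>n. 2 * C * \<theta> + 2 / \<theta> * \<bar>a n - a (n - nat \<lfloor>\<theta> * real n\<rfloor>)\<bar>) \<longlonglongrightarrow> 2 * C * \<theta> + 2 / \<theta> * \<bar>\<rho> / real m - \<rho> / real m\<bar>"
      by (intro tendsto_intros a_lim filterlim_compose[OF a_lim])
    then have "\<forall>\<^sub>F n in sequentially. 2 * C * \<theta> + 2 / \<theta> * \<bar>a n - a (n - nat \<lfloor>\<theta> * real n\<rfloor>)\<bar> < \<epsilon>"
      by (rule order_tendstoD) (use C\<theta> \<open>\<epsilon> > 0\<close> in simp)
    moreover have "\<forall>\<^sub>F n in sequentially. real n \<ge> 1 / \<theta>"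
      using eventually_compose_filterlim[OF eventually_ge_at_top filterlim_real_sequentially] .
    ultimately show "\<forall>\<^sub>F n in sequentially. dist (d n) 0 < \<epsilon>"
    proof eventually_elim
      case (elim n)
      have "\<bar>d n\<bar> \<le> 2 * C * \<theta> + 2 / \<theta> * \<bar>a n - a (n - nat \<lfloor>\<theta> * real n\<rfloor>)\<bar>"
        using elim \<theta> by (intro log_derivative_bound[OF der lip]) (auto simp: field_simps)
      then show ?case using elim by simp
    qed
  qed
  from tendsto_diff[OF step.IH this] show ?case by (simp add: d_def)
qed

end

section \<open>Summation by parts\<close>

lemma Abel_summation:
  fixes u \<beta> :: "nat \<Rightarrow> real"
  assumes "n \<ge> 1"
  shows "(\<Sum>m\<in>{1..n}. u m * \<beta> m)
    = (\<Sum>m\<in>{1..<n}. (\<beta> m - \<beta> (Suc m)) * (\<Sum>j\<in>{1..m}. u j)) + \<beta> n * (\<Sum>j\<in>{1..n}. u j)"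
  using assms
proof (induction n rule: dec_induct)
  case (step n)
  then show ?case by (simp add: algebra_simps)
qed simp

text \<open>A decreasing weight has nonnegative differences, so a comparison of partial sums carries
  over to weighted sums; the constant error telescopes to \<open>C * \<beta> 1\<close>.\<close>

lemma Abel_summation_mono:
  fixes u v \<beta> :: "nat \<Rightarrow> real"
  assumes "n \<ge> 1" and mono: "\<And>m l. m \<le> l \<Longrightarrow> \<beta> l \<le> \<beta> m" and nonneg: "\<And>m. \<beta> m \<ge> 0"
    and le: "\<And>m. 1 \<le> m \<Longrightarrow> m \<le> n \<Longrightarrow> (\<Sum>j\<in>{1..m}. u j) \<le> (\<Sum>j\<in>{1..m}. v j) + C"
  shows "(\<Sum>m\<in>{1..n}. u m * \<beta> m) \<le> (\<Sum>m\<in>{1..n}. v m * \<beta> m) + C * \<beta> 1"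
proof -
  have C: "(\<Sum>m\<in>{1..<n}. (\<beta> m - \<beta> (Suc m)) * C) + \<beta> n * C = C * \<beta> 1"
    using \<open>n \<ge> 1\<close> by (induction n rule: dec_induct) (simp_all add: algebra_simps)
  have "(\<Sum>m\<in>{1..n}. u m * \<beta> m)
      \<le> (\<Sum>m\<in>{1..<n}. (\<beta> m - \<beta> (Suc m)) * ((\<Sum>j\<in>{1..m}. v j) + C)) + \<beta> n * ((\<Sum>j\<in>{1..n}. v j) + C)"
    unfolding Abel_summation[OF \<open>n \<ge> 1\<close>]
    using le mono nonneg \<open>n \<ge> 1\<close> by (intro add_mono sum_mono mult_left_mono) auto
  also have "\<dots> = (\<Sum>m\<in>{1..n}. v m * \<beta> m) + ((\<Sum>m\<in>{1..<n}. (\<beta> m - \<beta> (Suc m)) * C) + \<beta> n * C)"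
    unfolding Abel_summation[OF \<open>n \<ge> 1\<close>] by (simp only: distrib_left sum.distrib add_ac)
  finally show ?thesis unfolding C .
qed

context multiplicative_walk
begin

subsection \<open>Asymptotics of the mean number of empty boxes\<close>

text \<open>For \<open>n \<ge> 1\<close> this is the mean number of empty boxes, by
  \<open>expected_empty_eq\<close>.\<close>

definition e :: "nat \<Rightarrow> real" where "e n = (\<Sum>m\<in>{1..n}. U n m * b m)"

lemma U_tendsto: "(\<lambda>n. U n 1) \<longlonglongrightarrow> \<rho> \<Longrightarrow> m \<ge> 1 \<Longrightarrow> (\<lambda>n. U n m) \<longlonglongrightarrow> \<rho> / real m"
proof -
  assume *: "(\<lambda>n. U n 1) \<longlonglongrightarrow> \<rho>" "m \<ge> 1"
  have "(\<lambda>n. real m * U n m / real m) \<longlonglongrightarrow> \<rho> / real m"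
    using U_limit[OF *] *(2) by (intro tendsto_intros) auto
  then show ?thesis using *(2) by simp
qed

lemma e_limit_summable:
  assumes lim: "(\<lambda>n. U n 1) \<longlonglongrightarrow> \<rho>" and sm: "summable (\<lambda>m. b m / real m)"
  shows "e \<longlonglongrightarrow> \<rho> * (\<Sum>m. b m / real m)"
proof (rule tendstoI)
  fix \<epsilon> :: real assume "\<epsilon> > 0"
  define h where "h N = (\<Sum>m\<in>{1..N}. b m / real m)" for N
  have "(\<lambda>N. \<Sum>m\<le>N. b m / real m) \<longlonglongrightarrow> (\<Sum>m. b m / real m)" using summable_LIMSEQ'[OF sm] .
  moreover have "(\<Sum>m\<le>N. b m / real m) = h N" for N
    unfolding h_def by (intro sum.mono_neutral_right) auto
  ultimately have "(\<lambda>N. \<rho> * h N) \<longlonglongrightarrow> \<rho> * (\<Sum>m. b m / real m)" by (intro tendsto_intros) simp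
  moreover have "\<epsilon> / 3 > 0" using \<open>\<epsilon> > 0\<close> by simp
  ultimately have "\<forall>\<^sub>F N in sequentially. dist (\<rho> * h N) (\<rho> * (\<Sum>m. b m / real m)) < \<epsilon> / 3"
    by (rule tendstoD)
  moreover obtain A0 where A0: "A0 \<ge> 1" "\<And>A n. A \<ge> A0 \<Longrightarrow> (\<Sum>m\<in>{A..n}. U n m * b m) < \<epsilon> / 3"
    using U_tail[OF b_antimono _ sm \<open>\<epsilon> / 3 > 0\<close>] less_imp_le[OF b_pos] by metis
  ultimately have "\<forall>\<^sub>F N in sequentially. dist (\<rho> * h N) (\<rho> * (\<Sum>m. b m / real m)) < \<epsilon> / 3 \<and> N \<ge> A0"
    using eventually_ge_at_top[of A0] by (intro eventually_conj)
  then obtain N where N: "dist (\<rho> * h N) (\<rho> * (\<Sum>m. b m / real m)) < \<epsilon> / 3" "N \<ge> A0"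
    using eventually_happens by fastforce
  have "(\<lambda>n. \<Sum>m\<in>{1..N}. U n m * b m) \<longlonglongrightarrow> (\<Sum>m\<in>{1..N}. \<rho> / real m * b m)"
    by (intro tendsto_intros U_tendsto[OF lim]) auto
  also have "(\<Sum>m\<in>{1..N}. \<rho> / real m * b m) = \<rho> * h N" by (simp add: h_def sum_distrib_left)
  finally have "\<forall>\<^sub>F n in sequentially. dist (\<Sum>m\<in>{1..N}. U n m * b m) (\<rho> * h N) < \<epsilon> / 3"
    using \<open>\<epsilon> / 3 > 0\<close> by (rule tendstoD)
  then show "\<forall>\<^sub>F n in sequentially. dist (e n) (\<rho> * (\<Sum>m. b m / real m)) < \<epsilon>"
    using eventually_ge_at_top[of N]
  proof eventually_elim
    case (elim n)
    have "{1..n} = {1..N} \<union> {Suc N..n}" using elim by auto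
    then have "e n = (\<Sum>m\<in>{1..N}. U n m * b m) + (\<Sum>m\<in>{Suc N..n}. U n m * b m)"
      by (simp add: e_def sum.union_disjoint)
    moreover have "0 \<le> (\<Sum>m\<in>{Suc N..n}. U n m * b m)"
      using less_imp_le[OF b_pos] by (intro sum_nonneg mult_nonneg_nonneg U_nonneg) auto
    moreover have "(\<Sum>m\<in>{Suc N..n}. U n m * b m) < \<epsilon> / 3" using A0(2)[of "Suc N" n] N by simp
    ultimately show ?case using elim(1) N(1) unfolding dist_real_def by linarith
  qed
qed

lemma sum_U_finite_tendsto_0:
  assumes "(\<lambda>n. U n 1) \<longlonglongrightarrow> 0"
  shows "(\<lambda>n. \<Sum>m\<in>{1..<N}. U n m * \<beta> m) \<longlonglongrightarrow> 0"
  using U_tendsto[OF assms] by (intro tendsto_null_sum tendsto_mult_left_zero) simp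

lemma sum_split_at: 
  fixes f :: "nat \<Rightarrow> real"
  shows "1 \<le> N \<Longrightarrow> N \<le> n \<Longrightarrow> (\<Sum>m\<in>{1..n}. f m) = (\<Sum>m\<in>{1..<N}. f m) + (\<Sum>m\<in>{N..n}. f m)"
proof -
  assume "1 \<le> N" "N \<le> n"
  then have "{1..n} = {1..<N} \<union> {N..n}" by auto
  then show ?thesis by (simp only:) (rule sum.union_disjoint, auto)
qed

lemma e_eventually_ge:
  assumes lim: "(\<lambda>n. U n 1) \<longlonglongrightarrow> 0" and ge: "\<forall>\<^sub>F m in sequentially. x * c m \<le> b m" and "x \<ge> 0" "\<epsilon> > 0"
  shows "\<forall>\<^sub>F n in sequentially. x - \<epsilon> < e n"
proof -
  obtain N where N: "N \<ge> 1" "\<And>m. m \<ge> N \<Longrightarrow> x * c m \<le> b m"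
    using ge unfolding eventually_sequentially by (metis le_trans nat_le_linear)
  have "(\<lambda>n. x * (\<Sum>m\<in>{1..<N}. U n m * c m)) \<longlonglongrightarrow> 0"
    by (intro tendsto_mult_right_zero sum_U_finite_tendsto_0 lim)
  then have "\<forall>\<^sub>F n in sequentially. x * (\<Sum>m\<in>{1..<N}. U n m * c m) < \<epsilon>"
    using \<open>\<epsilon> > 0\<close> by (rule order_tendstoD)
  then show ?thesis using eventually_ge_at_top[of N]
  proof eventually_elim
    case (elim n)
    have "x = x * (\<Sum>m\<in>{1..n}. U n m * c m)" using sum_U_c[of n] elim N(1) by simp
    also have "\<dots> = x * (\<Sum>m\<in>{1..<N}. U n m * c m) + (\<Sum>m\<in>{N..n}. U n m * (x * c m))"
      unfolding sum_split_at[OF N(1) elim(2)] by (simp add: distrib_left sum_distrib_left mult_ac)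
    also have "(\<Sum>m\<in>{N..n}. U n m * (x * c m)) \<le> (\<Sum>m\<in>{N..n}. U n m * b m)"
      using N by (intro sum_mono mult_left_mono U_nonneg) auto
    also have "\<dots> \<le> e n"
      unfolding e_def using N(1) less_imp_le[OF b_pos] by (intro sum_mono2) (auto intro!: mult_nonneg_nonneg U_nonneg)
    finally show ?case using elim(1) by linarith
  qed
qed

lemma e_eventually_le:
  assumes lim: "(\<lambda>n. U n 1) \<longlonglongrightarrow> 0" and le: "\<forall>\<^sub>F m in sequentially. b m \<le> x * c m" and "x \<ge> 0" "\<epsilon> > 0"
  shows "\<forall>\<^sub>F n in sequentially. e n < x + \<epsilon>"
proof -
  obtain N where N: "N \<ge> 1" "\<And>m. m \<ge> N \<Longrightarrow> b m \<le> x * c m"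
    using le unfolding eventually_sequentially by (metis le_trans nat_le_linear)
  have "\<forall>\<^sub>F n in sequentially. (\<Sum>m\<in>{1..<N}. U n m * b m) < \<epsilon>"
    using sum_U_finite_tendsto_0[OF lim] \<open>\<epsilon> > 0\<close> by (rule order_tendstoD)
  then show ?thesis using eventually_ge_at_top[of N]
  proof eventually_elim
    case (elim n)
    have "e n = (\<Sum>m\<in>{1..<N}. U n m * b m) + (\<Sum>m\<in>{N..n}. U n m * b m)"
      unfolding e_def by (rule sum_split_at[OF N(1) elim(2)])
    also have "(\<Sum>m\<in>{N..n}. U n m * b m) \<le> (\<Sum>m\<in>{N..n}. U n m * (x * c m))"
      using N by (intro sum_mono mult_left_mono U_nonneg) auto
    also have "\<dots> = x * (\<Sum>m\<in>{N..n}. U n m * c m)" by (simp add: sum_distrib_left mult_ac)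
    also have "\<dots> \<le> x * (\<Sum>m\<in>{1..n}. U n m * c m)"
      using N(1) less_imp_le[OF c_pos] \<open>x \<ge> 0\<close>
      by (intro mult_left_mono sum_mono2) (auto intro!: mult_nonneg_nonneg U_nonneg)
    also have "\<dots> = x" using sum_U_c[of n] elim N(1) by simp
    finally show ?case using elim(1) by linarith
  qed
qed

section \<open>Expected number of visits to an initial segment\<close>

definition V :: "nat \<Rightarrow> nat \<Rightarrow> real" where "V n m = (\<Sum>j\<in>{1..m}. U n j)"

lemma V_beyond: "n \<le> m \<Longrightarrow> V n m = V n n"
  unfolding V_def by (intro sum.mono_neutral_right) (auto simp: U_eq_0)

text \<open>Summing \<open>U_Suc_diff\<close> over all states telescopes: one more ball increases
  the expected number of visits to positive states by exactly
  \<open>U (n + 1) 1 / (n + 1)\<close>.\<close>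

lemma V_diag: "V n n = (\<Sum>i\<in>{1..n}. U i 1 / real i)"
proof (induction n)
  case 0
  show ?case by (simp add: V_def)
next
  case (Suc n)
  have "real (Suc n) * (V (Suc n) (Suc n) - V n (Suc n))
      = (\<Sum>j\<in>{1..Suc n}. real (Suc n) * (U (Suc n) j - U n j))"
    unfolding V_def sum_distrib_left[symmetric] sum_subtractf ..
  also have "\<dots> = (\<Sum>j\<in>{1..Suc n}. real j * U (Suc n) j - real (Suc j) * U (Suc n) (Suc j))"
    by (intro sum.cong refl U_Suc_diff) auto
  also have "\<dots> = real 1 * U (Suc n) 1 - real (Suc (Suc n)) * U (Suc n) (Suc (Suc n))"
  proof -
    have "(\<Sum>j\<in>{1..k}. real j * U (Suc n) j - real (Suc j) * U (Suc n) (Suc j))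
        = real 1 * U (Suc n) 1 - real (Suc k) * U (Suc n) (Suc k)" for k
      by (induction k) (simp_all del: of_nat_Suc)
    then show ?thesis .
  qed
  finally have "V (Suc n) (Suc n) - V n (Suc n) = U (Suc n) 1 / real (Suc n)"
    by (simp add: U_eq_0 field_simps)
  then show ?case using Suc V_beyond[of n "Suc n"] by simp
qed

lemma V_diag_mono: "n \<le> m \<Longrightarrow> V n n \<le> V m m"
  unfolding V_diag by (intro sum_mono2) (auto intro!: divide_nonneg_nonneg U_nonneg)

lemma V_nonneg: "V n m \<ge> 0"
  unfolding V_def by (intro sum_nonneg U_nonneg) auto

lemma V_rec: "m < n \<Longrightarrow> V n m = (\<Sum>j\<in>{1..n}. p n j * V j m)"
proof -
  assume "m < n"
  have "V n m = (\<Sum>i\<in>{1..m}. \<Sum>j\<in>{1..n}. p n j * U j i)"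
    unfolding V_def using \<open>m < n\<close> by (intro sum.cong refl) (subst U_rec, auto)
  also have "\<dots> = (\<Sum>j\<in>{1..n}. p n j * V j m)"
    unfolding V_def sum_distrib_left by (rule sum.swap)
  finally show ?thesis .
qed

text \<open>A start \<open>n \<le> m\<close> gives \<open>V n n\<close>, which grows with
  \<open>n\<close>; from above, the walk must first enter the segment.\<close>

lemma V_le: "n \<ge> 1 \<Longrightarrow> V n m \<le> V m m"
proof (rule max_principle[where A = m and y = "\<lambda>n. V n m"])
  fix n assume "1 \<le> n" "n \<le> m"
  then show "V n m \<le> V m m" using V_beyond[of n m] V_diag_mono[of n m] by simp
next
  fix n assume "1 \<le> n" "m < n"
  then show "V n m \<le> (\<Sum>j\<in>{1..n}. p n j * V j m)" using V_rec by simp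
qed (auto intro: V_nonneg)

text \<open>The probability that one step from \<open>j\<close> ends at or below \<open>l\<close>.
  For \<open>l \<le> m < n\<close>, the sum of \<open>U n j * overshoot l j\<close> over
  \<open>j > m\<close> is the probability that the walk from \<open>n\<close> enters
  \<open>{0..m}\<close> at or below \<open>l\<close>.\<close>

definition overshoot :: "nat \<Rightarrow> nat \<Rightarrow> real" where "overshoot l j = (\<Sum>i\<le>l. p j i)"

text \<open>From \<open>n > m\<close> the walk enters \<open>{0..m}\<close>; with the probability that it does so above \<open>l\<close>
  it then makes at least \<open>V l l\<close> visits in expectation.\<close>

lemma V_ge_overshoot:
  assumes "l \<le> m" "n \<ge> 1" "n > l"
  shows "V n m \<ge> V l l * (1 - (\<Sum>j\<in>{m<..n}. U n j * overshoot l j))"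
proof -
  define D where "D n = (\<Sum>j\<in>{1..n}. U n j * (if j > m then overshoot l j else 0))" for n
  have D_eq: "D n = (\<Sum>j\<in>{m<..n}. U n j * overshoot l j)" for n
    unfolding D_def by (intro sum.mono_neutral_cong_right) auto
  \<comment> \<open>For \<open>n > m\<close> the bracket is the probability of entering
    \<open>{0..m}\<close> above \<open>l\<close>. For \<open>l < n \<le> m\<close> it is 1 and
    \<open>V n m = V n n \<ge> V l l\<close>; for \<open>n \<le> l\<close> the indicator removes the
    first term.\<close>
  define y where "y n = V l l * ((if n > l then 1 else 0) - D n) - V n m" for n
  have "y n \<le> 0"
  proof (rule max_principle[where A = m and y = y])
    fix n assume n: "1 \<le> n" "n \<le> m"
    then have "D n = 0" unfolding D_def by (intro sum.neutral) auto
    then show "y n \<le> 0"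
      using n V_beyond[of n m] V_diag_mono[of l n] V_nonneg[of n n] by (simp add: y_def)
  next
    fix n assume n: "1 \<le> n" "m < n"
    have D: "D n = overshoot l n + (\<Sum>j\<in>{1..n}. p n j * D j)"
      unfolding D_def using potential_rec[OF n(1), of "\<lambda>j. if j > m then overshoot l j else 0"] n by simp
    have "{..n} = {..l} \<union> {j \<in> {1..n}. j > l}" using n assms by auto
    then have "(\<Sum>j\<le>n. p n j) = overshoot l n + (\<Sum>j\<in>{j \<in> {1..n}. j > l}. p n j)"
      unfolding overshoot_def by (simp only:) (rule sum.union_disjoint, auto)
    moreover have "(\<Sum>j\<in>{j \<in> {1..n}. j > l}. p n j) = (\<Sum>j\<in>{1..n}. p n j * (if j > l then 1 else 0))"
      by (intro sum.mono_neutral_cong_left) auto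
    ultimately have "1 = overshoot l n + (\<Sum>j\<in>{1..n}. p n j * (if j > l then 1 else 0))"
      unfolding sum_p by simp
    then have "(if n > l then 1 else 0) - D n = (\<Sum>j\<in>{1..n}. p n j * (if j > l then 1 else 0)) - (\<Sum>j\<in>{1..n}. p n j * D j)"
      using D n assms by simp
    then have "y n = V l l * ((\<Sum>j\<in>{1..n}. p n j * (if j > l then 1 else 0)) - (\<Sum>j\<in>{1..n}. p n j * D j))
        - (\<Sum>j\<in>{1..n}. p n j * V j m)"
      using V_rec[OF n(2)] by (simp add: y_def)
    also have "\<dots> = (\<Sum>j\<in>{1..n}. p n j * y j)"
      unfolding sum_subtractf[symmetric] sum_distrib_left y_def
      by (intro sum.cong refl) (simp add: algebra_simps)
    finally show "y n \<le> (\<Sum>j\<in>{1..n}. p n j * y j)" by simp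
  qed (use assms in auto)
  then show ?thesis using assms D_eq by (simp add: y_def)
qed

text \<open>A majorant free of \<open>l\<close> for the jump bounds below, used through
  \<open>(1 - w / (2 * l)) ^ l \<le> exp (- w / 2) \<le> 1 - w / 4\<close>. One half in 1/4 comes
  from the base \<open>1 - 1 / (2 * l)\<close>, the other from \<open>exp_neg_le\<close>.\<close>

definition g :: "nat \<Rightarrow> real" where "g x = expectation (\<lambda>\<omega>. (1 - W \<omega> / 4) ^ x)"

lemma integrable_damped [simp]:
  assumes "0 \<le> t" "t \<le> 1" shows "integrable M (\<lambda>\<omega>. (1 - W \<omega> * t) ^ x)"
proof (rule integrable_W[where B = 1 and f = "\<lambda>w. (1 - w * t) ^ x"])
  fix w :: real assume "0 < w" "w < 1"
  then have "0 \<le> w * t" "w * t \<le> 1 * 1" using assms by (simp, intro mult_mono) auto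
  then show "\<bar>(1 - w * t) ^ x\<bar> \<le> 1" by (simp add: power_le_one)
qed simp

text \<open>Markov's inequality for the decreasing function \<open>x ^ i\<close> with
  \<open>x = 1 - 1 / (2 * l)\<close>: Bernoulli's inequality gives \<open>x ^ l \<ge> 1 / 2\<close>,
  whence the factor 2, and the mean of \<open>x ^ i\<close> is the binomial generating
  function.\<close>

lemma overshoot_le:
  assumes "l \<ge> 1"
  shows "overshoot l j \<le> 2 * expectation (\<lambda>\<omega>. (1 - W \<omega> * (1 / (2 * real l))) ^ j)"
proof -
  have "overshoot l j = expectation (\<lambda>\<omega>. \<Sum>i\<le>l. Bernstein j i (W \<omega>))"
    unfolding overshoot_def p_def by (subst Bochner_Integration.integral_sum) auto
  also have "\<dots> \<le> expectation (\<lambda>\<omega>. 2 * (1 - W \<omega> * (1 / (2 * real l))) ^ j)"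
  proof (rule integral_mono_AE)
    show "AE \<omega> in M. (\<Sum>i\<le>l. Bernstein j i (W \<omega>)) \<le> 2 * (1 - W \<omega> * (1 / (2 * real l))) ^ j"
    proof (rule AE_W)
      fix w :: real assume w: "0 < w" "w < 1"
      define x where "x = 1 - 1 / (2 * real l)"
      have x: "0 \<le> x" "x \<le> 1" using assms by (auto simp: x_def field_simps)
      have "1 / 2 \<le> x ^ l"
      proof -
        have "1 + real l * (- 1 / (2 * real l)) \<le> (1 + (- 1 / (2 * real l))) ^ l"
          using assms by (intro Bernoulli_inequality) (auto simp: field_simps)
        then show ?thesis using assms by (simp add: x_def)
      qed
      have "(\<Sum>i\<le>l. Bernstein j i w) \<le> (\<Sum>i\<le>l. 2 * (Bernstein j i w * x ^ i))"
      proof (rule sum_mono)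
        fix i assume "i \<in> {..l}"
        then have "x ^ l \<le> x ^ i" using x by (intro power_decreasing) auto
        then have "1 \<le> 2 * x ^ i" using \<open>1 / 2 \<le> x ^ l\<close> by linarith
        then have "Bernstein j i w * 1 \<le> Bernstein j i w * (2 * x ^ i)"
          using w by (intro mult_left_mono Bernstein_nonneg) auto
        then show "Bernstein j i w \<le> 2 * (Bernstein j i w * x ^ i)" by simp
      qed
      also have "\<dots> \<le> (\<Sum>i\<le>max l j. 2 * (Bernstein j i w * x ^ i))"
        using w x by (intro sum_mono2 mult_nonneg_nonneg Bernstein_nonneg) auto
      also have "\<dots> = (\<Sum>i\<le>j. 2 * (Bernstein j i w * x ^ i))"
        by (intro sum.mono_neutral_right) (auto simp: Bernstein_eq_0)
      also have "\<dots> = 2 * (1 - w * (1 - x)) ^ j"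
        by (simp only: sum_distrib_left[symmetric] sum_Bernstein_power)
      finally show "(\<Sum>i\<le>l. Bernstein j i w) \<le> 2 * (1 - w * (1 / (2 * real l))) ^ j" by (simp add: x_def)
    qed
  qed (use assms in \<open>auto intro!: integrable_sum integrable_mult_right integrable_damped
        simp: field_simps simp del: times_divide_eq_right\<close>)
  also have "\<dots> = 2 * expectation (\<lambda>\<omega>. (1 - W \<omega> * (1 / (2 * real l))) ^ j)" by simp
  finally show ?thesis .
qed

text \<open>The bound depends only on \<open>R\<close>, a lower bound for the ratio of
  \<open>m\<close> to \<open>l\<close>. The chance of jumping from above \<open>m\<close> to at most
  \<open>l\<close> is thus small uniformly in \<open>l\<close>, \<open>m\<close> and
  \<open>n\<close> once \<open>R\<close> is large.\<close>

lemma overshoot_sum_le: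
  assumes "l \<ge> 1" "R \<ge> 1" "R * l \<le> m" and sm: "summable (\<lambda>i. g (2 ^ i * R))"
  shows "(\<Sum>j\<in>{m<..n}. U n j * overshoot l j) \<le> 4 / (1 - b 1) * (\<Sum>i. g (2 ^ i * R))"
proof -
  define \<beta> where "\<beta> j = expectation (\<lambda>\<omega>. (1 - W \<omega> * (1 / (2 * real l))) ^ j)" for j
  have l01: "0 \<le> 1 / (2 * real l)" "1 / (2 * real l) \<le> 1" using assms by (auto simp: field_simps)
  have base: "0 \<le> 1 - w * (1 / (2 * real l))" "1 - w * (1 / (2 * real l)) \<le> 1" if "0 < w" "w < 1" for w
    using that l01 mult_mono[of w 1 "1 / (2 * real l)" 1] by auto
  have \<beta>_mono: "\<beta> y \<le> \<beta> x" if "x \<le> y" for x y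
    unfolding \<beta>_def
  proof (rule integral_mono_AE)
    show "AE \<omega> in M. (1 - W \<omega> * (1 / (2 * real l))) ^ y \<le> (1 - W \<omega> * (1 / (2 * real l))) ^ x"
      using that base by (intro AE_W power_decreasing) auto
  qed (use l01 in \<open>auto intro!: integrable_damped simp del: times_divide_eq_right\<close>)
  have \<beta>_nonneg: "\<beta> x \<ge> 0" for x
    unfolding \<beta>_def using base by (intro integral_nonneg_AE AE_W zero_le_power) auto
  have \<beta>_g: "\<beta> (x * l) \<le> g x" for x
    unfolding \<beta>_def g_def
  proof (rule integral_mono_AE)
    show "AE \<omega> in M. (1 - W \<omega> * (1 / (2 * real l))) ^ (x * l) \<le> (1 - W \<omega> / 4) ^ x"
    proof (rule AE_W)
      fix w :: real assume w: "0 < w" "w < 1"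
      have "(1 - w * (1 / (2 * real l))) ^ l \<le> exp (- (w * (1 / (2 * real l)))) ^ l"
        using base[OF w] exp_ge_add_one_self[of "- (w * (1 / (2 * real l)))"] by (intro power_mono) auto
      also have "\<dots> = exp (- w / 2)" using assms by (simp add: exp_of_nat_mult[symmetric])
      also have "\<dots> \<le> 1 - w / 4" using exp_neg_le[of "w / 2"] w by simp
      finally have "((1 - w * (1 / (2 * real l))) ^ l) ^ x \<le> (1 - w / 4) ^ x"
        using base[OF w] by (intro power_mono) auto
      then show "(1 - w * (1 / (2 * real l))) ^ (x * l) \<le> (1 - w / 4) ^ x"
        by (simp add: power_mult[symmetric] mult.commute)
    qed
    show "integrable M (\<lambda>\<omega>. (1 - W \<omega> / 4) ^ x)" using integrable_damped[of "1 / 4"] by simp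
  qed (use l01 in \<open>auto intro!: integrable_damped simp del: times_divide_eq_right\<close>)
  have A: "R * l \<ge> 1" using assms by simp
  have sm\<beta>: "summable (\<lambda>i. \<beta> (2 ^ i * (R * l)))"
    using \<beta>_g[of "2 ^ i * R" for i] \<beta>_nonneg
    by (intro summable_comparison_test'[OF sm, of 0]) (simp add: mult.assoc)
  have "(\<Sum>j\<in>{m<..n}. U n j * overshoot l j) \<le> (\<Sum>j\<in>{m<..n}. U n j * (2 * \<beta> j))"
    using assms overshoot_le[OF \<open>l \<ge> 1\<close>] A unfolding \<beta>_def by (intro sum_mono mult_left_mono U_nonneg) auto
  also have "\<dots> = 2 * (\<Sum>j\<in>{m<..n}. U n j * \<beta> j)" by (simp add: sum_distrib_left mult_ac)
  also have "(\<Sum>j\<in>{m<..n}. U n j * \<beta> j) \<le> (\<Sum>j\<in>{R * l..n}. U n j * \<beta> j)"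
  proof (rule sum_mono2)
    fix j assume "j \<in> {R * l..n} - {m<..n}"
    then have "R * l \<le> j" by simp
    then have "j \<ge> 1" using A by linarith
    then show "0 \<le> U n j * \<beta> j" using U_nonneg \<beta>_nonneg by simp
  qed (use assms in auto)
  also have "\<dots> \<le> 2 / (1 - b 1) * (\<Sum>i. \<beta> (2 ^ i * (R * l)))"
    by (intro U_tail_dyadic \<beta>_mono \<beta>_nonneg A sm\<beta>)
  also have "(\<Sum>i. \<beta> (2 ^ i * (R * l))) \<le> (\<Sum>i. g (2 ^ i * R))"
    using \<beta>_g[of "2 ^ i * R" for i] by (intro suminf_le sm\<beta> sm) (simp add: mult.assoc)
  finally show ?thesis using b_less_1[of 1] by (simp add: divide_right_mono mult_left_mono)
qed

end

lemma harm_eq_sum: "harm n = (\<Sum>i\<in>{1..n}. 1 / real i)"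
  by (simp add: harm_def inverse_eq_divide)

text \<open>Between \<open>l = m div R\<close> and \<open>m\<close> there are at most
  \<open>m < R * (l + 1)\<close> terms, each at most \<open>1 / (l + 1)\<close>. The true loss is
  about \<open>ln R\<close>, but any constant will do.\<close>

lemma harm_div_ge:
  assumes "R \<ge> 1"
  shows "harm m - real R \<le> harm (m div R)"
proof -
  define l where "l = m div R"
  have "l \<le> m" by (simp add: l_def)
  have "m < R * Suc l" using assms unfolding l_def by (simp add: dividend_less_times_div)
  then have lt: "real m \<le> real R * real (Suc l)" by (metis less_imp_le of_nat_le_iff of_nat_mult)
  have "{1..m} = {1..l} \<union> {Suc l..m}" using \<open>l \<le> m\<close> by auto
  then have "harm m = harm l + (\<Sum>i\<in>{Suc l..m}. 1 / real i)"
    unfolding harm_eq_sum by (simp only:) (rule sum.union_disjoint, auto)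
  also have "(\<Sum>i\<in>{Suc l..m}. 1 / real i) \<le> (\<Sum>i\<in>{Suc l..m}. 1 / real (Suc l))"
    by (intro sum_mono divide_left_mono) auto
  also have "\<dots> = (real m - real l) / real (Suc l)" using \<open>l \<le> m\<close> by (simp add: of_nat_diff)
  also have "\<dots> \<le> real m / real (Suc l)" by (intro divide_right_mono) auto
  also have "\<dots> \<le> real R" using lt by (simp add: field_simps)
  finally show ?thesis by (simp add: l_def)
qed

text \<open>The term \<open>m = 0\<close> is a division by zero, that is 0, so the logarithmic
  series may start there. The same convention removes \<open>c 0 / real 0\<close> and
  \<open>b 0 / real 0\<close> from the sums for \<mu> and \<nu>.\<close>

lemma neg_ln_sums:
  fixes z :: real
  assumes "0 < z" "z < 1"
  shows "(\<lambda>m. (1 - z) ^ m / real m) sums (- ln z)"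
proof -
  have "(\<lambda>n. - ((- (z - 1)) ^ n) / real n) sums ln (1 + (z - 1))"
    using assms by (intro ln_series') auto
  from sums_minus[OF this] show ?thesis by simp
qed

context multiplicative_walk
begin

text \<open>By \<open>V_diag\<close> this is a logarithmic average of \<open>U i 1\<close>; the
  finitely many \<open>i\<close> at which \<open>U i 1\<close> is not yet close to \<rho> make up
  the constant.\<close>

lemma V_diag_approx:
  assumes lim: "(\<lambda>n. U n 1) \<longlonglongrightarrow> \<rho>" and "\<epsilon> > 0"
  shows "\<exists>C\<ge>0. \<forall>n. \<bar>V n n - \<rho> * harm n\<bar> \<le> \<epsilon> * harm n + C"
proof -
  obtain N where N: "\<And>i. i \<ge> N \<Longrightarrow> \<bar>U i 1 - \<rho>\<bar> < \<epsilon>"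
    using tendstoD[OF lim \<open>\<epsilon> > 0\<close>] unfolding eventually_sequentially dist_real_def by blast
  define C where "C = (\<Sum>i\<in>{1..N}. \<bar>U i 1 - \<rho>\<bar> / real i)"
  have "C \<ge> 0" unfolding C_def by (intro sum_nonneg) auto
  moreover have "\<bar>V n n - \<rho> * harm n\<bar> \<le> \<epsilon> * harm n + C" for n
  proof -
    have "V n n - \<rho> * harm n = (\<Sum>i\<in>{1..n}. (U i 1 - \<rho>) / real i)"
      unfolding V_diag harm_eq_sum sum_distrib_left sum_subtractf[symmetric] by (simp add: diff_divide_distrib)
    also have "\<bar>\<dots>\<bar> \<le> (\<Sum>i\<in>{1..n}. \<bar>U i 1 - \<rho>\<bar> / real i)"
      by (rule order_trans[OF sum_abs]) (simp add: abs_divide)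
    also have "\<dots> \<le> (\<Sum>i\<in>{1..n}. \<epsilon> * (1 / real i) + (if i \<le> N then \<bar>U i 1 - \<rho>\<bar> / real i else 0))"
    proof (rule sum_mono)
      fix i
      show "\<bar>U i 1 - \<rho>\<bar> / real i \<le> \<epsilon> * (1 / real i) + (if i \<le> N then \<bar>U i 1 - \<rho>\<bar> / real i else 0)"
        using N[of i] \<open>\<epsilon> > 0\<close> by (cases "i \<le> N") (auto intro: divide_right_mono)
    qed
    also have "\<dots> = \<epsilon> * harm n + (\<Sum>i\<in>{1..n}. if i \<le> N then \<bar>U i 1 - \<rho>\<bar> / real i else 0)"
      unfolding harm_eq_sum sum.distrib sum_distrib_left by simp
    also have "(\<Sum>i\<in>{1..n}. if i \<le> N then \<bar>U i 1 - \<rho>\<bar> / real i else 0)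
        = (\<Sum>i\<in>{1..n} \<inter> {1..N}. \<bar>U i 1 - \<rho>\<bar> / real i)"
      by (intro sum.mono_neutral_cong_right) auto
    also have "\<dots> \<le> C" unfolding C_def by (intro sum_mono2) auto
    finally show ?thesis by simp
  qed
  ultimately show ?thesis by blast
qed

lemma g_antimono: "m \<le> n \<Longrightarrow> g n \<le> g m" and g_nonneg: "g n \<ge> 0"
proof -
  have int: "integrable M (\<lambda>\<omega>. (1 - W \<omega> / 4) ^ x)" for x using integrable_damped[of "1 / 4"] by simp
  show "g n \<le> g m" if "m \<le> n"
    unfolding g_def using that by (intro integral_mono_AE int AE_W power_decreasing) auto
  show "g n \<ge> 0" unfolding g_def by (intro integral_nonneg_AE AE_W zero_le_power) auto
qed

text \<open>With \<open>l = m div R\<close>, the walk enters \<open>{0..m}\<close> above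
  \<open>l\<close> with probability at least \<open>1 - \<epsilon>\<close> and then has at least
  \<open>V l l\<close> visits in expectation; \<open>harm l\<close> falls short of
  \<open>harm m\<close> only by a constant.\<close>

lemma V_lower:
  assumes lim: "(\<lambda>n. U n 1) \<longlonglongrightarrow> \<rho>" and sm: "summable (\<lambda>m. g m / real m)"
    and \<epsilon>: "0 < \<epsilon>" "\<epsilon> < 1" "\<epsilon> < \<rho>"
  shows "\<exists>C\<ge>0. \<forall>n m. 1 \<le> m \<longrightarrow> m \<le> n \<longrightarrow> (1 - \<epsilon>) * (\<rho> - \<epsilon>) * harm m - C \<le> V n m"
proof -
  obtain C1 where C1: "C1 \<ge> 0" "\<And>n. \<bar>V n n - \<rho> * harm n\<bar> \<le> \<epsilon> * harm n + C1"
    using V_diag_approx[OF lim \<epsilon>(1)] by blast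
  define K where "K = 4 / (1 - b 1)"
  have "K > 0" using b_less_1[of 1] by (simp add: K_def)
  have sm2: "summable (\<lambda>i. g (2 ^ i))" using summable_dyadic[OF g_antimono g_nonneg sm] .
  obtain J0 where J0: "\<And>j. j \<ge> J0 \<Longrightarrow> norm (\<Sum>i. g (2 ^ (i + j))) < \<epsilon> / K"
    using suminf_exist_split[OF divide_pos_pos[OF \<epsilon>(1) \<open>K > 0\<close>] sm2] by blast
  \<comment> \<open>The extra doubling ensures \<open>R \<ge> 2\<close>, so that
    \<open>l = m div R\<close> satisfies \<open>l < m \<le> n\<close>.\<close>
  define R :: nat where "R = 2 ^ Suc J0"
  have "R \<ge> 2" by (simp add: R_def)
  have smR: "summable (\<lambda>i. g (2 ^ i * R))"
    using summable_ignore_initial_segment[OF sm2, of "Suc J0"] by (simp add: R_def power_add mult_ac)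
  have tail: "K * (\<Sum>i. g (2 ^ i * R)) \<le> \<epsilon>"
  proof -
    have "(\<Sum>i. g (2 ^ i * R)) < \<epsilon> / K"
      using J0[of "Suc J0"] abs_ge_self[of "\<Sum>i. g (2 ^ i * R)"] by (simp add: R_def power_add mult_ac)
    then show ?thesis using \<open>K > 0\<close> by (simp add: field_simps)
  qed
  have "(1 - \<epsilon>) * (\<rho> - \<epsilon>) * harm m - (C1 + \<rho> * real R) \<le> V n m" if m: "1 \<le> m" "m \<le> n" for n m
  proof (cases "m div R = 0")
    case True
    \<comment> \<open>Here \<open>m < R\<close>, so \<open>harm m \<le> R\<close> and the constant
      \<open>\<rho> * R\<close> already makes the left side nonpositive.\<close>
    have coef: "(1 - \<epsilon>) * (\<rho> - \<epsilon>) \<le> 1 * \<rho>" using \<epsilon> by (intro mult_mono) auto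
    have "harm m \<le> real R" using harm_div_ge[of R m] \<open>R \<ge> 2\<close> True by (simp add: harm_eq_sum)
    then have "(1 - \<epsilon>) * (\<rho> - \<epsilon>) * harm m \<le> \<rho> * real R"
      using coef \<epsilon> harm_nonneg by (intro mult_mono) auto
    then show ?thesis using C1(1) V_nonneg[of n m] by linarith
  next
    case False
    define l where "l = m div R"
    have l: "l \<ge> 1" "R * l \<le> m" using False by (auto simp: l_def)
    have "2 * l \<le> R * l" using \<open>R \<ge> 2\<close> by (intro mult_right_mono) auto
    then have "l < m" using l by linarith
    have "(\<Sum>j\<in>{m<..n}. U n j * overshoot l j) \<le> \<epsilon>"
      using overshoot_sum_le[OF l(1) _ l(2) smR, of n] \<open>R \<ge> 2\<close> tail by (simp add: K_def)
    then have "V l l * (1 - \<epsilon>) \<le> V l l * (1 - (\<Sum>j\<in>{m<..n}. U n j * overshoot l j))"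
      using V_nonneg by (intro mult_left_mono) auto
    also have "\<dots> \<le> V n m" using m \<open>l < m\<close> by (intro V_ge_overshoot) auto
    finally have 1: "V l l * (1 - \<epsilon>) \<le> V n m" .
    have "(\<rho> - \<epsilon>) * harm m - (C1 + \<rho> * real R) \<le> V l l"
    proof -
      have "(\<rho> - \<epsilon>) * (harm m - real R) \<le> (\<rho> - \<epsilon>) * harm l"
        using harm_div_ge[of R m] \<open>R \<ge> 2\<close> \<epsilon> by (intro mult_left_mono) (auto simp: l_def)
      moreover have "(\<rho> - \<epsilon>) * harm l - C1 \<le> V l l" using C1(2)[of l] by (simp add: left_diff_distrib abs_le_iff)
      moreover have "(\<rho> - \<epsilon>) * real R \<le> \<rho> * real R" using \<epsilon> by (intro mult_right_mono) auto
      ultimately show ?thesis by (simp add: algebra_simps)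
    qed
    then have "((\<rho> - \<epsilon>) * harm m - (C1 + \<rho> * real R)) * (1 - \<epsilon>) \<le> V l l * (1 - \<epsilon>)"
      using \<epsilon> by (intro mult_right_mono) auto
    moreover have "(C1 + \<rho> * real R) * (1 - \<epsilon>) \<le> (C1 + \<rho> * real R) * 1"
      using \<epsilon> C1(1) by (intro mult_left_mono) auto
    ultimately show ?thesis using 1 by (simp add: algebra_simps)
  qed
  moreover have "C1 + \<rho> * real R \<ge> 0" using C1(1) \<epsilon> by simp
  ultimately show ?thesis by blast
qed

definition H :: "nat \<Rightarrow> real" where "H n = (\<Sum>m\<in>{1..n}. b m / real m)"

text \<open>\<open>V_le\<close> and \<open>V_diag_approx\<close> bound the visits to
  \<open>{1..m}\<close> uniformly in \<open>n\<close>; since \<open>b\<close> decreases, summation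
  by parts transfers the bound to \<open>e\<close>.\<close>

lemma e_upper:
  assumes lim: "(\<lambda>n. U n 1) \<longlonglongrightarrow> \<rho>" and "\<epsilon> > 0"
  shows "\<exists>C\<ge>0. \<forall>n\<ge>1. e n \<le> (\<rho> + \<epsilon>) * H n + C"
proof -
  obtain C where C: "C \<ge> 0" "\<And>n. \<bar>V n n - \<rho> * harm n\<bar> \<le> \<epsilon> * harm n + C"
    using V_diag_approx[OF assms] by blast
  have "e n \<le> (\<rho> + \<epsilon>) * H n + C * b 1" if "n \<ge> 1" for n
  proof -
    have "e n \<le> (\<Sum>m\<in>{1..n}. (\<rho> + \<epsilon>) * (1 / real m) * b m) + C * b 1"
      unfolding e_def
    proof (rule Abel_summation_mono[OF that b_antimono less_imp_le[OF b_pos]])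
      fix m
      have "V n m \<le> V m m" using that by (rule V_le)
      also have "\<dots> \<le> (\<rho> + \<epsilon>) * harm m + C" using C(2)[of m] by (simp add: distrib_right abs_le_iff)
      finally show "(\<Sum>j\<in>{1..m}. U n j) \<le> (\<Sum>j\<in>{1..m}. (\<rho> + \<epsilon>) * (1 / real j)) + C"
        by (simp add: V_def harm_eq_sum sum_distrib_left)
    qed
    also have "(\<Sum>m\<in>{1..n}. (\<rho> + \<epsilon>) * (1 / real m) * b m) = (\<rho> + \<epsilon>) * H n"
      by (simp add: H_def sum_distrib_left)
    finally show ?thesis .
  qed
  moreover have "C * b 1 \<ge> 0" using C(1) less_imp_le[OF b_pos] by simp
  ultimately show ?thesis by blast
qed

lemma e_lower:
  assumes lim: "(\<lambda>n. U n 1) \<longlonglongrightarrow> \<rho>" and sm: "summable (\<lambda>m. g m / real m)"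
    and \<epsilon>: "0 < \<epsilon>" "\<epsilon> < 1" "\<epsilon> < \<rho>"
  shows "\<exists>C\<ge>0. \<forall>n\<ge>1. (1 - \<epsilon>) * (\<rho> - \<epsilon>) * H n - C \<le> e n"
proof -
  obtain C where C: "C \<ge> 0" "\<And>n m. 1 \<le> m \<Longrightarrow> m \<le> n \<Longrightarrow> (1 - \<epsilon>) * (\<rho> - \<epsilon>) * harm m - C \<le> V n m"
    using V_lower[OF assms] by blast
  have "(1 - \<epsilon>) * (\<rho> - \<epsilon>) * H n - C * b 1 \<le> e n" if "n \<ge> 1" for n
  proof -
    have "(1 - \<epsilon>) * (\<rho> - \<epsilon>) * H n = (\<Sum>m\<in>{1..n}. (1 - \<epsilon>) * (\<rho> - \<epsilon>) * (1 / real m) * b m)"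
      by (simp add: H_def sum_distrib_left)
    also have "\<dots> \<le> e n + C * b 1"
      unfolding e_def
    proof (rule Abel_summation_mono[OF that b_antimono less_imp_le[OF b_pos]])
      fix m assume "1 \<le> m" "m \<le> n"
      have "(\<Sum>j\<in>{1..m}. (1 - \<epsilon>) * (\<rho> - \<epsilon>) * (1 / real j)) = (1 - \<epsilon>) * (\<rho> - \<epsilon>) * harm m"
        by (simp add: harm_eq_sum sum_distrib_left)
      also have "\<dots> \<le> (\<Sum>j\<in>{1..m}. U n j) + C"
        using C(2)[OF \<open>1 \<le> m\<close> \<open>m \<le> n\<close>] by (simp add: V_def)
      finally show "(\<Sum>j\<in>{1..m}. (1 - \<epsilon>) * (\<rho> - \<epsilon>) * (1 / real j)) \<le> (\<Sum>j\<in>{1..m}. U n j) + C" .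
    qed
    finally show ?thesis by simp
  qed
  moreover have "C * b 1 \<ge> 0" using C(1) less_imp_le[OF b_pos] by simp
  ultimately show ?thesis by blast
qed

lemma e_asymp_H:
  assumes lim: "(\<lambda>n. U n 1) \<longlonglongrightarrow> \<rho>" and sm: "summable (\<lambda>m. g m / real m)" and "\<rho> > 0"
    and H: "filterlim H at_top sequentially"
  shows "(\<lambda>n. e n / H n) \<longlonglongrightarrow> \<rho>"
proof (rule tendstoI)
  fix \<delta> :: real assume "\<delta> > 0"
  \<comment> \<open>Since \<open>(1 - \<epsilon>) * (\<rho> - \<epsilon>) \<ge> \<rho> - \<epsilon>
    * (1 + \<rho>)\<close>, the last bound limits the relative error to \<open>\<delta> / 2\<close>;
    the additive constants are absorbed by the growth of \<open>H\<close>.\<close>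
  define \<epsilon> where "\<epsilon> = min (1 / 2) (min (\<rho> / 2) (\<delta> / (2 * (1 + \<rho>))))"
  have \<epsilon>: "0 < \<epsilon>" "\<epsilon> < 1" "\<epsilon> < \<rho>" using \<open>\<rho> > 0\<close> \<open>\<delta> > 0\<close> by (auto simp: \<epsilon>_def)
  have "\<epsilon> \<le> \<delta> / (2 * (1 + \<rho>))" by (simp add: \<epsilon>_def)
  then have \<epsilon>\<delta>: "\<epsilon> * (1 + \<rho>) \<le> \<delta> / 2" using \<open>\<rho> > 0\<close> by (simp add: field_simps)
  obtain C1 where C1: "C1 \<ge> 0" "\<And>n. n \<ge> 1 \<Longrightarrow> e n \<le> (\<rho> + \<epsilon>) * H n + C1"
    using e_upper[OF lim \<epsilon>(1)] by blast
  obtain C2 where C2: "C2 \<ge> 0" "\<And>n. n \<ge> 1 \<Longrightarrow> (1 - \<epsilon>) * (\<rho> - \<epsilon>) * H n - C2 \<le> e n"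
    using e_lower[OF lim sm \<epsilon>] by blast
  have "\<forall>\<^sub>F n in sequentially. H n > 2 * (C1 + C2) / \<delta>"
    using H unfolding filterlim_at_top_dense by blast
  moreover have "\<forall>\<^sub>F n in sequentially. H n > 0"
    using H unfolding filterlim_at_top_dense by blast
  ultimately show "\<forall>\<^sub>F n in sequentially. dist (e n / H n) \<rho> < \<delta>"
    using eventually_ge_at_top[of 1]
  proof eventually_elim
    case (elim n)
    have C: "C1 + C2 < \<delta> / 2 * H n" using elim(1) \<open>\<delta> > 0\<close> by (simp add: field_simps)
    have "e n - \<rho> * H n \<le> \<epsilon> * H n + C1" using C1(2)[OF elim(3)] by (simp add: algebra_simps)
    also have "\<epsilon> * H n \<le> \<epsilon> * (1 + \<rho>) * H n" using \<epsilon> elim(2) \<open>\<rho> > 0\<close> by simp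
    finally have 1: "e n - \<rho> * H n \<le> \<epsilon> * (1 + \<rho>) * H n + C1" by simp
    have "\<rho> - \<epsilon> * (1 + \<rho>) \<le> (1 - \<epsilon>) * (\<rho> - \<epsilon>)" by (simp add: algebra_simps)
    then have "(\<rho> - \<epsilon> * (1 + \<rho>)) * H n \<le> (1 - \<epsilon>) * (\<rho> - \<epsilon>) * H n"
      using elim(2) by (intro mult_right_mono) auto
    then have 2: "- (\<epsilon> * (1 + \<rho>) * H n) - C2 \<le> e n - \<rho> * H n"
      using C2(2)[OF elim(3)] by (simp add: left_diff_distrib)
    have "\<epsilon> * (1 + \<rho>) * H n \<le> \<delta> / 2 * H n" using \<epsilon>\<delta> elim(2) by (intro mult_right_mono) auto
    then have "\<bar>e n - \<rho> * H n\<bar> < \<delta> * H n" using 1 2 C C1(1) C2(1) by (simp add: abs_less_iff)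
    then have "\<bar>e n - \<rho> * H n\<bar> / H n < \<delta>" using elim(2) by (simp add: field_simps)
    moreover have "e n / H n - \<rho> = (e n - \<rho> * H n) / H n" using elim(2) by (simp add: field_simps)
    ultimately show ?case using elim(2) by (simp add: dist_real_def abs_divide)
  qed
qed

lemma e_asymp:
  assumes lim: "(\<lambda>n. U n 1) \<longlonglongrightarrow> \<rho>" and sm: "summable (\<lambda>m. g m / real m)" and "\<rho> > 0"
    and H: "filterlim H at_top sequentially" and J: "\<forall>\<^sub>F n in sequentially. \<bar>J n - H n\<bar> \<le> C"
  shows "(\<lambda>n. e n / (\<rho> * J n)) \<longlonglongrightarrow> 1"
proof -
  have H_pos: "\<forall>\<^sub>F n in sequentially. H n > 0"
    using H unfolding filterlim_at_top_dense by blast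
  have "(\<lambda>n. (J n - H n) / H n) \<longlonglongrightarrow> 0"
  proof (rule Lim_null_comparison)
    show "\<forall>\<^sub>F n in sequentially. norm ((J n - H n) / H n) \<le> C / H n"
      using J H_pos by eventually_elim (simp add: abs_divide divide_right_mono)
    show "(\<lambda>n. C / H n) \<longlonglongrightarrow> 0"
      by (intro tendsto_divide_0[OF tendsto_const] filterlim_at_top_imp_at_infinity H)
  qed
  then have "(\<lambda>n. 1 + (J n - H n) / H n) \<longlonglongrightarrow> 1 + 0" by (intro tendsto_intros)
  then have JH: "(\<lambda>n. J n / H n) \<longlonglongrightarrow> 1 + 0"
    by (rule Lim_transform_eventually) (use H_pos in eventually_elim, simp add: field_simps)
  have "(\<lambda>n. (e n / H n) / (\<rho> * (J n / H n))) \<longlonglongrightarrow> \<rho> / (\<rho> * (1 + 0))"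
    using \<open>\<rho> > 0\<close> by (intro tendsto_intros JH e_asymp_H[OF lim sm _ H]) auto
  then have "(\<lambda>n. (e n / H n) / (\<rho> * (J n / H n))) \<longlonglongrightarrow> 1" using \<open>\<rho> > 0\<close> by simp
  then show ?thesis
    by (rule Lim_transform_eventually) (use H_pos in eventually_elim, simp)
qed

section \<open>Series for the logarithmic moments\<close>

lemma nn_integral_neg_ln:
  assumes [measurable]: "random_variable borel Z" and Z: "AE \<omega> in M. 0 < Z \<omega> \<and> Z \<omega> < 1"
  shows "(\<integral>\<^sup>+\<omega>. ennreal (- ln (Z \<omega>)) \<partial>M) = (\<Sum>m. ennreal (expectation (\<lambda>\<omega>. (1 - Z \<omega>) ^ m) / real m))"
proof -
  have int: "integrable M (\<lambda>\<omega>. (1 - Z \<omega>) ^ m)" for m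
  proof (rule integrable_const_bound[where B = 1])
    show "AE \<omega> in M. norm ((1 - Z \<omega>) ^ m) \<le> 1"
      using Z by eventually_elim (simp add: power_le_one)
  qed measurable
  \<comment> \<open>Expand \<open>- ln z\<close> in powers of \<open>1 - z\<close>. All terms are
    nonnegative, so sum and integral may be exchanged even if the value is infinite.\<close>
  have "(\<integral>\<^sup>+\<omega>. ennreal (- ln (Z \<omega>)) \<partial>M) = (\<integral>\<^sup>+\<omega>. (\<Sum>m. ennreal ((1 - Z \<omega>) ^ m / real m)) \<partial>M)"
  proof (rule nn_integral_cong_AE)
    show "AE \<omega> in M. ennreal (- ln (Z \<omega>)) = (\<Sum>m. ennreal ((1 - Z \<omega>) ^ m / real m))"
      using Z
    proof eventually_elim
      case (elim \<omega>)
      then have "(\<lambda>m. (1 - Z \<omega>) ^ m / real m) sums (- ln (Z \<omega>))" by (intro neg_ln_sums) auto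
      then show ?case
        using elim by (subst suminf_ennreal_eq[where x = "- ln (Z \<omega>)"]) auto
    qed
  qed
  also have "\<dots> = (\<Sum>m. \<integral>\<^sup>+\<omega>. ennreal ((1 - Z \<omega>) ^ m / real m) \<partial>M)"
    by (rule nn_integral_suminf) measurable
  also have "\<dots> = (\<Sum>m. ennreal (expectation (\<lambda>\<omega>. (1 - Z \<omega>) ^ m / real m)))"
  proof (intro suminf_cong nn_integral_eq_integral)
    show "integrable M (\<lambda>\<omega>. (1 - Z \<omega>) ^ m / real m)" for m using int by simp
    show "AE \<omega> in M. 0 \<le> (1 - Z \<omega>) ^ m / real m" for m
      using Z by eventually_elim simp
  qed
  finally show ?thesis by simp
qed

lemma mu_series: "(\<integral>\<^sup>+\<omega>. ennreal \<bar>ln (W \<omega>)\<bar> \<partial>M) = (\<Sum>m. ennreal (c m / real m))"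
proof -
  have "(\<integral>\<^sup>+\<omega>. ennreal \<bar>ln (W \<omega>)\<bar> \<partial>M) = (\<integral>\<^sup>+\<omega>. ennreal (- ln (W \<omega>)) \<partial>M)"
    by (intro nn_integral_cong_AE AE_W) (simp add: abs_if ln_less_zero)
  also have "\<dots> = (\<Sum>m. ennreal (c m / real m))"
    unfolding c_def by (rule nn_integral_neg_ln[OF W_measurable]) (rule AE_W, simp)
  finally show ?thesis .
qed

lemma nu_series: "(\<integral>\<^sup>+\<omega>. ennreal \<bar>ln (1 - W \<omega>)\<bar> \<partial>M) = (\<Sum>m. ennreal (b m / real m))"
proof -
  have "(\<integral>\<^sup>+\<omega>. ennreal \<bar>ln (1 - W \<omega>)\<bar> \<partial>M) = (\<integral>\<^sup>+\<omega>. ennreal (- ln (1 - W \<omega>)) \<partial>M)"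
    by (intro nn_integral_cong_AE AE_W) (simp add: abs_if ln_less_zero)
  also have "\<dots> = (\<Sum>m. ennreal (expectation (\<lambda>\<omega>. (1 - (1 - W \<omega>)) ^ m) / real m))"
    by (rule nn_integral_neg_ln) (measurable, rule AE_W, simp)
  finally show ?thesis by (simp add: b_def)
qed

text \<open>The series of \<open>g m / m\<close> is the mean of \<open>- ln (W / 4)\<close>, which
  exceeds \<mu> only by \<open>ln 4\<close>.\<close>

lemma summable_g:
  assumes "summable (\<lambda>m. c m / real m)" shows "summable (\<lambda>m. g m / real m)"
proof -
  have fin: "(\<integral>\<^sup>+\<omega>. ennreal \<bar>ln (W \<omega>)\<bar> \<partial>M) < \<top>"
    unfolding mu_series using less_imp_le[OF c_pos] by (subst suminf_ennreal2[OF _ assms]) auto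
  have "(\<Sum>m. ennreal (g m / real m)) = (\<integral>\<^sup>+\<omega>. ennreal (- ln (W \<omega> / 4)) \<partial>M)"
    unfolding g_def by (rule nn_integral_neg_ln[symmetric]) (measurable, rule AE_W, simp)
  also have "\<dots> = (\<integral>\<^sup>+\<omega>. ennreal (ln 4) + ennreal \<bar>ln (W \<omega>)\<bar> \<partial>M)"
    by (intro nn_integral_cong_AE AE_W) (simp add: ln_div abs_if ln_less_zero ennreal_plus[symmetric] del: ennreal_plus)
  also have "\<dots> = ennreal (ln 4) + (\<integral>\<^sup>+\<omega>. ennreal \<bar>ln (W \<omega>)\<bar> \<partial>M)"
    by (subst nn_integral_add) (auto simp: emeasure_space_1)
  also have "\<dots> < \<top>" using fin by (simp add: less_top)
  finally show ?thesis
    by (intro summable_suminf_not_top) (auto intro!: divide_nonneg_nonneg g_nonneg)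
qed

end

section \<open>Comparison of the Laplace integral with a sum\<close>

lemma nn_integral_antimono_bounds:
  fixes f :: "real \<Rightarrow> ennreal"
  assumes [measurable]: "f \<in> borel_measurable borel"
    and mono: "\<And>x y. 1 \<le> x \<Longrightarrow> x \<le> y \<Longrightarrow> f y \<le> f x" and "n \<ge> 1"
  shows "(\<Sum>k\<in>{2..n}. f (real k)) \<le> (\<integral>\<^sup>+y\<in>{1..real n}. f y \<partial>lborel) \<and>
    (\<integral>\<^sup>+y\<in>{1..real n}. f y \<partial>lborel) \<le> (\<Sum>k\<in>{1..<n}. f (real k))"
  using \<open>n \<ge> 1\<close>
proof (induction n rule: dec_induct)
  case base
  have "(\<integral>\<^sup>+y\<in>{1..real 1}. f y \<partial>lborel) = 0"
    by (simp add: nn_integral_indicator_singleton)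
  then show ?case by simp
next
  case (step n)
  define I where "I = (\<integral>\<^sup>+y\<in>{real n<..real (Suc n)}. f y \<partial>lborel)"
  have "(\<integral>\<^sup>+y\<in>{1..real (Suc n)}. f y \<partial>lborel)
      = (\<integral>\<^sup>+y. f y * indicator {1..real n} y + f y * indicator {real n<..real (Suc n)} y \<partial>lborel)"
    using step by (intro nn_integral_cong) (auto simp: indicator_def)
  also have "\<dots> = (\<integral>\<^sup>+y\<in>{1..real n}. f y \<partial>lborel) + I"
    unfolding I_def by (intro nn_integral_add) auto
  finally have split: "(\<integral>\<^sup>+y\<in>{1..real (Suc n)}. f y \<partial>lborel) = (\<integral>\<^sup>+y\<in>{1..real n}. f y \<partial>lborel) + I" .
  have const: "(\<integral>\<^sup>+y\<in>{real n<..real (Suc n)}. x \<partial>lborel) = x" for x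
    by (subst nn_integral_cmult_indicator) auto
  have "I \<le> (\<integral>\<^sup>+y\<in>{real n<..real (Suc n)}. f (real n) \<partial>lborel)"
    unfolding I_def using step mono by (intro nn_integral_mono) (auto simp: indicator_def)
  then have 1: "I \<le> f (real n)" by (simp only: const)
  have "(\<integral>\<^sup>+y\<in>{real n<..real (Suc n)}. f (real (Suc n)) \<partial>lborel) \<le> I"
    unfolding I_def using step mono by (intro nn_integral_mono) (auto simp: indicator_def)
  then have 2: "f (real (Suc n)) \<le> I" by (simp only: const)
  have "{2..Suc n} = insert (Suc n) {2..n}" using step by auto
  then have "(\<Sum>k\<in>{2..Suc n}. f (real k)) = (\<Sum>k\<in>{2..n}. f (real k)) + f (real (Suc n))"
    by (simp add: add.commute)
  moreover have "(\<Sum>k\<in>{1..<Suc n}. f (real k)) = (\<Sum>k\<in>{1..<n}. f (real k)) + f (real n)"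
    using step by simp
  ultimately show ?case using step.IH 1 2 unfolding split by (auto intro: add_mono)
qed

context multiplicative_walk
begin

text \<open>The lower bound is \<open>w \<le> exp (- (1 - w))\<close>. For the upper one put
  \<open>x = 1 - w\<close> and use \<open>exp (- x) \<le> 1 - x / 2\<close>: the series of
  \<open>((1 - x / 2) ^ k - (1 - x) ^ k) / k\<close> equals
  \<open>- ln (x / 2) + ln x = ln 2\<close> for every \<open>x\<close>, so the error does not depend
  on the law of \<open>W\<close>.\<close>

lemma Laplace_minus_b_bounds:
  assumes "n \<ge> 1"
  defines "\<phi> \<equiv> \<lambda>k::nat. expectation (\<lambda>\<omega>. exp (- real k * (1 - W \<omega>)))"
  shows "b k \<le> \<phi> k" and "(\<Sum>k\<in>{1..n}. \<phi> k / real k) \<le> H n + ln 2"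
proof -
  have int: "integrable M (\<lambda>\<omega>. exp (- real k * (1 - W \<omega>)))" for k
    by (rule integrable_W[where B = 1 and f = "\<lambda>w. exp (- real k * (1 - w))"])
       (auto intro!: mult_nonneg_nonneg)
  show "b k \<le> \<phi> k"
    unfolding b_def \<phi>_def
  proof (intro integral_mono_AE int integrable_power_W AE_W)
    fix w :: real assume w: "0 < w" "w < 1"
    have "w \<le> exp (- (1 - w))" using exp_ge_add_one_self[of "- (1 - w)"] by simp
    then have "w ^ k \<le> exp (- (1 - w)) ^ k" using w by (intro power_mono) auto
    also have "\<dots> = exp (- real k * (1 - w))" by (simp add: exp_of_nat_mult[symmetric] algebra_simps)
    finally show "w ^ k \<le> exp (- real k * (1 - w))" .
  qed
  have "(\<Sum>k\<in>{1..n}. \<phi> k / real k) - H n = expectation (\<lambda>\<omega>. \<Sum>k\<in>{1..n}. (exp (- real k * (1 - W \<omega>)) - W \<omega> ^ k) / real k)"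
    unfolding \<phi>_def H_def b_def using int
    by (subst Bochner_Integration.integral_sum) (auto simp: sum_subtractf diff_divide_distrib)
  also have "\<dots> \<le> expectation (\<lambda>_. ln 2)"
  proof (rule integral_mono_AE)
    show "AE \<omega> in M. (\<Sum>k\<in>{1..n}. (exp (- real k * (1 - W \<omega>)) - W \<omega> ^ k) / real k) \<le> ln 2"
    proof (rule AE_W)
      fix w :: real assume w: "0 < w" "w < 1"
      define x where "x = 1 - w"
      have x: "0 < x" "x < 1" "w = 1 - x" using w by (auto simp: x_def)
      have "(\<lambda>k. (1 - x / 2) ^ k / real k - (1 - x) ^ k / real k) sums (- ln (x / 2) - - ln x)"
        using x by (intro sums_diff neg_ln_sums) auto
      also have "- ln (x / 2) - - ln x = ln 2" using x by (simp add: ln_div)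
      finally have sums: "(\<lambda>k. (1 - x / 2) ^ k / real k - (1 - x) ^ k / real k) sums ln 2" .
      have "(\<Sum>k\<in>{1..n}. (exp (- real k * (1 - w)) - w ^ k) / real k)
          \<le> (\<Sum>k\<in>{1..n}. (1 - x / 2) ^ k / real k - (1 - x) ^ k / real k)"
      proof (rule sum_mono)
        fix k
        have "exp (- real k * (1 - w)) = exp (- x) ^ k"
          by (simp add: x_def exp_of_nat_mult[symmetric] algebra_simps)
        also have "\<dots> \<le> (1 - x / 2) ^ k" using x exp_neg_le[of x] by (intro power_mono) auto
        finally have "(exp (- real k * (1 - w)) - w ^ k) / real k \<le> ((1 - x / 2) ^ k - w ^ k) / real k"
          by (intro divide_right_mono) auto
        then show "(exp (- real k * (1 - w)) - w ^ k) / real k \<le> (1 - x / 2) ^ k / real k - (1 - x) ^ k / real k"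
          by (simp add: x(3) diff_divide_distrib)
      qed
      also have "\<dots> \<le> ln 2"
        unfolding sums_unique[OF sums]
      proof (rule sum_le_suminf)
        show "0 \<le> (1 - x / 2) ^ k / real k - (1 - x) ^ k / real k" for k
          using x by (auto intro!: divide_right_mono power_mono)
      qed (use sums in \<open>auto simp: sums_iff\<close>)
      finally show "(\<Sum>k\<in>{1..n}. (exp (- real k * (1 - w)) - w ^ k) / real k) \<le> ln 2" .
    qed
  qed (use int in \<open>auto intro!: integrable_sum integrable_diff integrable_divide\<close>)
  finally show "(\<Sum>k\<in>{1..n}. \<phi> k / real k) \<le> H n + ln 2" by (simp add: prob_space)
qed

text \<open>The witness \<open>J\<close> records that the integral is finite. The integral test
  loses at most the first summand, which is at most 1, and the passage from exponentials to powers
  at most \<open>ln 2\<close>; 2 covers either error.\<close>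

lemma Laplace_integral:
  assumes "n \<ge> 1"
  shows "\<exists>J. (\<integral>\<^sup>+y\<in>{1..real n}. (\<integral>\<^sup>+\<omega>. ennreal (exp (- y * (1 - W \<omega>))) \<partial>M) / ennreal y \<partial>lborel) = ennreal J \<and>
    0 \<le> J \<and> \<bar>J - H n\<bar> \<le> 2"
proof -
  define f where "f y = (\<integral>\<^sup>+\<omega>. ennreal (exp (- y * (1 - W \<omega>))) \<partial>M) / ennreal y" for y
  define I where "I = (\<integral>\<^sup>+y\<in>{1..real n}. f y \<partial>lborel)"
  define \<phi> where "\<phi> k = expectation (\<lambda>\<omega>. exp (- real k * (1 - W \<omega>)))" for k
  have \<phi>_nonneg: "\<phi> k \<ge> 0" for k unfolding \<phi>_def by (intro integral_nonneg_AE) auto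
  have [measurable]: "f \<in> borel_measurable borel" unfolding f_def by measurable
  have mono: "f y \<le> f x" if "1 \<le> x" "x \<le> y" for x y
    unfolding f_def divide_ennreal_def
  proof (rule mult_mono)
    show "(\<integral>\<^sup>+\<omega>. ennreal (exp (- y * (1 - W \<omega>))) \<partial>M) \<le> (\<integral>\<^sup>+\<omega>. ennreal (exp (- x * (1 - W \<omega>))) \<partial>M)"
      using that by (intro nn_integral_mono_AE AE_W ennreal_leI) (auto intro!: mult_right_mono)
    show "inverse (ennreal y) \<le> inverse (ennreal x)"
      using that by (simp add: inverse_ennreal le_imp_inverse_le ennreal_leI)
  qed auto
  have f_nat: "f (real k) = ennreal (\<phi> k / real k)" if "k \<ge> 1" for k
  proof -
    have "(\<integral>\<^sup>+\<omega>. ennreal (exp (- real k * (1 - W \<omega>))) \<partial>M) = ennreal (\<phi> k)"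
      unfolding \<phi>_def
    proof (rule nn_integral_eq_integral)
      show "integrable M (\<lambda>\<omega>. exp (- real k * (1 - W \<omega>)))"
        by (rule integrable_W[where B = 1 and f = "\<lambda>w. exp (- real k * (1 - w))"])
           (auto intro!: mult_nonneg_nonneg)
    qed auto
    then show ?thesis using that \<phi>_nonneg by (simp add: f_def divide_ennreal)
  qed
  have f_sum: "(\<Sum>k\<in>A. f (real k)) = ennreal (\<Sum>k\<in>A. \<phi> k / real k)" if "\<And>k. k \<in> A \<Longrightarrow> k \<ge> 1" for A
    using that f_nat \<phi>_nonneg by (subst sum_ennreal[symmetric]) auto
  have up: "I \<le> ennreal (\<Sum>k\<in>{1..<n}. \<phi> k / real k)" and lo: "ennreal (\<Sum>k\<in>{2..n}. \<phi> k / real k) \<le> I"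
    using nn_integral_antimono_bounds[of f, OF \<open>f \<in> borel_measurable borel\<close> mono \<open>n \<ge> 1\<close>] f_sum[of "{1..<n}"] f_sum[of "{2..n}"]
    by (auto simp: I_def)
  obtain J where J: "I = ennreal J" "0 \<le> J"
    using up by (cases I) (auto simp: top_unique)
  have "J \<le> (\<Sum>k\<in>{1..<n}. \<phi> k / real k)"
    using up J \<phi>_nonneg by (subst (asm) J(1), subst (asm) ennreal_le_iff) (auto intro!: sum_nonneg)
  also have "\<dots> \<le> (\<Sum>k\<in>{1..n}. \<phi> k / real k)" using \<phi>_nonneg by (intro sum_mono2) auto
  also have "\<dots> \<le> H n + ln 2" using Laplace_minus_b_bounds(2)[OF \<open>n \<ge> 1\<close>] by (simp add: \<phi>_def)
  also have "ln 2 \<le> (2 :: real)" using ln_le_minus_one[of 2] by simp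
  finally have "J \<le> H n + 2" by simp
  have "H n \<le> (\<Sum>k\<in>{1..n}. \<phi> k / real k)"
    unfolding H_def using Laplace_minus_b_bounds(1)[OF \<open>n \<ge> 1\<close>] by (intro sum_mono divide_right_mono) (auto simp: \<phi>_def)
  also have "\<dots> = \<phi> 1 + (\<Sum>k\<in>{2..n}. \<phi> k / real k)"
  proof -
    have "{1..n} = insert 1 {2..n}" using \<open>n \<ge> 1\<close> by auto
    then show ?thesis by simp
  qed
  also have "\<phi> 1 \<le> expectation (\<lambda>_. 1)"
    unfolding \<phi>_def
  proof (rule integral_mono_AE)
    show "integrable M (\<lambda>\<omega>. exp (- real 1 * (1 - W \<omega>)))"
      by (rule integrable_W[where B = 1 and f = "\<lambda>w. exp (- real 1 * (1 - w))"]) auto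
  qed (auto intro!: AE_W)
  also have "(\<Sum>k\<in>{2..n}. \<phi> k / real k) \<le> J"
    using lo J \<phi>_nonneg by (subst (asm) J(1), subst (asm) ennreal_le_iff) auto
  finally have "H n \<le> J + 2" by (simp add: prob_space)
  then show ?thesis using J \<open>J \<le> H n + 2\<close> unfolding I_def f_def by (intro exI[of _ J]) auto
qed

end

subsection \<open>Allocation of the balls\<close>

sublocale bernoulli_sieve \<subseteq> multiplicative_walk M W Ws
  by unfold_locales (fact W_measurable W_range Ws_indep Ws_distr)+

context bernoulli_sieve
begin

lemma factor_algebra_subalgebra: "subalgebra M (factor_algebra M Ws)"
  unfolding subalgebra_def
proof
  let ?f = "\<lambda>\<omega>. \<lambda>k\<in>{1..}. Ws k \<omega>"
  show "space (factor_algebra M Ws) = space M" by (simp add: factor_algebra_def)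
  have f: "?f \<in> measurable M (\<Pi>\<^sub>M k\<in>{1..}. borel)"
    by (intro measurable_restrict) (auto intro: Ws_measurable)
  have "?f \<in> space M \<rightarrow> space (\<Pi>\<^sub>M k\<in>{1..}. borel)"
    by (rule Pi_I) (rule measurable_space[OF f])
  then have "sets (factor_algebra M Ws) = {?f -` A \<inter> space M |A. A \<in> sets (\<Pi>\<^sub>M k\<in>{1..}. borel)}"
    unfolding factor_algebra_def by (rule sets_vimage_algebra2)
  then show "sets (factor_algebra M Ws) \<subseteq> sets M" using measurable_sets[OF f] by auto
qed

lemma X_measurable_UNIV: "i \<ge> 1 \<Longrightarrow> X i \<in> measurable M (count_space UNIV)"
  using measurable_compose[OF X_measurable, of i "\<lambda>x. x" "count_space UNIV"] by simp

lemma X_ge_1: "i \<ge> 1 \<Longrightarrow> \<omega> \<in> space M \<Longrightarrow> X i \<omega> \<ge> 1"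
  using measurable_space[OF X_measurable, of i \<omega>] by simp

lemma X_event [measurable]: "{\<omega> \<in> space M. \<forall>i\<in>{1..n}. P i (X i \<omega>)} \<in> events"
proof -
  have "{\<omega> \<in> space M. P i (X i \<omega>)} \<in> events" if "i \<in> {1..n}" for i
  proof -
    have "X i -` {x. P i x} \<inter> space M \<in> events"
      using that by (intro measurable_sets[OF X_measurable_UNIV]) auto
    also have "X i -` {x. P i x} \<inter> space M = {\<omega> \<in> space M. P i (X i \<omega>)}" by auto
    finally show ?thesis .
  qed
  then show ?thesis by (intro sets.sets_Collect_finite_All) auto
qed

lemma box_freq_Suc: "box_freq Ws (Suc k) \<omega> = Q k \<omega> * (1 - Ws (Suc k) \<omega>)"
proof -
  have "{1..<Suc k} = {1..k}" by auto
  then show ?thesis by (simp add: box_freq_def Q_def)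
qed

lemma box_freq_measurable [measurable]: "k \<ge> 1 \<Longrightarrow> random_variable borel (box_freq Ws k)"
proof -
  assume "k \<ge> 1"
  then obtain l where "k = Suc l" by (cases k) auto
  then show ?thesis by (simp add: box_freq_Suc[abs_def])
qed

lemma box_freq_range: "k \<ge> 1 \<Longrightarrow> AE \<omega> in M. 0 \<le> box_freq Ws k \<omega> \<and> box_freq Ws k \<omega> \<le> 1"
proof -
  assume "k \<ge> 1"
  then obtain l where l: "k = Suc l" by (cases k) auto
  have "AE \<omega> in M. Ws (Suc l) \<omega> \<in> {0<..<1}" by (rule Ws_range) simp
  with Q_range'[of l] show ?thesis
  proof eventually_elim
    case (elim \<omega>)
    then show ?case unfolding l box_freq_Suc by (auto intro!: mult_le_one)
  qed
qed

lemma prob_boxes_eq: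
  assumes "\<And>i. i \<in> {1..n} \<Longrightarrow> \<beta> i \<ge> 1"
  shows "prob {\<omega> \<in> space M. \<forall>i\<in>{1..n}. X i \<omega> = \<beta> i} = expectation (\<lambda>\<omega>. \<Prod>i\<in>{1..n}. box_freq Ws (\<beta> i) \<omega>)"
proof -
  interpret finite_measure_subalgebra M "factor_algebra M Ws"
    by unfold_locales (rule factor_algebra_subalgebra)
  let ?E = "{\<omega> \<in> space M. \<forall>i\<in>{1..n}. X i \<omega> = \<beta> i}"
  have E: "?E \<in> events" by (rule X_event)
  have int: "integrable M (indicator ?E :: 'a \<Rightarrow> real)"
    using E by (intro integrable_real_indicator) (auto simp: emeasure_eq_measure)
  have "prob ?E = expectation (indicator ?E)" using E by simp
  also have "\<dots> = expectation (real_cond_exp M (factor_algebra M Ws) (indicator ?E))"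
    using real_cond_exp_int(2)[OF int] by simp
  also have "\<dots> = expectation (\<lambda>\<omega>. \<Prod>i\<in>{1..n}. box_freq Ws (\<beta> i) \<omega>)"
    using assms by (intro integral_cong_AE X_cond_law borel_measurable_cond_exp2 borel_measurable_prod box_freq_measurable) auto
  finally show ?thesis .
qed

text \<open>Sum over all allocations of the \<open>n\<close> balls to \<open>B\<close>; the sum of
  the products factors into an \<open>n\<close>-th power. Finiteness of \<open>B\<close> keeps this
  a finite sum.\<close>

lemma prob_boxes_in:
  assumes "finite B" "B \<subseteq> {1..}"
  shows "prob {\<omega> \<in> space M. \<forall>i\<in>{1..n}. X i \<omega> \<in> B} = expectation (\<lambda>\<omega>. (\<Sum>j\<in>B. box_freq Ws j \<omega>) ^ n)"
proof -
  let ?P = "{1..n} \<rightarrow>\<^sub>E B"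
  let ?E = "\<lambda>\<beta>. {\<omega> \<in> space M. \<forall>i\<in>{1..n}. X i \<omega> = \<beta> i}"
  have fin: "finite ?P" using assms by (intro finite_PiE) auto
  have ge1: "\<beta> i \<ge> 1" if "\<beta> \<in> ?P" "i \<in> {1..n}" for \<beta> i
    using PiE_mem[OF that] assms by auto
  have "{\<omega> \<in> space M. \<forall>i\<in>{1..n}. X i \<omega> \<in> B} = (\<Union>\<beta>\<in>?P. ?E \<beta>)"
  proof (intro equalityI subsetI)
    fix \<omega> assume "\<omega> \<in> {\<omega> \<in> space M. \<forall>i\<in>{1..n}. X i \<omega> \<in> B}"
    then show "\<omega> \<in> (\<Union>\<beta>\<in>?P. ?E \<beta>)"
      by (intro UN_I[of "\<lambda>i\<in>{1..n}. X i \<omega>"]) auto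
  next
    fix \<omega> assume "\<omega> \<in> (\<Union>\<beta>\<in>?P. ?E \<beta>)"
    then obtain \<beta> where \<beta>: "\<beta> \<in> ?P" "\<omega> \<in> ?E \<beta>" by blast
    then have "X i \<omega> \<in> B" if "i \<in> {1..n}" for i using PiE_mem[OF \<beta>(1) that] that by simp
    then show "\<omega> \<in> {\<omega> \<in> space M. \<forall>i\<in>{1..n}. X i \<omega> \<in> B}" using \<beta> by simp
  qed
  moreover have "prob (\<Union>\<beta>\<in>?P. ?E \<beta>) = (\<Sum>\<beta>\<in>?P. prob (?E \<beta>))"
  proof (rule finite_measure_finite_Union[OF fin])
    show "disjoint_family_on ?E ?P"
      unfolding disjoint_family_on_def
    proof (intro ballI impI)
      fix \<beta> \<beta>' assume *: "\<beta> \<in> ?P" "\<beta>' \<in> ?P" "\<beta> \<noteq> \<beta>'"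
      then obtain i where "i \<in> {1..n}" "\<beta> i \<noteq> \<beta>' i" using PiE_ext[OF *(1,2)] by blast
      then show "?E \<beta> \<inter> ?E \<beta>' = {}" by force
    qed
  qed (use X_event in auto)
  moreover have "(\<Sum>\<beta>\<in>?P. prob (?E \<beta>)) = (\<Sum>\<beta>\<in>?P. expectation (\<lambda>\<omega>. \<Prod>i\<in>{1..n}. box_freq Ws (\<beta> i) \<omega>))"
    using ge1 by (intro sum.cong refl prob_boxes_eq) auto
  moreover have "\<dots> = expectation (\<lambda>\<omega>. \<Sum>\<beta>\<in>?P. \<Prod>i\<in>{1..n}. box_freq Ws (\<beta> i) \<omega>)"
  proof (rule Bochner_Integration.integral_sum[symmetric])
    fix \<beta> assume \<beta>: "\<beta> \<in> ?P"
    show "integrable M (\<lambda>\<omega>. \<Prod>i\<in>{1..n}. box_freq Ws (\<beta> i) \<omega>)"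
    proof (rule integrable_const_bound[where B = 1])
      have "AE \<omega> in M. \<forall>i\<in>{1..n}. 0 \<le> box_freq Ws (\<beta> i) \<omega> \<and> box_freq Ws (\<beta> i) \<omega> \<le> 1"
        using ge1[OF \<beta>] box_freq_range by (intro AE_finite_allI) auto
      then show "AE \<omega> in M. norm (\<Prod>i\<in>{1..n}. box_freq Ws (\<beta> i) \<omega>) \<le> 1"
      proof eventually_elim
        case (elim \<omega>)
        then have "0 \<le> (\<Prod>i\<in>{1..n}. box_freq Ws (\<beta> i) \<omega>)" "(\<Prod>i\<in>{1..n}. box_freq Ws (\<beta> i) \<omega>) \<le> 1"
          by (auto intro!: prod_nonneg prod_le_1)
        then show ?case by simp
      qed
    qed (use ge1[OF \<beta>] in \<open>auto intro!: borel_measurable_prod box_freq_measurable\<close>)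
  qed
  moreover have "(\<Sum>\<beta>\<in>?P. \<Prod>i\<in>{1..n}. box_freq Ws (\<beta> i) \<omega>) = (\<Sum>j\<in>B. box_freq Ws j \<omega>) ^ n" for \<omega>
    using assms prod_sum_PiE[of "{1..n}" "\<lambda>_. B" "\<lambda>_ j. box_freq Ws j \<omega>"] by simp
  ultimately show ?thesis by simp
qed

lemma sum_box_freq: "(\<Sum>j\<in>{1..N}. box_freq Ws j \<omega>) = 1 - Q N \<omega>"
proof (induction N)
  case 0
  show ?case by (simp add: Q_def)
next
  case (Suc N)
  then show ?case by (simp add: box_freq_Suc Q_Suc algebra_simps)
qed

lemma prob_le_box: "prob {\<omega> \<in> space M. \<forall>i\<in>{1..n}. X i \<omega> \<in> {1..k}} = expectation (\<lambda>\<omega>. (1 - Q k \<omega>) ^ n)"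
  by (subst prob_boxes_in) (auto simp: sum_box_freq[simplified])

text \<open>The admissible boxes form an infinite set, so the allocation is first confined to boxes
  up to \<open>N\<close>. Their total frequency is \<open>1 - Q N - f\<close>, and the resulting
  error is at most \<open>n\<close> times the mean of \<open>Q N\<close>, which decays
  geometrically.\<close>

lemma prob_box_empty:
  "prob {\<omega> \<in> space M. \<forall>i\<in>{1..n}. X i \<omega> \<noteq> Suc k} = expectation (\<lambda>\<omega>. (1 - Q k \<omega> * (1 - Ws (Suc k) \<omega>)) ^ n)"
proof (rule LIMSEQ_unique)
  define A where "A N = {\<omega> \<in> space M. \<forall>i\<in>{1..n}. X i \<omega> \<in> {1..N} - {Suc k}}" for N
  have UN: "(\<Union>N. A N) = {\<omega> \<in> space M. \<forall>i\<in>{1..n}. X i \<omega> \<noteq> Suc k}"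
  proof (intro equalityI subsetI)
    fix \<omega> assume \<omega>: "\<omega> \<in> {\<omega> \<in> space M. \<forall>i\<in>{1..n}. X i \<omega> \<noteq> Suc k}"
    \<comment> \<open>The sum of the box indices is a convenient upper bound for all of
      them.\<close>
    define N where "N = (\<Sum>i\<in>{1..n}. X i \<omega>)"
    have "X i \<omega> \<le> N" if "i \<in> {1..n}" for i unfolding N_def using that by (intro member_le_sum) auto
    then have "\<omega> \<in> A N" using \<omega> X_ge_1 by (auto simp: A_def)
    then show "\<omega> \<in> (\<Union>N. A N)" by blast
  qed (auto simp: A_def)
  have "(\<lambda>N. prob (A N)) \<longlonglongrightarrow> prob (\<Union>N. A N)"
  proof (rule finite_Lim_measure_incseq)
    show "range A \<subseteq> events" unfolding A_def using X_event by auto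
    show "incseq A" by (auto simp: incseq_def A_def)
  qed
  then show "(\<lambda>N. prob (A N)) \<longlonglongrightarrow> prob {\<omega> \<in> space M. \<forall>i\<in>{1..n}. X i \<omega> \<noteq> Suc k}" unfolding UN .
  define f where "f \<omega> = box_freq Ws (Suc k) \<omega>" for \<omega>
  have f_range: "AE \<omega> in M. 0 \<le> f \<omega> \<and> f \<omega> \<le> 1" unfolding f_def by (rule box_freq_range) simp
  have [measurable]: "random_variable borel f" unfolding f_def by measurable
  have diff: "\<bar>prob (A N) - expectation (\<lambda>\<omega>. (1 - f \<omega>) ^ n)\<bar> \<le> real n * b 1 ^ N" if "N > k" for N
  proof -
    have sum: "(\<Sum>j\<in>{1..N} - {Suc k}. box_freq Ws j \<omega>) = 1 - Q N \<omega> - f \<omega>" for \<omega>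
      using that sum_box_freq[of \<omega> N] by (subst sum_diff1) (auto simp: f_def)
    have "AE \<omega> in M. \<forall>j\<in>{1..N} - {Suc k}. 0 \<le> box_freq Ws j \<omega> \<and> box_freq Ws j \<omega> \<le> 1"
      using box_freq_range by (intro AE_finite_allI) auto
    then have range: "AE \<omega> in M. 0 \<le> 1 - Q N \<omega> - f \<omega>"
      by eventually_elim (subst sum[symmetric], auto intro!: sum_nonneg)
    have bound: "AE \<omega> in M. \<bar>(1 - Q N \<omega> - f \<omega>) ^ n\<bar> \<le> 1 \<and> \<bar>(1 - f \<omega>) ^ n\<bar> \<le> 1 \<and>
        \<bar>(1 - Q N \<omega> - f \<omega>) ^ n - (1 - f \<omega>) ^ n\<bar> \<le> real n * Q N \<omega>"
      using range f_range Q_range'[of N]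
    proof eventually_elim
      case (elim \<omega>)
      have "norm ((1 - Q N \<omega> - f \<omega>) ^ n - (1 - f \<omega>) ^ n) \<le> real n * norm (1 - Q N \<omega> - f \<omega> - (1 - f \<omega>))"
        using elim by (intro norm_power_diff) auto
      then show ?case using elim by (simp add: power_le_one)
    qed
    have int: "integrable M (\<lambda>\<omega>. (1 - Q N \<omega> - f \<omega>) ^ n)" "integrable M (\<lambda>\<omega>. (1 - f \<omega>) ^ n)"
    proof -
      show "integrable M (\<lambda>\<omega>. (1 - Q N \<omega> - f \<omega>) ^ n)"
        by (rule integrable_const_bound[where B = 1], use bound in eventually_elim, simp, measurable)
      show "integrable M (\<lambda>\<omega>. (1 - f \<omega>) ^ n)"
        by (rule integrable_const_bound[where B = 1], use bound in eventually_elim, simp, measurable)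
    qed
    have "prob (A N) - expectation (\<lambda>\<omega>. (1 - f \<omega>) ^ n) = expectation (\<lambda>\<omega>. (1 - Q N \<omega> - f \<omega>) ^ n - (1 - f \<omega>) ^ n)"
      unfolding A_def using int by (subst prob_boxes_in) (auto simp: sum[simplified])
    also have "\<bar>\<dots>\<bar> \<le> expectation (\<lambda>\<omega>. real n * Q N \<omega>)"
      using int bound integral_abs_bound by (intro order_trans[OF integral_abs_bound] integral_mono_AE) (auto elim: eventually_mono)
    also have "\<dots> = real n * b 1 ^ N" by (simp add: expectation_Q)
    finally show ?thesis .
  qed
  have "(\<lambda>N. prob (A N) - expectation (\<lambda>\<omega>. (1 - f \<omega>) ^ n)) \<longlonglongrightarrow> 0"
  proof (rule Lim_null_comparison)
    show "\<forall>\<^sub>F N in sequentially. norm (prob (A N) - expectation (\<lambda>\<omega>. (1 - f \<omega>) ^ n)) \<le> real n * b 1 ^ N"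
      using eventually_gt_at_top[of k] by eventually_elim (use diff in simp)
    show "(\<lambda>N. real n * b 1 ^ N) \<longlonglongrightarrow> 0"
      using b_pos[of 1] b_less_1[of 1] by (intro tendsto_mult_right_zero LIMSEQ_realpow_zero) auto
  qed
  then show "(\<lambda>N. prob (A N)) \<longlonglongrightarrow> expectation (\<lambda>\<omega>. (1 - Q k \<omega> * (1 - Ws (Suc k) \<omega>)) ^ n)"
    by (simp add: LIM_zero_iff f_def box_freq_Suc)
qed

text \<open>The second event implies the first, so the difference is the probability that box
  \<open>k + 1\<close> is empty while some ball lies beyond the first \<open>k\<close> boxes. Given
  \<open>m \<ge> 1\<close> such balls, all of them must also miss box \<open>k + 1\<close>, which
  has probability \<open>b m\<close>; the term \<open>m = 0\<close> is the subtracted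
  probability.\<close>

lemma prob_gap:
  "prob {\<omega> \<in> space M. \<forall>i\<in>{1..n}. X i \<omega> \<noteq> Suc k} - prob {\<omega> \<in> space M. \<forall>i\<in>{1..n}. X i \<omega> \<in> {1..k}}
    = (\<Sum>m\<in>{1..n}. q k n m * b m)"
proof -
  have int: "integrable M (\<lambda>\<omega>. Bernstein n m (Q k \<omega>) * Ws (Suc k) \<omega> ^ m)"
    and ex: "expectation (\<lambda>\<omega>. Bernstein n m (Q k \<omega>) * Ws (Suc k) \<omega> ^ m) = q k n m * b m" for m
    using Q_Ws_indep[where f = "Bernstein n m" and g = "\<lambda>w. w ^ m" and B = 1 and B' = 1 and k = k]
    by (auto simp: q_def b_def Bernstein_abs_le power_le_one)
  have "(1 - Q k \<omega> * (1 - Ws (Suc k) \<omega>)) ^ n = (\<Sum>m\<le>n. Bernstein n m (Q k \<omega>) * Ws (Suc k) \<omega> ^ m)" for \<omega>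
    by (simp add: sum_Bernstein_power)
  then have "prob {\<omega> \<in> space M. \<forall>i\<in>{1..n}. X i \<omega> \<noteq> Suc k}
      = expectation (\<lambda>\<omega>. \<Sum>m\<le>n. Bernstein n m (Q k \<omega>) * Ws (Suc k) \<omega> ^ m)"
    unfolding prob_box_empty by simp
  also have "\<dots> = (\<Sum>m\<le>n. q k n m * b m)"
    using int ex by (subst Bochner_Integration.integral_sum) auto
  also have "\<dots> = q k n 0 * b 0 + (\<Sum>m\<in>{1..n}. q k n m * b m)"
  proof -
    have "{..n} = insert 0 {1..n}" by auto
    then show ?thesis by simp
  qed
  also have "q k n 0 * b 0 = prob {\<omega> \<in> space M. \<forall>i\<in>{1..n}. X i \<omega> \<in> {1..k}}"
    unfolding prob_le_box by (simp add: q_def Bernstein_def)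
  finally show ?thesis by simp
qed

text \<open>Box \<open>k + 1\<close> counts exactly if it is empty and not all balls lie in the
  first \<open>k\<close> boxes. A ball beyond box \<open>k\<close> is then beyond box
  \<open>k + 1\<close> as well, so that box is within the range.\<close>

lemma num_empty_eq:
  assumes "n \<ge> 1" "\<omega> \<in> space M"
  shows "(of_nat (num_empty X n \<omega>) :: ennreal)
    = (\<Sum>k. indicator ({\<omega> \<in> space M. \<forall>i\<in>{1..n}. X i \<omega> \<noteq> Suc k} - {\<omega> \<in> space M. \<forall>i\<in>{1..n}. X i \<omega> \<in> {1..k}}) \<omega>)"
proof -
  define S where "S = (\<lambda>i. X i \<omega>) ` {1..n}"
  define m where "m = Max S"
  define K where "K = {k. Suc k \<le> m \<and> Suc k \<notin> S}"
  have S: "finite S" "S \<noteq> {}" using assms by (auto simp: S_def)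
  then have m: "m \<in> S" "\<And>x. x \<in> S \<Longrightarrow> x \<le> m" by (auto simp: m_def)
  have sub: "S \<subseteq> {1..m}" using m X_ge_1 assms by (auto simp: S_def)
  have "num_empty X n \<omega> = card ({1..m} - S)"
    unfolding num_empty_def max_occupied_def num_occupied_def S_def[symmetric] m_def[symmetric]
    using sub S by (simp add: card_Diff_subset)
  also have "{1..m} - S = Suc ` K"
    unfolding K_def by (auto simp: image_iff) (metis Suc_le_D One_nat_def)
  also have "card (Suc ` K) = card K" by (simp add: card_image)
  finally have card: "num_empty X n \<omega> = card K" .
  have "finite K" by (rule finite_subset[of _ "{..m}"]) (auto simp: K_def)
  have ind: "indicator ({\<omega> \<in> space M. \<forall>i\<in>{1..n}. X i \<omega> \<noteq> Suc k} - {\<omega> \<in> space M. \<forall>i\<in>{1..n}. X i \<omega> \<in> {1..k}}) \<omega>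
      = (indicator K k :: ennreal)" for k
  proof -
    have 1: "(\<forall>i\<in>{1..n}. X i \<omega> \<noteq> Suc k) \<longleftrightarrow> Suc k \<notin> S" unfolding S_def image_iff by metis
    have "(\<forall>i\<in>{1..n}. X i \<omega> \<in> {1..k}) \<longleftrightarrow> S \<subseteq> {1..k}" by (auto simp: S_def)
    also have "\<dots> \<longleftrightarrow> m \<le> k"
    proof
      show "S \<subseteq> {1..k} \<Longrightarrow> m \<le> k" using m by auto
      assume "m \<le> k"
      then have "{1..m} \<subseteq> {1..k}" by auto
      then show "S \<subseteq> {1..k}" using sub by (rule order_trans[rotated])
    qed
    finally show ?thesis using assms 1 by (auto simp: indicator_def K_def)
  qed
  have "(\<Sum>k. indicator K k :: ennreal) = (\<Sum>k\<in>K. indicator K k)"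
    using \<open>finite K\<close> by (intro suminf_finite) auto
  also have "\<dots> = of_nat (card K)" by (simp add: indicator_def)
  finally show ?thesis unfolding ind card by simp
qed

lemma expected_empty_eq: "n \<ge> 1 \<Longrightarrow> expected_empty M X n = ennreal (e n)"
proof -
  assume n: "n \<ge> 1"
  define A where "A k = {\<omega> \<in> space M. \<forall>i\<in>{1..n}. X i \<omega> \<noteq> Suc k}" for k
  define B where "B k = {\<omega> \<in> space M. \<forall>i\<in>{1..n}. X i \<omega> \<in> {1..k}}" for k
  have AB: "A k \<in> events" "B k \<in> events" "B k \<subseteq> A k" for k
    using X_event unfolding A_def B_def by auto
  have "expected_empty M X n = (\<integral>\<^sup>+\<omega>. (\<Sum>k. indicator (A k - B k) \<omega>) \<partial>M)"
    unfolding expected_empty_def A_def B_def using n by (intro nn_integral_cong num_empty_eq)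
  also have "\<dots> = (\<Sum>k. \<integral>\<^sup>+\<omega>. indicator (A k - B k) \<omega> \<partial>M)"
    using AB by (intro nn_integral_suminf) auto
  also have "\<dots> = (\<Sum>k. ennreal (\<Sum>m\<in>{1..n}. q k n m * b m))"
  proof (intro suminf_cong)
    fix k
    have "(\<integral>\<^sup>+\<omega>. indicator (A k - B k) \<omega> \<partial>M) = ennreal (prob (A k - B k))"
      using AB by (subst nn_integral_indicator) (auto simp: emeasure_eq_measure)
    also have "prob (A k - B k) = (\<Sum>m\<in>{1..n}. q k n m * b m)"
      using AB[of k] finite_measure_Diff[of "A k" "B k"] prob_gap[of n k] by (simp add: A_def B_def)
    finally show "(\<integral>\<^sup>+\<omega>. indicator (A k - B k) \<omega> \<partial>M) = ennreal (\<Sum>m\<in>{1..n}. q k n m * b m)" .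
  qed
  also have "\<dots> = ennreal (e n)"
  proof (rule suminf_ennreal_eq)
    show "0 \<le> (\<Sum>m\<in>{1..n}. q k n m * b m)" for k
      using q_nonneg less_imp_le[OF b_pos] by (intro sum_nonneg mult_nonneg_nonneg) auto
    show "(\<lambda>k. \<Sum>m\<in>{1..n}. q k n m * b m) sums e n"
      unfolding e_def U_def
      by (intro sums_sum sums_mult2 summable_sums q_summable) auto
  qed
  finally show ?thesis .
qed


section \<open>Transfer of the ratio bounds to extended lower and upper limits\<close>

lemma liminf_ratio_le:
  fixes E :: "nat \<Rightarrow> ennreal"
  assumes lim: "(\<lambda>n. U n 1) \<longlonglongrightarrow> 0" and E: "\<forall>\<^sub>F n in sequentially. E n = ennreal (e n)"
  shows "liminf (\<lambda>n. ennreal (b n / c n)) \<le> liminf E"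
  unfolding le_Liminf_iff
proof (intro allI impI)
  fix y assume y: "y < liminf (\<lambda>n. ennreal (b n / c n))"
  \<comment> \<open>The intermediate value is finite and leaves the gap \<open>z' - y'\<close> as
    the error allowed in \<open>e_eventually_ge\<close>.\<close>
  then obtain z where z: "y < z" "z < liminf (\<lambda>n. ennreal (b n / c n))" using dense by blast
  obtain y' where y': "y = ennreal y'" "y' \<ge> 0" using z(1) by (cases y) auto
  obtain z' where z': "z = ennreal z'" "z' \<ge> 0" using z(2) by (cases z) auto
  have "y' < z'" using z(1) y' z' by (simp add: ennreal_less_iff)
  have "\<forall>\<^sub>F n in sequentially. z < ennreal (b n / c n)"
    using z(2) by (rule less_LiminfD)
  then have "\<forall>\<^sub>F n in sequentially. z' * c n \<le> b n"
  proof eventually_elim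
    case (elim n)
    then have "z' < b n / c n" using z' by (simp add: ennreal_less_iff)
    then show ?case using c_pos[of n] by (simp add: field_simps)
  qed
  from e_eventually_ge[OF lim this z'(2), of "z' - y'"] \<open>y' < z'\<close>
  have "\<forall>\<^sub>F n in sequentially. y' < e n" by simp
  with E show "\<forall>\<^sub>F n in sequentially. y < E n"
    by eventually_elim (use y' in \<open>simp add: ennreal_less_iff\<close>)
qed

lemma limsup_ratio_ge:
  fixes E :: "nat \<Rightarrow> ennreal"
  assumes lim: "(\<lambda>n. U n 1) \<longlonglongrightarrow> 0" and E: "\<forall>\<^sub>F n in sequentially. E n = ennreal (e n)"
  shows "limsup E \<le> limsup (\<lambda>n. ennreal (b n / c n))"
  unfolding Limsup_le_iff
proof (intro allI impI)
  fix y assume y: "limsup (\<lambda>n. ennreal (b n / c n)) < y"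
  \<comment> \<open>As \<open>y\<close> itself may be infinite, two finite values are inserted below
    it; their distance is the error allowed in \<open>e_eventually_le\<close>.\<close>
  then obtain x where x: "limsup (\<lambda>n. ennreal (b n / c n)) < x" "x < y" using dense by blast
  then obtain z where z: "limsup (\<lambda>n. ennreal (b n / c n)) < z" "z < x" using dense by blast
  obtain x' where x': "x = ennreal x'" "x' \<ge> 0" using x(2) by (cases x) auto
  obtain z' where z': "z = ennreal z'" "z' \<ge> 0" using z(2) by (cases z) auto
  have "z' < x'" using z(2) x' z' by (simp add: ennreal_less_iff)
  have "\<forall>\<^sub>F n in sequentially. ennreal (b n / c n) < z"
    using z(1) by (rule Limsup_lessD)
  then have "\<forall>\<^sub>F n in sequentially. b n \<le> z' * c n"
  proof eventually_elim
    case (elim n)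
    then have "b n / c n < z'" using z' b_pos[of n] c_pos[of n] by (simp add: ennreal_less_iff)
    then show ?case using c_pos[of n] by (simp add: field_simps)
  qed
  from e_eventually_le[OF lim this z'(2), of "x' - z'"] \<open>z' < x'\<close>
  have "\<forall>\<^sub>F n in sequentially. e n < x'" by simp
  with E show "\<forall>\<^sub>F n in sequentially. E n < y"
  proof eventually_elim
    case (elim n)
    then have "E n \<le> x" using x' by (simp add: ennreal_leI)
    then show ?case using x(2) by simp
  qed
qed

lemma H_at_top:
  assumes "\<not> summable (\<lambda>m. b m / real m)"
  shows "filterlim H at_top sequentially"
  unfolding filterlim_at_top
proof
  fix Z
  have "\<exists>n. Z < H n"
  proof (rule ccontr)
    assume *: "\<not> ?thesis"
    have "summable (\<lambda>m. b m / real m)"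
    proof (rule bounded_imp_summable)
      show "b m / real m \<ge> 0" for m using b_pos[of m] by simp
      show "(\<Sum>m\<le>N. b m / real m) \<le> Z" for N
      proof -
        have "(\<Sum>m\<le>N. b m / real m) = H N" unfolding H_def by (intro sum.mono_neutral_right) auto
        then show ?thesis using * by (simp add: not_less)
      qed
    qed
    then show False using assms by simp
  qed
  then obtain n where n: "Z < H n" by blast
  have "H n \<le> H k" if "n \<le> k" for k
    unfolding H_def using that less_imp_le[OF b_pos] by (intro sum_mono2) auto
  then show "\<forall>\<^sub>F n in sequentially. Z \<le> H n"
    using n unfolding eventually_sequentially by (meson less_le_trans less_imp_le)
qed

end

theorem theorem7p1:
  fixes M :: "'a measure" and W :: "'a \<Rightarrow> real"
    and Ws :: "nat \<Rightarrow> 'a \<Rightarrow> real" and X :: "nat \<Rightarrow> 'a \<Rightarrow> nat"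
    and \<mu> \<nu> :: ennreal and r :: "nat \<Rightarrow> ennreal"
  assumes sieve: "bernoulli_sieve M W Ws X"
    and nonlat: "non_lattice (distr M borel (\<lambda>\<omega>. \<bar>ln (W \<omega>)\<bar>))"
    and mu: "\<mu> = (\<integral>\<^sup>+ \<omega>. ennreal \<bar>ln (W \<omega>)\<bar> \<partial>M)"
    and nu: "\<nu> = (\<integral>\<^sup>+ \<omega>. ennreal \<bar>ln (1 - W \<omega>)\<bar> \<partial>M)"
    and r: "\<And>n. r n = (\<integral>\<^sup>+ \<omega>. ennreal (W \<omega> ^ n) \<partial>M) / (\<integral>\<^sup>+ \<omega>. ennreal ((1 - W \<omega>) ^ n) \<partial>M)"
  shows "(\<mu> = \<infinity> \<and> \<nu> = \<infinity> \<longrightarrow>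
            liminf r \<le> liminf (expected_empty M X)
          \<and> liminf (expected_empty M X) \<le> limsup (expected_empty M X)
          \<and> limsup (expected_empty M X) \<le> limsup r
          \<and> (\<forall>\<gamma>\<^sub>0::ennreal. r \<longlonglongrightarrow> \<gamma>\<^sub>0 \<longrightarrow> expected_empty M X \<longlonglongrightarrow> \<gamma>\<^sub>0))
       \<and> (\<nu> < \<infinity> \<longrightarrow> expected_empty M X \<longlonglongrightarrow> \<nu> / \<mu>)
       \<and> (\<mu> < \<infinity> \<and> \<nu> = \<infinity> \<longrightarrow>
            (\<lambda>n. expected_empty M X n /
                 (1 / \<mu> * (\<integral>\<^sup>+ y\<in>{1..real n}.
                    (\<integral>\<^sup>+ \<omega>. ennreal (exp (- y * (1 - W \<omega>))) \<partial>M) / ennreal y \<partial>lborel)))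
            \<longlonglongrightarrow> 1)"
proof -
  interpret bernoulli_sieve M W Ws X by (rule sieve)
  obtain \<rho> where \<rho>: "(\<lambda>n. U n 1) \<longlonglongrightarrow> \<rho>"
    "summable (\<lambda>m. c m / real m) \<Longrightarrow> \<rho> * (\<Sum>m. c m / real m) = 1"
    "\<not> summable (\<lambda>m. c m / real m) \<Longrightarrow> \<rho> = 0"
    using U_1_limit[OF nonlat] by blast
  have nonneg: "0 \<le> c m / real m" "0 \<le> b m / real m" for m
    using c_pos[of m] b_pos[of m] by simp_all
  have mu': "\<mu> = (\<Sum>m. ennreal (c m / real m))" unfolding mu mu_series ..
  have nu': "\<nu> = (\<Sum>m. ennreal (b m / real m))" unfolding nu nu_series ..
  have mu_fin: "summable (\<lambda>m. c m / real m)" "\<mu> = ennreal (\<Sum>m. c m / real m)" if "\<mu> < \<infinity>"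
  proof -
    show "summable (\<lambda>m. c m / real m)"
      using that nonneg(1) unfolding mu' by (intro summable_suminf_not_top) auto
    then show "\<mu> = ennreal (\<Sum>m. c m / real m)"
      unfolding mu' using nonneg(1) by (intro suminf_ennreal2)
  qed
  have mu_inf: "\<not> summable (\<lambda>m. c m / real m)" if "\<mu> = \<infinity>"
    using that suminf_ennreal2[OF nonneg(1)] unfolding mu' by auto
  have nu_fin: "summable (\<lambda>m. b m / real m)" "\<nu> = ennreal (\<Sum>m. b m / real m)" if "\<nu> < \<infinity>"
  proof -
    show "summable (\<lambda>m. b m / real m)"
      using that nonneg(2) unfolding nu' by (intro summable_suminf_not_top) auto
    then show "\<nu> = ennreal (\<Sum>m. b m / real m)"
      unfolding nu' using nonneg(2) by (intro suminf_ennreal2)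
  qed
  have nu_inf: "\<not> summable (\<lambda>m. b m / real m)" if "\<nu> = \<infinity>"
    using that suminf_ennreal2[OF nonneg(2)] unfolding nu' by auto
  have E: "\<forall>\<^sub>F n in sequentially. expected_empty M X n = ennreal (e n)"
    using eventually_ge_at_top[of 1] by eventually_elim (rule expected_empty_eq)
  have r': "r = (\<lambda>n. ennreal (b n / c n))"
  proof
    fix n
    have "(\<integral>\<^sup>+ \<omega>. ennreal (W \<omega> ^ n) \<partial>M) = ennreal (b n)"
      unfolding b_def by (rule nn_integral_eq_integral) (simp, intro AE_W, simp)
    moreover have "(\<integral>\<^sup>+ \<omega>. ennreal ((1 - W \<omega>) ^ n) \<partial>M) = ennreal (c n)"
      unfolding c_def by (rule nn_integral_eq_integral) (simp, intro AE_W, simp)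
    ultimately show "r n = ennreal (b n / c n)"
      unfolding r using b_pos[of n] c_pos[of n] by (simp add: divide_ennreal)
  qed
  have "liminf r \<le> liminf (expected_empty M X)
      \<and> liminf (expected_empty M X) \<le> limsup (expected_empty M X)
      \<and> limsup (expected_empty M X) \<le> limsup r
      \<and> (\<forall>\<gamma>\<^sub>0::ennreal. r \<longlonglongrightarrow> \<gamma>\<^sub>0 \<longrightarrow> expected_empty M X \<longlonglongrightarrow> \<gamma>\<^sub>0)" if "\<mu> = \<infinity>"
  proof -
    have "(\<lambda>n. U n 1) \<longlonglongrightarrow> 0" using \<rho>(1) \<rho>(3)[OF mu_inf[OF that]] by simp
    note lo = liminf_ratio_le[OF this E, folded r'] and up = limsup_ratio_ge[OF this E, folded r']
    have mid: "liminf (expected_empty M X) \<le> limsup (expected_empty M X)"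
      by (rule Liminf_le_Limsup) simp
    have "expected_empty M X \<longlonglongrightarrow> \<gamma>\<^sub>0" if "r \<longlonglongrightarrow> \<gamma>\<^sub>0" for \<gamma>\<^sub>0
    proof (rule Liminf_eq_Limsup)
      have "liminf r = \<gamma>\<^sub>0" "limsup r = \<gamma>\<^sub>0"
        using that by (auto intro: lim_imp_Liminf lim_imp_Limsup)
      then show "liminf (expected_empty M X) = \<gamma>\<^sub>0" "limsup (expected_empty M X) = \<gamma>\<^sub>0"
        using lo mid up by (metis order_antisym order_trans)+
    qed simp
    then show ?thesis using lo mid up by blast
  qed
  moreover have "expected_empty M X \<longlonglongrightarrow> \<nu> / \<mu>" if "\<nu> < \<infinity>"
  proof -
    define Sb where "Sb = (\<Sum>m. b m / real m)"
    have "(\<lambda>n. ennreal (e n)) \<longlonglongrightarrow> ennreal (\<rho> * Sb)"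
      unfolding Sb_def by (intro tendsto_ennrealI e_limit_summable \<rho>(1) nu_fin(1) that)
    moreover have "ennreal (\<rho> * Sb) = \<nu> / \<mu>"
    proof (cases "\<mu> = \<infinity>")
      case True
      \<comment> \<open>Both sides vanish: \<rho> is 0, and a finite value divided by infinity is
        0.\<close>
      then show ?thesis using \<rho>(3)[OF mu_inf] nu_fin(2)[OF that] by simp
    next
      case False
      then have fin: "\<mu> < \<infinity>" by (simp add: less_top)
      define Sc where "Sc = (\<Sum>m. c m / real m)"
      have eq: "\<rho> * Sc = 1" unfolding Sc_def using \<rho>(2) mu_fin(1)[OF fin] by simp
      have "Sc \<ge> 0" unfolding Sc_def by (rule suminf_nonneg[OF mu_fin(1)[OF fin] nonneg(1)])
      then have "Sc > 0" using eq by (cases "Sc = 0") auto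
      have "Sb \<ge> 0" unfolding Sb_def by (rule suminf_nonneg[OF nu_fin(1)[OF that] nonneg(2)])
      have "\<rho> = 1 / Sc" using eq \<open>Sc > 0\<close> by (simp add: field_simps)
      then show ?thesis
        using \<open>Sc > 0\<close> \<open>Sb \<ge> 0\<close> unfolding nu_fin(2)[OF that] mu_fin(2)[OF fin] Sb_def[symmetric] Sc_def[symmetric]
        by (simp add: divide_ennreal)
    qed
    ultimately have "(\<lambda>n. ennreal (e n)) \<longlonglongrightarrow> \<nu> / \<mu>" by simp
    then show ?thesis
      by (rule Lim_transform_eventually) (use E in eventually_elim, simp)
  qed
  moreover have "(\<lambda>n. expected_empty M X n /
      (1 / \<mu> * (\<integral>\<^sup>+ y\<in>{1..real n}. (\<integral>\<^sup>+ \<omega>. ennreal (exp (- y * (1 - W \<omega>))) \<partial>M) / ennreal y \<partial>lborel)))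
      \<longlonglongrightarrow> 1" if fin: "\<mu> < \<infinity>" and inf: "\<nu> = \<infinity>"
  proof -
    define I where "I n = (\<integral>\<^sup>+ y\<in>{1..real n}. (\<integral>\<^sup>+ \<omega>. ennreal (exp (- y * (1 - W \<omega>))) \<partial>M) / ennreal y \<partial>lborel)" for n
    define Sc where "Sc = (\<Sum>m. c m / real m)"
    have eq: "\<rho> * Sc = 1" unfolding Sc_def using \<rho>(2) mu_fin(1)[OF fin] by simp
    have "Sc \<ge> 0" unfolding Sc_def by (rule suminf_nonneg[OF mu_fin(1)[OF fin] nonneg(1)])
    then have "Sc > 0" using eq by (cases "Sc = 0") auto
    have \<rho>_eq: "\<rho> = 1 / Sc" using eq \<open>Sc > 0\<close> by (simp add: field_simps)
    then have "\<rho> > 0" using \<open>Sc > 0\<close> by simp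
    have mu_inv: "1 / \<mu> = ennreal \<rho>"
      unfolding mu_fin(2)[OF fin] Sc_def[symmetric] \<rho>_eq
      using divide_ennreal[of 1 Sc] \<open>Sc > 0\<close> by simp
    have H: "filterlim H at_top sequentially" by (rule H_at_top[OF nu_inf[OF inf]])
    have "\<forall>n. \<exists>J. n \<ge> 1 \<longrightarrow> I n = ennreal J \<and> 0 \<le> J \<and> \<bar>J - H n\<bar> \<le> 2"
      using Laplace_integral unfolding I_def by blast
    then obtain J where J: "\<And>n. n \<ge> 1 \<Longrightarrow> I n = ennreal (J n) \<and> 0 \<le> J n \<and> \<bar>J n - H n\<bar> \<le> 2"
      by metis
    have "\<forall>\<^sub>F n in sequentially. \<bar>J n - H n\<bar> \<le> 2"
      using eventually_ge_at_top[of 1] by eventually_elim (use J in blast)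
    from e_asymp[OF \<rho>(1) summable_g[OF mu_fin(1)[OF fin]] \<open>\<rho> > 0\<close> H this]
    have "(\<lambda>n. ennreal (e n / (\<rho> * J n))) \<longlonglongrightarrow> ennreal 1" by (rule tendsto_ennrealI)
    then have "(\<lambda>n. expected_empty M X n / (1 / \<mu> * I n)) \<longlonglongrightarrow> ennreal 1"
    proof (rule Lim_transform_eventually)
      \<comment> \<open>Since \<open>J n\<close> is within 2 of \<open>H n\<close>, this makes
        \<open>J n\<close> positive, and the extended quotient agrees with the real one.\<close>
      have "\<forall>\<^sub>F n in sequentially. H n > 2" using H unfolding filterlim_at_top_dense by blast
      then show "\<forall>\<^sub>F n in sequentially. ennreal (e n / (\<rho> * J n)) = expected_empty M X n / (1 / \<mu> * I n)"
        using E eventually_ge_at_top[of 1]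
      proof eventually_elim
        case (elim n)
        have J_pos: "J n > 0" using J[OF elim(3)] elim(1) by linarith
        have "e n \<ge> 0"
          unfolding e_def using less_imp_le[OF b_pos] by (intro sum_nonneg mult_nonneg_nonneg U_nonneg) auto
        then show ?case
          using J[OF elim(3)] J_pos \<open>\<rho> > 0\<close> unfolding mu_inv elim(2)
          by (simp add: ennreal_mult[symmetric] divide_ennreal)
      qed
    qed
    then show ?thesis unfolding I_def by simp
  qed
  ultimately show ?thesis by blast
qed

end
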